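(* Let $T=(1,2,\ldots,d,t_d=t,0)$ with $d\ge t\ge 1$, $s=d+1-t$, and $\delta=\max\{t+1-s,0\}$. For a positive integer $k$ let $\mu(T,k)$ be the number of partitions $P$ of diagonal lengths $T$ with $\kappa(P)=k$. Then $$\mu(T,k)=\begin{cases}\binom{s+t}{s}-\binom{s+t}{s+\delta+1}, & \text{if } k=s+\delta \text{ (non-special } P),\\[4pt] \binom{s+t}{k}-\binom{s+t}{k+1}, & \text{if } s+\delta<k\le s+t,\\[4pt] 0,&\text{otherwise.}\end{cases}$$
   Context: Binomial coefficients $\binom{a}{b}$ with $b>a$ are $0$. Let $R=\mathsf k[x,y]$ with its standard grading, where the field $\mathsf k$ has characteristic zero, or is infinite of characteristic $p$ greater than the socle degree $d$ of $T$. For a partition $P=(p_1\ge\cdots\ge p_m)$ let $C_P$ be the set of monomials $x^ay^b$ with $0\le b<m$, $0\le a<p_{b+1}$, and $E_P$ the set of monomials not in $C_P$, and also the monomial ideal they generate. The diagonal lengths of $P$ is the Hilbert function of $R/E_P$. The initial monomial of a form is its monomial of highest $y$-degree with nonzero coefficient; $\mathrm{in}(I)$ is generated by the initial monomials of elements of $I$; the Jordan cell $\mathbb V(E_P)$ is the affine variety (an affine space) parametrizing all graded ideals $I\subset R$ with $\mathrm{in}(I)=E_P$. $\kappa(P)$ is the minimum number of generators of a generic ideal $I\in\mathbb V(E_P)$ (generic: in a suitable nonempty Zariski-open dense subset). $P$ is non-special if $\kappa(P)=\kappa(T)$, the minimum number of generators of a generic graded ideal $I$ with $R/I$ of Hilbert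 function $T$. *)

theory Defs
  imports "HOL-Computational_Algebra.Polynomial" "HOL-Analysis.Abstract_Topology"
begin

text \<open>
  The ring $R = k[x,y]$ is \<^typ>\<open>'k poly poly\<close>: the outer variable is $y$, the inner
  one is $x$, so the coefficient of $x^a y^b$ in \<open>f\<close> is \<open>coeff (coeff f b) a\<close>.
  Monomials are handled through their exponent pairs \<open>(a, b)\<close>.
\<close>

interpretation ideal: module "times :: 'r::comm_ring_1 \<Rightarrow> 'r \<Rightarrow> 'r"
  by standard (auto simp: algebra_simps)

interpretation kvs: vector_space "\<lambda>c::'k::field. smult [:c:] :: 'k poly poly \<Rightarrow> 'k poly poly"
  by standard (auto simp: smult_add_right smult_add_left[symmetric] one_pCons[symmetric] mult.commute)

definition bimonom :: "nat \<times> nat \<Rightarrow> 'k::field poly poly" where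
  "bimonom m = monom (monom 1 (fst m)) (snd m)"

definition bicoeff :: "'k::field poly poly \<Rightarrow> nat \<times> nat \<Rightarrow> 'k" where
  "bicoeff f m = coeff (coeff f (snd m)) (fst m)"

definition forms :: "nat \<Rightarrow> 'k::field poly poly set" where
  "forms n = {f. \<forall>a b. bicoeff f (a, b) \<noteq> 0 \<longrightarrow> a + b = n}"

definition hom_component :: "nat \<Rightarrow> 'k::field poly poly \<Rightarrow> 'k poly poly" where
  "hom_component n f = (\<Sum>b\<le>n. smult [:bicoeff f (n - b, b):] (bimonom (n - b, b)))"

definition graded_ideal :: "'k::field poly poly set \<Rightarrow> bool" where
  "graded_ideal I \<longleftrightarrow> ideal.subspace I \<and> (\<forall>f\<in>I. \<forall>n. hom_component n f \<in> I)"

text \<open>Hilbert function of $R/I$ for graded \<open>I\<close>: $\dim (R/I)_i = \dim R_i - \dim I_i$.\<close>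

definition hilbert :: "'k::field poly poly set \<Rightarrow> nat \<Rightarrow> nat" where
  "hilbert I i = kvs.dim (forms i :: 'k poly poly set) - kvs.dim (I \<inter> forms i)"

definition num_gens :: "'k::field poly poly set \<Rightarrow> nat" where
  "num_gens I = (LEAST n. \<exists>G. finite G \<and> card G = n \<and> ideal.span G = I)"


definition is_partition :: "nat list \<Rightarrow> bool" where
  "is_partition P \<longleftrightarrow> sorted_wrt (\<ge>) P \<and> 0 \<notin> set P"

definition C_exps :: "nat list \<Rightarrow> (nat \<times> nat) set" where
  "C_exps P = {(a, b). b < length P \<and> a < P ! b}"

definition E_ideal :: "nat list \<Rightarrow> 'k::field poly poly set" where
  "E_ideal P = ideal.span (bimonom ` (- C_exps P))"

definition diagonal_lengths :: "'k::field itself \<Rightarrow> nat list \<Rightarrow> nat \<Rightarrow> nat" where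
  "diagonal_lengths _ P = hilbert (E_ideal P :: 'k poly poly set)"

text \<open>
  For a nonzero form, \<^term>\<open>degree f\<close> is its \<open>y\<close>-degree, and the leading coefficient
  (in \<open>k[x]\<close>) is a nonzero multiple of a power of \<open>x\<close>.
\<close>

definition initial_exp :: "'k::field poly poly \<Rightarrow> nat \<times> nat" where
  "initial_exp f = (degree (lead_coeff f), degree f)"

definition initial_ideal :: "'k::field poly poly set \<Rightarrow> 'k poly poly set" where
  "initial_ideal I = ideal.span {bimonom (initial_exp f) | f n. f \<in> I \<inter> forms n \<and> f \<noteq> 0}"

definition jordan_cell :: "nat list \<Rightarrow> 'k::field poly poly set set" where
  "jordan_cell P = {I. graded_ideal I \<and> initial_ideal I = E_ideal P}"

definition graded_ideals :: "(nat \<Rightarrow> nat) \<Rightarrow> 'k::field poly poly set set" where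
  "graded_ideals T = {I. graded_ideal I \<and> hilbert I = T}"


text \<open>
  The Zariski topology on an affine space with coordinates indexed by \<open>'v\<close>
  is generated by the nonvanishing loci of polynomial functions.
\<close>

inductive_set poly_functions :: "(('v \<Rightarrow> 'k::field) \<Rightarrow> 'k) set" where
  const: "(\<lambda>_. c) \<in> poly_functions"
| coord: "(\<lambda>v. v i) \<in> poly_functions"
| add: "p \<in> poly_functions \<Longrightarrow> q \<in> poly_functions \<Longrightarrow> (\<lambda>v. p v + q v) \<in> poly_functions"
| mult: "p \<in> poly_functions \<Longrightarrow> q \<in> poly_functions \<Longrightarrow> (\<lambda>v. p v * q v) \<in> poly_functions"

definition zariski :: "('v \<Rightarrow> 'k::field) topology" where
  "zariski = topology_generated_by {{v. p v \<noteq> 0} | p. p \<in> poly_functions}"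

text \<open>
  If the monomials with exponents in \<open>C\<close> form a \<open>k\<close>-basis of $R/I$, then \<open>I\<close> is determined by
  the coefficients $c_{\mu\nu}$ ($\nu \in C$) in the congruences
  $\mu \equiv \sum_{\nu \in C} c_{\mu\nu}\, \nu \pmod I$, one for each monomial $\mu$.
\<close>

definition monomial_basis_mod :: "(nat \<times> nat) set \<Rightarrow> 'k::field poly poly set \<Rightarrow> bool" where
  "monomial_basis_mod C I \<longleftrightarrow> (\<forall>f. \<exists>!g. g \<in> kvs.span (bimonom ` C) \<and> f - g \<in> I)"

definition normal_form ::
    "(nat \<times> nat) set \<Rightarrow> 'k::field poly poly set \<Rightarrow> 'k poly poly \<Rightarrow> 'k poly poly" where
  "normal_form C I f = (THE g. g \<in> kvs.span (bimonom ` C) \<and> f - g \<in> I)"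

definition coords ::
    "(nat \<times> nat) set \<Rightarrow> 'k::field poly poly set \<Rightarrow> (nat \<times> nat) \<times> (nat \<times> nat) \<Rightarrow> 'k" where
  "coords C I = (\<lambda>(\<mu>, \<nu>). bicoeff (normal_form C I (bimonom \<mu>)) \<nu>)"

text \<open>
  For \<open>I\<close> in the Jordan cell of \<open>P\<close> the monomials of \<open>C_P\<close> are a basis of $R/I$, and the
  coordinates are, up to sign, the non-leading coefficients of the reduced basis
  of \<open>I\<close>. They identify the cell with a closed subset of an affine space.
\<close>

definition cell_topology :: "nat list \<Rightarrow> 'k::field poly poly set topology" where
  "cell_topology P = pullback_topology (jordan_cell P) (coords (C_exps P)) zariski"

text \<open>
  The variety of all graded ideals of Hilbert function \<open>T\<close>, glued from the affine charts on which a
  given set \<open>C\<close> of monomials is a basis of $R/I$ (these are the restrictions of the standard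
  charts of the Grassmannians of $R_i$).
\<close>

definition chart :: "(nat \<Rightarrow> nat) \<Rightarrow> (nat \<times> nat) set \<Rightarrow> 'k::field poly poly set set" where
  "chart T C = {I \<in> graded_ideals T. monomial_basis_mod C I}"

definition chart_topology ::
    "(nat \<Rightarrow> nat) \<Rightarrow> (nat \<times> nat) set \<Rightarrow> 'k::field poly poly set topology" where
  "chart_topology T C = pullback_topology (chart T C) (coords C) zariski"

definition graded_ideals_topology :: "(nat \<Rightarrow> nat) \<Rightarrow> 'k::field poly poly set topology" where
  "graded_ideals_topology T =
     topology (\<lambda>U. U \<subseteq> graded_ideals T \<and> (\<forall>C. openin (chart_topology T C) (U \<inter> chart T C)))"

lemma openin_graded_ideals_topology:
  fixes U :: "'k::field poly poly set set"
  shows "openin (graded_ideals_topology T) U \<longleftrightarrow>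
     U \<subseteq> graded_ideals T \<and> (\<forall>C. openin (chart_topology T C) (U \<inter> chart T C))"
proof -
  have "istopology (\<lambda>U :: 'k poly poly set set. U \<subseteq> graded_ideals T \<and>
          (\<forall>C. openin (chart_topology T C) (U \<inter> chart T C)))"
    unfolding istopology_def
  proof (intro conjI allI impI)
    fix A B :: "'k poly poly set set" and C
    assume "A \<subseteq> graded_ideals T \<and> (\<forall>C. openin (chart_topology T C) (A \<inter> chart T C))"
      and "B \<subseteq> graded_ideals T \<and> (\<forall>C. openin (chart_topology T C) (B \<inter> chart T C))"
    then have "openin (chart_topology T C) ((A \<inter> chart T C) \<inter> (B \<inter> chart T C))"
      by (simp only: openin_Int)
    moreover have "(A \<inter> chart T C) \<inter> (B \<inter> chart T C) = A \<inter> B \<inter> chart T C" by auto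
    ultimately show "openin (chart_topology T C) (A \<inter> B \<inter> chart T C)" by simp
  next
    fix K :: "'k poly poly set set set" and C
    assume "\<forall>A\<in>K. A \<subseteq> graded_ideals T \<and> (\<forall>C. openin (chart_topology T C) (A \<inter> chart T C))"
    then have "openin (chart_topology T C) (\<Union>A\<in>K. A \<inter> chart T C)"
      by (intro openin_Union) blast
    then show "openin (chart_topology T C) (\<Union>K \<inter> chart T C)" by (simp only: Int_Union2)
  qed blast+
  then show ?thesis
    unfolding graded_ideals_topology_def by (simp only: topology_inverse')
qed


text \<open>The number of generators of all ideals in a suitable nonempty dense open set.\<close>

definition generic_num_gens :: "'k::field poly poly set topology \<Rightarrow> nat" where
  "generic_num_gens X =
     (THE k. \<exists>U. openin X U \<and> U \<noteq> {} \<and> X closure_of U = topspace X \<and> (\<forall>I\<in>U. num_gens I = k))"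

definition kappa :: "'k::field itself \<Rightarrow> nat list \<Rightarrow> nat" where
  "kappa _ P = generic_num_gens (cell_topology P :: 'k poly poly set topology)"

definition kappa_hilbert :: "'k::field itself \<Rightarrow> (nat \<Rightarrow> nat) \<Rightarrow> nat" where
  "kappa_hilbert _ T = generic_num_gens (graded_ideals_topology T :: 'k poly poly set topology)"

definition non_special :: "'k::field itself \<Rightarrow> nat list \<Rightarrow> bool" where
  "non_special K P \<longleftrightarrow> kappa K P = kappa_hilbert K (diagonal_lengths K P)"

definition mu :: "'k::field itself \<Rightarrow> (nat \<Rightarrow> nat) \<Rightarrow> nat \<Rightarrow> nat" where
  "mu K T k = card {P. is_partition P \<and> diagonal_lengths K P = T \<and> kappa K P = k}"

text \<open>The sequence $(1, 2, \ldots, d, t, 0, 0, \ldots)$, with \<open>t\<close> in degree \<open>d\<close>.\<close>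

definition T_seq :: "nat \<Rightarrow> nat \<Rightarrow> nat \<Rightarrow> nat" where
  "T_seq d t i = (if i < d then i + 1 else if i = d then t else 0)"

end

theory Submission
  imports Defs
begin

text \<open>
  Let $s = d + 1 - t$. A graded ideal $I$ with Hilbert function $T$ consists of an
  $s$-dimensional space $V$ of forms of degree $d$ together with all forms of higher degree.
  Its minimal generators are a basis of $V$ and a basis of $R_{d+1}$ modulo $R_1 V$, so there are
  $s + (d + 2 - \dim R_1 V)$ of them (\<open>num_gens_top_ideal\<close>), and a generic number of generators
  amounts to a maximal value of $\dim R_1 V$.

  A partition $P$ of diagonal lengths $T$ is given by the set $S \subseteq \{0, \ldots, d\}$ of the
  $y$-degrees of the monomials of degree $d$ in $E_P$; it has $s$ elements, and every $s$-element set
  occurs (\<open>bij_betw_pivots\<close>). The Jordan cell of $P$ consists of the $V$ whose nonzero elements have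
  exactly the $y$-degrees in $S$ (\<open>jordan_cell_eq\<close>). Build such a $V$ by adding one form at a time, in
  the order of the $y$-degrees. A new form $f$ of $y$-degree $n$ adds at most the two dimensions of
  $xf$ and $yf$ to $R_1 V$, and the result lies in the space of forms of $y$-degree at most $n + 1$.
  A greedy choice of $f$ attains the smaller of these two bounds at every step. Therefore the least
  codimension of $R_1 V$ is the final position \<open>gap\<close> of a walk that starts at $1$, goes up when
  $n \notin S$, and goes down when $n \in S$ unless it is at $0$; and $\kappa(P)$ is $s$ plus this
  position (\<open>kappa_eq_card_plus_gap\<close>).

  Without the reflection at $0$, a walk with $s$ down-steps among $n$ steps would end at $n + 1 - 2s$.
  For every $m$ above this value, and for $m = 0$, exactly $\binom{n}{s+m}$ of these walks end at
  height at least $m$: Pascal's rule is the case distinction on the last step (\<open>card_gap_ge\<close>).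
  The formula for $\mu$ is the difference of these counts for consecutive $m$.

  It remains to see that the maximal value of $\dim R_1 V$ is the generic one. Cells and charts have
  coordinates that range over a set closed under affine lines. Over an infinite field, two
  polynomials neither of which vanishes identically on a line have a common nonvanishing point on it,
  so nonempty open sets meet (\<open>pullback_zariski_irreducible\<close>).
  The condition that $\dim R_1 V$ is large is open, because elimination without division produces a
  polynomial that certifies linear independence (\<open>indep_family_open\<close>). Finally, every chart of the variety of all ideals contains a $V$ with $R_1 V$
  as large as possible: join a basis of such a $V$ by a line to the monomials that the chart prescribes
  (\<open>chart_meets_max_rank\<close>).
\<close>

section \<open>Dimensions of finite-dimensional subspaces\<close>

text \<open>
  For a ring acting on itself this rule associates products in the direction opposite to
  \<open>mult.assoc\<close>, and the simplifier would loop with both of them.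
\<close>

declare ideal.scale_scale [simp del]

text \<open>
  The space of all polynomials is infinite-dimensional, so the following facts ask for a finite
  set \<open>B\<close> whose span contains the subspaces that are compared.
\<close>

lemma (in vector_space) dim_mono_finite:
  assumes "U \<subseteq> span W" "W \<subseteq> span B" "finite B"
  shows "dim U \<le> dim W"
proof -
  obtain A where A: "A \<subseteq> W" "independent A" "W \<subseteq> span A" "card A = dim W"
    using basis_exists by blast
  have "finite A"
    using independent_span_bound[OF assms(3) A(2)] A(1) assms(2) by blast
  moreover have "U \<subseteq> span A"
    using assms(1) A(3) span_mono span_span by blast
  ultimately show ?thesis
    using dim_le_card A(4) by metis
qed

lemma (in vector_space) independent_card_le_dim_finite:
  assumes "independent A" "A \<subseteq> W" "W \<subseteq> span B" "finite B"
  shows "card A \<le> dim W"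
  using dim_mono_finite[of A W B] assms dim_eq_card_independent span_superset by fastforce

lemma (in vector_space) dim_insert_le_finite:
  assumes "W \<subseteq> span B" "finite B"
  shows "dim (insert w W) \<le> Suc (dim W)"
proof -
  obtain A where A: "A \<subseteq> W" "independent A" "W \<subseteq> span A" "card A = dim W"
    using basis_exists by blast
  have "finite A"
    using independent_span_bound[OF assms(2) A(2)] A(1) assms(1) by blast
  moreover have "insert w W \<subseteq> span (insert w A)"
    using A(3) span_mono[of A "insert w A"] span_base by blast
  ultimately have "dim (insert w W) \<le> card (insert w A)"
    by (intro dim_le_card) auto
  then show ?thesis
    using A(4) card_insert_le_m1 \<open>finite A\<close> by (metis card_insert_if le_SucI le_refl order_trans)
qed

lemma (in vector_space) dim_insert_notin_finite:
  assumes "W \<subseteq> span B" "finite B" "w \<notin> span W"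
  shows "dim (insert w W) = Suc (dim W)"
proof -
  obtain A where A: "A \<subseteq> W" "independent A" "W \<subseteq> span A" "card A = dim W"
    using basis_exists by blast
  have fin: "finite A"
    using independent_span_bound[OF assms(2) A(2)] A(1) assms(1) by blast
  have w: "w \<notin> span A"
    using assms(3) span_mono[OF A(1)] by blast
  then have "independent (insert w A)"
    using A(2) independent_insertI by blast
  moreover have "insert w A \<subseteq> insert w W" using A(1) by blast
  moreover have "insert w W \<subseteq> span (insert w B)"
    using assms(1) span_mono[of B "insert w B"] span_base by blast
  ultimately have "card (insert w A) \<le> dim (insert w W)"
    using assms(2) by (intro independent_card_le_dim_finite[where B = "insert w B"]) auto
  moreover have "w \<notin> A" using w span_base by blast
  ultimately show ?thesis
    using A(4) fin dim_insert_le_finite[OF assms(1,2), of w] by simp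
qed

lemma (in vector_space) subspace_eq_of_dim_le:
  assumes "subspace U" "U \<subseteq> W" "W \<subseteq> span B" "finite B" "dim W \<le> dim U"
  shows "U = W"
proof (rule ccontr)
  assume "U \<noteq> W"
  then obtain w where w: "w \<in> W" "w \<notin> span U"
    using assms(1,2) span_eq_iff by blast
  have "Suc (dim U) = dim (insert w U)"
    using dim_insert_notin_finite[of U B w] w assms by auto
  also have "\<dots> \<le> dim W"
    using w assms(2-4) span_superset[of W] by (intro dim_mono_finite[of _ _ B]) auto
  finally show False using assms(5) by simp
qed

lemma (in vector_space) independent_Un:
  assumes "finite A" "independent A" "independent A'" "span A \<inter> span A' \<subseteq> {0}"
  shows "independent (A \<union> A')"
  using assms
proof (induction A rule: finite_induct)
  case (insert a A)
  have A: "independent A" "a \<notin> span A"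
    using insert.prems(1) insert.hyps(2) independent_insert by auto
  have "a \<notin> span (A \<union> A')"
  proof
    assume "a \<in> span (A \<union> A')"
    then obtain u w where a: "a = u + w" "u \<in> span A" "w \<in> span A'"
      by (auto simp: span_Un)
    have "u \<in> span (insert a A)" "a \<in> span (insert a A)"
      using a(2) span_mono[of A "insert a A"] span_base by blast+
    then have "a - u \<in> span (insert a A)" by (rule span_diff[rotated])
    moreover have "a - u = w" using a(1) by simp
    ultimately have "w = 0" using insert.prems(3) a(3) by blast
    then show False using a A(2) by simp
  qed
  moreover have "independent (A \<union> A')"
    using insert.IH A(1) insert.prems span_mono[of A "insert a A"] by blast
  ultimately show ?case using independent_insertI by simp
qed simp

lemma (in vector_space) dim_add_le_dim_Un:
  assumes "subspace U" "subspace W" "U \<inter> W \<subseteq> {0}" "U \<union> W \<subseteq> span B" "finite B"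
  shows "dim U + dim W \<le> dim (U \<union> W)"
proof -
  obtain A where A: "A \<subseteq> U" "independent A" "U \<subseteq> span A" "card A = dim U"
    using basis_exists by blast
  obtain A' where A': "A' \<subseteq> W" "independent A'" "W \<subseteq> span A'" "card A' = dim W"
    using basis_exists by blast
  have fin: "finite A" "finite A'"
    using independent_span_bound[OF assms(5)] A(1,2) A'(1,2) assms(4) by blast+
  have sub: "span A \<subseteq> U" "span A' \<subseteq> W"
    using span_minimal A(1) A'(1) assms(1,2) by blast+
  then have "independent (A \<union> A')"
    using independent_Un[OF fin(1) A(2) A'(2)] assms(3) by blast
  then have "card (A \<union> A') \<le> dim (U \<union> W)"
    using independent_card_le_dim_finite[OF _ _ assms(4,5)] A(1) A'(1) by blast
  moreover have "A \<inter> A' = {}"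
    using A(1,2) A'(1) assms(3) dependent_zero by blast
  ultimately show ?thesis
    using card_Un_disjoint[OF fin] A(4) A'(4) by simp
qed

lemma (in vector_space) dim_Un_le:
  assumes "finite A" "W \<subseteq> span B" "finite B"
  shows "dim (A \<union> W) \<le> card A + dim W"
proof -
  obtain A' where A': "A' \<subseteq> W" "independent A'" "W \<subseteq> span A'" "card A' = dim W"
    using basis_exists by blast
  have fin: "finite A'"
    using independent_span_bound[OF assms(3)] A'(1,2) assms(2) by blast
  have "A \<union> W \<subseteq> span (A \<union> A')"
    using A'(3) span_mono[of A' "A \<union> A'"] span_superset[of "A \<union> A'"] by blast
  then have "dim (A \<union> W) \<le> card (A \<union> A')"
    using fin assms(1) by (intro dim_le_card) auto
  also have "\<dots> \<le> card A + card A'" by (rule card_Un_le)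
  finally show ?thesis using A'(4) by simp
qed

lemma span_image_coefficients:
  assumes "finite S" "inj_on z S" "f \<in> kvs.span (z ` S)"
  shows "\<exists>c. f = (\<Sum>b\<in>S. smult [:c b:] (z b :: 'k::field poly poly))"
proof -
  obtain u where "f = (\<Sum>x\<in>z ` S. smult [:u x:] x)"
    using assms(3) kvs.span_finite[of "z ` S"] assms(1) by auto
  then have "f = (\<Sum>b\<in>S. smult [:u (z b):] (z b))" by (simp add: sum.reindex[OF assms(2)])
  then show ?thesis by (intro exI[of _ "\<lambda>b. u (z b)"])
qed

section \<open>Coefficients, forms and supports\<close>

lemma bicoeff_0 [simp]: "bicoeff 0 m = 0"
  and bicoeff_add [simp]: "bicoeff (f + g) m = bicoeff f m + bicoeff g m"
  and bicoeff_diff [simp]: "bicoeff (f - g) m = bicoeff f m - bicoeff g m"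
  and bicoeff_smult [simp]: "bicoeff (smult [:c:] f) m = c * bicoeff f m"
  by (simp_all add: bicoeff_def)

lemma bicoeff_sum [simp]: "bicoeff (sum f A) m = (\<Sum>i\<in>A. bicoeff (f i) m)"
  by (induction A rule: infinite_finite_induct) simp_all

lemma bicoeff_bimonom [simp]: "bicoeff (bimonom m) m' = (if m = m' then 1 else 0)"
  by (cases m; cases m') (simp add: bicoeff_def bimonom_def coeff_monom)

lemma bipoly_eqI: "(\<And>m. bicoeff f m = bicoeff g m) \<Longrightarrow> f = g"
  unfolding bicoeff_def by (intro poly_eqI) (metis fst_conv snd_conv)

lemma finite_bicoeff_support: "finite {m. bicoeff f m \<noteq> 0}"
proof (rule finite_subset)
  show "{m. bicoeff f m \<noteq> 0} \<subseteq> (\<lambda>(b, a). (a, b)) ` (SIGMA b:{..degree f}. {..degree (coeff f b)})"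
  proof
    fix m assume "m \<in> {m. bicoeff f m \<noteq> 0}"
    then have *: "coeff (coeff f (snd m)) (fst m) \<noteq> 0" by (simp add: bicoeff_def)
    then have "snd m \<le> degree f" "fst m \<le> degree (coeff f (snd m))"
      by (metis coeff_0 le_degree, metis le_degree)
    then show "m \<in> (\<lambda>(b, a). (a, b)) ` (SIGMA b:{..degree f}. {..degree (coeff f b)})"
      by (intro image_eqI[of _ _ "(snd m, fst m)"]) auto
  qed
qed auto

lemma bipoly_eq_sum_bimonom:
  assumes "finite A" "\<And>m. bicoeff f m \<noteq> 0 \<Longrightarrow> m \<in> A"
  shows "f = (\<Sum>m\<in>A. smult [:bicoeff f m:] (bimonom m))"
proof (rule bipoly_eqI)
  fix m
  have "(\<Sum>i\<in>A. bicoeff (smult [:bicoeff f i:] (bimonom i)) m) = (\<Sum>i\<in>A. if m = i then bicoeff f m else 0)"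
    by (intro sum.cong) auto
  then show "bicoeff f m = bicoeff (\<Sum>m\<in>A. smult [:bicoeff f m:] (bimonom m)) m"
    unfolding bicoeff_sum using assms(1) assms(2)[of m]
    by (cases "m \<in> A") (auto simp: sum.delta)
qed

text \<open>
  Most subspaces below are given by the monomials that may occur in their elements.
\<close>

definition supported :: "(nat \<times> nat) set \<Rightarrow> 'k::field poly poly set" where
  "supported C = {f. \<forall>m. bicoeff f m \<noteq> 0 \<longrightarrow> m \<in> C}"

lemma supportedI: "(\<And>a b. bicoeff f (a, b) \<noteq> 0 \<Longrightarrow> (a, b) \<in> C) \<Longrightarrow> f \<in> supported C"
  by (auto simp: supported_def)

lemma supportedD: "f \<in> supported C \<Longrightarrow> m \<notin> C \<Longrightarrow> bicoeff f m = 0"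
  unfolding supported_def by blast

lemma bimonom_in_supported [simp]: "bimonom m \<in> supported C \<longleftrightarrow> m \<in> C"
  unfolding supported_def by (simp del: split_paired_All)

lemma subspace_supported: "kvs.subspace (supported C)"
  unfolding supported_def kvs.subspace_def
  by (simp del: split_paired_All) (metis add.right_neutral)

lemma span_bimonom: "kvs.span (bimonom ` C) = (supported C :: 'k::field poly poly set)"
proof (rule kvs.span_subspace)
  show "supported C \<subseteq> kvs.span (bimonom ` C :: 'k poly poly set)"
  proof
    fix f :: "'k poly poly" assume f: "f \<in> supported C"
    have "(\<Sum>m | bicoeff f m \<noteq> 0. smult [:bicoeff f m:] (bimonom m)) \<in> kvs.span (bimonom ` C)"
      using f by (intro kvs.span_sum kvs.span_scale kvs.span_base) (auto simp: supported_def)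
    then show "f \<in> kvs.span (bimonom ` C)"
      using bipoly_eq_sum_bimonom[OF finite_bicoeff_support[of f], of f] by simp
  qed
qed (auto simp: subspace_supported)

lemma inj_bimonom: "inj bimonom"
proof (rule injI)
  fix m m' :: "nat \<times> nat" assume "bimonom m = (bimonom m' :: 'a poly poly)"
  then have "bicoeff (bimonom m) m' = (bicoeff (bimonom m') m' :: 'a)" by simp
  then show "m = m'" by (simp split: if_splits)
qed

lemma dim_supported:
  assumes "finite C"
  shows "kvs.dim (supported C :: 'k::field poly poly set) = card C"
proof -
  have "kvs.independent (bimonom ` C :: 'k poly poly set)"
    unfolding kvs.dependent_def
  proof safe
    fix m assume "m \<in> C"
      and "(bimonom m :: 'k poly poly) \<in> kvs.span (bimonom ` C - {bimonom m})"
    moreover have "bimonom ` C - {bimonom m} = (bimonom ` (C - {m}) :: 'k poly poly set)"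
      by (simp add: image_set_diff[OF inj_bimonom])
    ultimately show False by (simp add: span_bimonom)
  qed
  then show ?thesis
    using kvs.dim_span_eq_card_independent[of "bimonom ` C :: 'k poly poly set"]
      card_image[OF inj_on_subset[OF inj_bimonom]] span_bimonom by (metis subset_UNIV)
qed

lemma supported_mono: "C \<subseteq> D \<Longrightarrow> supported C \<subseteq> supported D"
  by (auto simp: supported_def)

lemma forms_eq_supported: "forms n = supported {m. fst m + snd m = n}"
  by (auto simp: forms_def supported_def)

lemma subspace_forms: "kvs.subspace (forms n)"
  by (simp add: forms_eq_supported subspace_supported)

text \<open>
  The exponents of the monomial of degree \<open>d\<close> and $y$-degree \<open>b\<close>.
  Indexing the monomials of a fixed degree by $y$-degree reduces questions on forms to questions
  on sets of natural numbers.
\<close>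

definition dmon :: "nat \<Rightarrow> nat \<Rightarrow> nat \<times> nat" where
  "dmon d b = (d - b, b)"

lemma dmon_image: "{m. fst m + snd m = n \<and> snd m \<in> B} = dmon n ` (B \<inter> {..n})"
proof -
  have "m = dmon n (snd m)" if "fst m + snd m = n" for m using that by (cases m) (auto simp: dmon_def)
  then show ?thesis by (auto simp: dmon_def intro!: image_eqI)
qed

lemma inj_dmon: "inj (dmon n)"
  by (auto simp: inj_def dmon_def)

lemma degree_eq_dmon: "fst m + snd m = n \<Longrightarrow> m = dmon n (snd m)"
  by (cases m) (auto simp: dmon_def)

lemma forms_eq_dmon: "forms n = supported (dmon n ` {..n})"
  using dmon_image[of n UNIV] by (simp add: forms_eq_supported)

lemma forms_eq_span: "forms n = kvs.span (bimonom ` dmon n ` {..n})"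
  by (simp add: span_bimonom forms_eq_dmon)

lemma dim_forms: "kvs.dim (forms n :: 'k::field poly poly set) = n + 1"
  unfolding forms_eq_dmon by (subst dim_supported) (auto simp: card_image inj_on_subset[OF inj_dmon])

lemma bicoeff_hom_component: "bicoeff (hom_component n f) m = (if fst m + snd m = n then bicoeff f m else 0)"
proof -
  have "bicoeff (hom_component n f) m = (\<Sum>b\<le>n. if b = snd m \<and> fst m + snd m = n then bicoeff f m else 0)"
    unfolding hom_component_def bicoeff_sum by (cases m) (intro sum.cong; auto)
  also have "\<dots> = (\<Sum>b\<le>n. if b = snd m then (if fst m + snd m = n then bicoeff f m else 0) else 0)"
    by (intro sum.cong) auto
  finally show ?thesis by (auto simp: sum.delta)
qed

lemma hom_component_in_forms: "hom_component n f \<in> forms n"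
  by (auto simp: forms_def bicoeff_hom_component split: if_splits)

lemma hom_component_add: "hom_component n (f + g) = hom_component n f + hom_component n g"
  and hom_component_smult: "hom_component n (smult [:c:] f) = smult [:c:] (hom_component n f)"
  and hom_component_0 [simp]: "hom_component n 0 = 0"
  and hom_component_diff: "hom_component n (f - g) = hom_component n f - hom_component n g"
  by (rule bipoly_eqI, simp add: bicoeff_hom_component)+

lemma hom_component_form: "f \<in> forms n \<Longrightarrow> hom_component n f = f"
  by (rule bipoly_eqI) (simp add: bicoeff_hom_component forms_eq_supported supportedD)

lemma hom_component_other_form: "f \<in> forms n \<Longrightarrow> m \<noteq> n \<Longrightarrow> hom_component m f = 0"
  by (rule bipoly_eqI) (simp add: bicoeff_hom_component forms_eq_supported supportedD)

lemma bicoeff_mult: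
  "bicoeff (f * g) (a, b) = (\<Sum>j\<le>b. \<Sum>i\<le>a. bicoeff f (i, j) * bicoeff g (a - i, b - j))"
  by (simp add: bicoeff_def coeff_mult coeff_sum)

lemma bimonom_mult: "bimonom (a, b) * bimonom (a', b') = bimonom (a + a', b + b')"
  by (simp add: bimonom_def mult_monom)

lemma bicoeff_bimonom_mult:
  "bicoeff (bimonom (i, j) * f) (a, b) = (if i \<le> a \<and> j \<le> b then bicoeff f (a - i, b - j) else 0)"
  by (simp add: bimonom_def bicoeff_def coeff_monom_mult)

abbreviation varx :: "'k::field poly poly" where "varx \<equiv> bimonom (1, 0)"
abbreviation vary :: "'k::field poly poly" where "vary \<equiv> bimonom (0, 1)"

text \<open>
  For cofactors in an ideal: the constant term acts as a scalar, and the other two summands raise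
  degrees.
\<close>

lemma bipoly_split:
  obtains c h1 h2 where "h = [:[:c:]:] + varx * h1 + vary * (h2 :: 'k::field poly poly)"
proof -
  obtain h0 h2 where h: "h = pCons h0 h2" by (cases h)
  obtain c h1 where h0: "h0 = pCons c h1" by (cases h0)
  have "h = [:[:c:]:] + varx * [:h1:] + vary * h2"
    unfolding h h0
    by (rule bipoly_eqI) (simp add: bimonom_def bicoeff_def monom_altdef coeff_pCons split: nat.splits)
  then show thesis using that by blast
qed

lemma mult_forms: "f \<in> forms m \<Longrightarrow> bimonom (i, j) * f \<in> forms (i + j + m)"
  unfolding forms_def mem_Collect_eq
proof (intro allI impI)
  fix a b assume f: "\<forall>a b. bicoeff f (a, b) \<noteq> 0 \<longrightarrow> a + b = m"
    and "bicoeff (bimonom (i, j) * f) (a, b) \<noteq> 0"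
  then have "i \<le> a" "j \<le> b" "a - i + (b - j) = m"
    using f by (auto simp: bicoeff_bimonom_mult split: if_splits)
  then show "a + b = i + j + m" by simp
qed

lemma scalar_mult: "[:[:c:]:] * f = smult [:c:] (f :: 'k::field poly poly)"
  by simp

lemma ideal_subspace_imp_kvs_subspace:
  assumes "ideal.subspace (I :: 'k::field poly poly set)"
  shows "kvs.subspace I"
  using assms unfolding ideal.subspace_def kvs.subspace_def by (metis scalar_mult)

section \<open>Ideals that contain all forms above a degree\<close>

definition upward_closed :: "(nat \<times> nat) set \<Rightarrow> bool" where
  "upward_closed U \<longleftrightarrow> (\<forall>a b i j. (a, b) \<in> U \<longrightarrow> (a + i, b + j) \<in> U)"

text \<open>
  A product has a monomial outside \<open>U\<close> only if the second factor already has one,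
  because dividing a monomial outside \<open>U\<close> never leads into \<open>U\<close>.
\<close>

lemma ideal_supported:
  assumes "upward_closed U"
  shows "ideal.subspace (supported U :: 'k::field poly poly set)"
proof (rule ideal.subspaceI)
  fix h f :: "'k poly poly" assume f: "f \<in> supported U"
  have "bicoeff (h * f) (a, b) = 0" if "(a, b) \<notin> U" for a b
    unfolding bicoeff_mult
  proof (intro sum.neutral ballI)
    fix j i assume "j \<in> {..b}" "i \<in> {..a}"
    then have "(a - i + i, b - j + j) = (a, b)" by simp
    then have "(a - i, b - j) \<notin> U"
      using that assms unfolding upward_closed_def by metis
    then show "bicoeff h (i, j) * bicoeff f (a - i, b - j) = 0"
      using supportedD[OF f] by simp
  qed
  then show "h * f \<in> supported U" by (force simp: supported_def)
qed (auto intro: kvs.subspace_0[OF subspace_supported] kvs.subspace_add[OF subspace_supported])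

lemma ideal_span_bimonom:
  assumes "upward_closed U"
  shows "ideal.span (bimonom ` U) = (supported U :: 'k::field poly poly set)"
proof (rule ideal.span_subspace)
  have "kvs.span (bimonom ` U) \<subseteq> (ideal.span (bimonom ` U) :: 'k poly poly set)"
    by (intro kvs.span_minimal ideal.span_superset ideal_subspace_imp_kvs_subspace ideal.subspace_span)
  then show "supported U \<subseteq> (ideal.span (bimonom ` U) :: 'k poly poly set)"
    by (simp add: span_bimonom)
qed (use assms ideal_supported in auto)

lemma supported_eq_iff: "supported U = (supported U' :: 'k::field poly poly set) \<longleftrightarrow> U = U'"
  using bimonom_in_supported by (metis subsetI subset_antisym)

definition deg_ge :: "nat \<Rightarrow> (nat \<times> nat) set" where
  "deg_ge n = {m. n \<le> fst m + snd m}"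

lemma upward_closed_deg_ge: "upward_closed (deg_ge n)"
  by (auto simp: upward_closed_def deg_ge_def)

lemma hom_component_Suc_mult:
  "hom_component (Suc n) (varx * g) = varx * hom_component n g"
  "hom_component (Suc n) (vary * g) = vary * hom_component n g"
proof -
  have "bicoeff (hom_component (Suc n) (varx * g)) (a, b) = bicoeff (varx * hom_component n g) (a, b)" for a b
    by (auto simp: bicoeff_hom_component bicoeff_bimonom_mult)
  then show "hom_component (Suc n) (varx * g) = varx * hom_component n g"
    by (intro bipoly_eqI) auto
  have "bicoeff (hom_component (Suc n) (vary * g)) (a, b) = bicoeff (vary * hom_component n g) (a, b)" for a b
    by (auto simp: bicoeff_hom_component bicoeff_bimonom_mult)
  then show "hom_component (Suc n) (vary * g) = vary * hom_component n g"
    by (intro bipoly_eqI) auto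
qed

lemma hom_component_var_mult_low:
  assumes "g \<in> supported (deg_ge n)"
  shows "hom_component n (varx * g) = 0" "hom_component n (vary * g) = 0"
proof -
  have "bicoeff (hom_component n (varx * g)) (a, b) = 0" for a b
    using supportedD[OF assms, of "(a - 1, b)"]
    by (simp add: bicoeff_hom_component bicoeff_bimonom_mult deg_ge_def)
  then show "hom_component n (varx * g) = 0" by (intro bipoly_eqI) auto
  have "bicoeff (hom_component n (vary * g)) (a, b) = 0" for a b
    using supportedD[OF assms, of "(a, b - 1)"]
    by (simp add: bicoeff_hom_component bicoeff_bimonom_mult deg_ge_def)
  then show "hom_component n (vary * g) = 0" by (intro bipoly_eqI) auto
qed

text \<open>
  In an ideal without forms below degree \<open>n\<close>, multiplication by \<open>h\<close> acts
  as a scalar in degree \<open>n\<close>, while in degree \<open>n + 1\<close> it adds only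
  multiples of \<open>x\<close> and \<open>y\<close> of elements of degree \<open>n\<close>. This
  is all that counting generators needs.
\<close>

lemma hom_component_mult_low:
  assumes "g \<in> supported (deg_ge n)"
  obtains c h1 h2 where "hom_component n (h * g) = smult [:c:] (hom_component n g)"
    "hom_component (Suc n) (h * g) = smult [:c:] (hom_component (Suc n) g)
       + varx * hom_component n (h1 * g) + vary * hom_component n (h2 * g)"
proof -
  obtain c h1 h2 where h: "h = [:[:c:]:] + varx * h1 + vary * h2" by (rule bipoly_split)
  have hg: "h * g = smult [:c:] g + varx * (h1 * g) + vary * (h2 * g)"
    unfolding h by (simp only: distrib_right mult.assoc scalar_mult)
  have "h1 * g \<in> supported (deg_ge n)" "h2 * g \<in> supported (deg_ge n)"
    using ideal.subspace_scale[OF ideal_supported[OF upward_closed_deg_ge] assms] by auto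
  then show thesis
    using that[of c h1 h2]
    by (simp only: hg hom_component_add hom_component_smult hom_component_Suc_mult hom_component_var_mult_low add_0_right)
qed

text \<open>
  The ideals with Hilbert function $(1, \ldots, d, t, 0)$ are exactly these, for subspaces
  \<open>V\<close> of dimension $d + 1 - t$ of the forms of degree \<open>d\<close>.
\<close>

definition top_ideal :: "nat \<Rightarrow> 'k::field poly poly set \<Rightarrow> 'k poly poly set" where
  "top_ideal d V = {f \<in> supported (deg_ge d). hom_component d f \<in> V}"

definition R1_span :: "'k::field poly poly set \<Rightarrow> 'k poly poly set" where
  "R1_span V = kvs.span ((*) varx ` V \<union> (*) vary ` V)"

abbreviation R1_dim :: "'k::field poly poly set \<Rightarrow> nat" where
  "R1_dim V \<equiv> kvs.dim (R1_span V)"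

lemma form_deg_ge: "f \<in> forms n \<Longrightarrow> d \<le> n \<Longrightarrow> f \<in> supported (deg_ge d)"
  by (auto simp: forms_def supported_def deg_ge_def)

lemma ideal_top_ideal:
  assumes "kvs.subspace V"
  shows "ideal.subspace (top_ideal d V :: 'k::field poly poly set)"
proof (rule ideal.subspaceI)
  have S: "ideal.subspace (supported (deg_ge d) :: 'k poly poly set)"
    by (rule ideal_supported[OF upward_closed_deg_ge])
  show "0 \<in> top_ideal d V"
    using kvs.subspace_0[OF assms] ideal.subspace_0[OF S] by (simp add: top_ideal_def)
  fix f g h :: "'k poly poly" assume f: "f \<in> top_ideal d V"
  { assume "g \<in> top_ideal d V"
    then show "f + g \<in> top_ideal d V"
      using f kvs.subspace_add[OF assms] ideal.subspace_add[OF S]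
      by (simp add: top_ideal_def hom_component_add) }
  obtain c where "hom_component d (h * f) = smult [:c:] (hom_component d f)"
    using f hom_component_mult_low[of f d h] unfolding top_ideal_def by blast
  then show "h * f \<in> top_ideal d V"
    using f kvs.subspace_scale[OF assms] ideal.subspace_scale[OF S] by (simp add: top_ideal_def)
qed

lemma top_ideal_Int_forms:
  assumes "kvs.subspace V" "V \<subseteq> forms d"
  shows "top_ideal d V \<inter> forms n = (if n < d then {0} else if n = d then V else (forms n :: 'k::field poly poly set))"
proof -
  have zero: "f = 0" if "f \<in> supported (deg_ge d)" "f \<in> forms n" "n < d" for f :: "'k poly poly"
  proof (rule bipoly_eqI)
    fix m show "bicoeff f m = bicoeff 0 m"
      using that supportedD[of f _ m] by (cases "fst m + snd m = n") (auto simp: deg_ge_def forms_eq_supported)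
  qed
  have V0: "0 \<in> V" and F0: "0 \<in> (forms n :: 'k poly poly set)" and S0: "0 \<in> top_ideal d V"
    using kvs.subspace_0[OF assms(1)] kvs.subspace_0[OF subspace_forms]
      ideal.subspace_0[OF ideal_top_ideal[OF assms(1)]] by blast+
  consider "n < d" | "n = d" | "d < n" by linarith
  then show ?thesis
  proof cases
    case 1
    have "top_ideal d V \<inter> forms n = {0}"
    proof
      show "top_ideal d V \<inter> forms n \<subseteq> {0}" using zero 1 unfolding top_ideal_def by blast
      show "{0} \<subseteq> top_ideal d V \<inter> forms n" using S0 F0 by blast
    qed
    then show ?thesis using 1 by simp
  next
    case 2
    have "top_ideal d V \<inter> forms d = V"
    proof
      show "top_ideal d V \<inter> forms d \<subseteq> V"
        unfolding top_ideal_def using hom_component_form by fastforce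
      show "V \<subseteq> top_ideal d V \<inter> forms d"
      proof
        fix f assume "f \<in> V"
        then have "f \<in> forms d" using assms(2) by blast
        then show "f \<in> top_ideal d V \<inter> forms d"
          using form_deg_ge[of f d d] \<open>f \<in> V\<close> by (simp add: top_ideal_def hom_component_form)
      qed
    qed
    then show ?thesis using 2 by simp
  next
    case 3
    have "f \<in> top_ideal d V" if "f \<in> forms n" for f
      using form_deg_ge[OF that, of d] hom_component_other_form[OF that, of d] 3 V0
      by (simp add: top_ideal_def)
    then have "top_ideal d V \<inter> forms n = forms n" by blast
    then show ?thesis using 3 by simp
  qed
qed

lemma graded_top_ideal:
  assumes "kvs.subspace V" "V \<subseteq> forms d"
  shows "graded_ideal (top_ideal d V :: 'k::field poly poly set)"
  unfolding graded_ideal_def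
proof (intro conjI ballI allI ideal_top_ideal assms)
  fix f :: "'k poly poly" and n assume f: "f \<in> top_ideal d V"
  consider "n < d" | "n = d" | "d < n" by linarith
  then have "hom_component n f \<in> top_ideal d V \<inter> forms n"
  proof cases
    case 1
    then have "hom_component n f = 0"
      using f supportedD[of f "deg_ge d"]
      by (intro bipoly_eqI) (auto simp: bicoeff_hom_component top_ideal_def deg_ge_def)
    then show ?thesis using top_ideal_Int_forms[OF assms] 1 by simp
  next
    case 2
    have "hom_component d f \<in> V" using f by (simp add: top_ideal_def)
    then show ?thesis using 2 by (simp add: top_ideal_Int_forms[OF assms])
  next
    case 3
    then show ?thesis by (simp add: top_ideal_Int_forms[OF assms] hom_component_in_forms)
  qed
  then show "hom_component n f \<in> top_ideal d V" by blast
qed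

lemma supported_deg_ge_subset:
  assumes "kvs.subspace I" "\<And>n. d \<le> n \<Longrightarrow> forms n \<subseteq> I"
  shows "supported (deg_ge d) \<subseteq> (I :: 'k::field poly poly set)"
proof -
  have "bimonom m \<in> I" if "d \<le> fst m + snd m" for m
  proof -
    have "(bimonom m :: 'k poly poly) \<in> forms (fst m + snd m)" by (simp add: forms_eq_supported)
    then show ?thesis using assms(2)[OF that] by blast
  qed
  then show ?thesis
    unfolding span_bimonom[symmetric] by (intro kvs.span_minimal assms(1)) (auto simp: deg_ge_def)
qed

lemma top_ideal_subset:
  assumes "kvs.subspace I" "V \<subseteq> I" "\<And>n. d < n \<Longrightarrow> forms n \<subseteq> I"
  shows "top_ideal d V \<subseteq> (I :: 'k::field poly poly set)"
proof
  fix f :: "'k poly poly" assume f: "f \<in> top_ideal d V"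
  have "f - hom_component d f \<in> supported (deg_ge (Suc d))"
    unfolding supported_def mem_Collect_eq
  proof (intro allI impI)
    fix m assume "bicoeff (f - hom_component d f) m \<noteq> 0"
    then have "fst m + snd m \<noteq> d" "bicoeff f m \<noteq> 0"
      by (simp_all add: bicoeff_hom_component split: if_splits)
    moreover have "m \<in> deg_ge d"
      using f calculation(2) supportedD[of f "deg_ge d" m] unfolding top_ideal_def by blast
    ultimately show "m \<in> deg_ge (Suc d)" by (simp add: deg_ge_def)
  qed
  then have "f - hom_component d f \<in> I"
    using supported_deg_ge_subset[OF assms(1), of "Suc d"] assms(3) by auto
  moreover have "hom_component d f \<in> I" using f assms(2) by (auto simp: top_ideal_def)
  ultimately show "f \<in> I" using kvs.subspace_add[OF assms(1)] by fastforce
qed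

lemma graded_ideal_eq_top_ideal:
  fixes I :: "'k::field poly poly set"
  assumes "graded_ideal I" "\<And>n. n < d \<Longrightarrow> I \<inter> forms n \<subseteq> {0}" "\<And>n. d < n \<Longrightarrow> forms n \<subseteq> I"
  shows "I = top_ideal d (I \<inter> forms d)"
proof
  have I: "ideal.subspace I" "kvs.subspace I"
    using assms(1) ideal_subspace_imp_kvs_subspace by (auto simp: graded_ideal_def)
  show "top_ideal d (I \<inter> forms d) \<subseteq> I"
    by (rule top_ideal_subset[OF I(2) _ assms(3)]) auto
  show "I \<subseteq> top_ideal d (I \<inter> forms d)"
  proof
    fix f assume f: "f \<in> I"
    then have hom: "hom_component n f \<in> I \<inter> forms n" for n
      using assms(1) hom_component_in_forms by (auto simp: graded_ideal_def)
    have "f \<in> supported (deg_ge d)"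
      unfolding supported_def mem_Collect_eq
    proof (intro allI impI, rule ccontr)
      fix m assume m: "bicoeff f m \<noteq> 0" "m \<notin> deg_ge d"
      then have "hom_component (fst m + snd m) f = 0"
        using hom[of "fst m + snd m"] assms(2)[of "fst m + snd m"] by (auto simp: deg_ge_def)
      then have "bicoeff (hom_component (fst m + snd m) f) m = 0" by simp
      then show False using m(1) by (simp add: bicoeff_hom_component)
    qed
    then show "f \<in> top_ideal d (I \<inter> forms d)" using hom by (simp add: top_ideal_def)
  qed
qed

lemma R1_span_subset_forms:
  assumes "V \<subseteq> forms d"
  shows "R1_span V \<subseteq> (forms (Suc d) :: 'k::field poly poly set)"
  unfolding R1_span_def
proof (rule kvs.span_minimal[OF _ subspace_forms])
  show "(*) varx ` V \<union> (*) vary ` V \<subseteq> (forms (Suc d) :: 'k poly poly set)"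
    using assms mult_forms[of _ d 1 0] mult_forms[of _ d 0 1] by auto
qed

lemma subspace_R1_span: "kvs.subspace (R1_span V)"
  by (simp add: R1_span_def)

lemma forms_subset_span: "forms n \<subseteq> kvs.span (bimonom ` dmon n ` {..n} :: 'k::field poly poly set)"
  using forms_eq_span by blast

lemma finite_bimonoms [simp]: "finite (bimonom ` dmon n ` {..n})" by simp

lemma dim_le_if_subset_forms:
  assumes "V \<subseteq> (forms d :: 'k::field poly poly set)"
  shows "kvs.dim V \<le> d + 1"
proof -
  have "kvs.dim V \<le> kvs.dim (forms d :: 'k poly poly set)"
    using assms kvs.span_superset[of "forms d :: 'k poly poly set"]
    by (intro kvs.dim_mono_finite[OF _ forms_subset_span]) auto
  then show ?thesis by (simp add: dim_forms)
qed

lemma graded_ideal_eq_top_ideal_if_dims: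
  fixes I :: "'k::field poly poly set"
  assumes I: "graded_ideal I" and low: "\<And>n. n < d \<Longrightarrow> kvs.dim (I \<inter> forms n) = 0"
    and high: "\<And>n. d < n \<Longrightarrow> kvs.dim (I \<inter> forms n) = n + 1"
  shows "I = top_ideal d (I \<inter> forms d)"
proof (rule graded_ideal_eq_top_ideal[OF I])
  have "kvs.subspace I" using I ideal_subspace_imp_kvs_subspace by (auto simp: graded_ideal_def)
  then have sub: "kvs.subspace (I \<inter> forms n)" for n by (intro kvs.subspace_inter subspace_forms)
  show "I \<inter> forms n \<subseteq> {0}" if "n < d" for n
  proof (rule subsetI, rule ccontr)
    fix f assume f: "f \<in> I \<inter> forms n" "f \<notin> {0}"
    then have "card {f} \<le> kvs.dim (I \<inter> forms n)"
      using forms_subset_span[of n, where 'k='k]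
      by (intro kvs.independent_card_le_dim_finite[of _ _ "bimonom ` dmon n ` {..n}"]) auto
    then show False using low[OF that] by simp
  qed
  show "forms n \<subseteq> I" if "d < n" for n
    using kvs.subspace_eq_of_dim_le[OF sub _ forms_subset_span, of n n] high[OF that] by (auto simp: dim_forms)
qed

lemma hilbert_top_ideal:
  assumes "kvs.subspace V" "V \<subseteq> forms d"
  shows "hilbert (top_ideal d V :: 'k::field poly poly set) = T_seq d (d + 1 - kvs.dim V)"
proof
  fix n
  have "kvs.dim ({0} :: 'k poly poly set) = 0"
    using kvs.dim_span[of "{} :: 'k poly poly set"] kvs.dim_eq_card_independent[OF kvs.independent_empty]
    by simp
  then show "hilbert (top_ideal d V) n = T_seq d (d + 1 - kvs.dim V) n"
    by (simp add: hilbert_def top_ideal_Int_forms[OF assms] dim_forms T_seq_def)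
qed

text \<open>
  Project to the degrees \<open>d\<close> and $d + 1$. The image of the ideal is $V \oplus
  R_{d+1}$, and it is spanned by the images of the generators together with $R_1 V$, since every
  cofactor without constant term contributes an element of $R_1 V$.
\<close>

lemma card_generators_ge:
  fixes V :: "'k::field poly poly set"
  assumes V: "kvs.subspace V" "V \<subseteq> forms d"
    and G: "finite G" "ideal.span G = top_ideal d V"
  shows "kvs.dim V + (d + 2) \<le> card G + R1_dim V"
proof -
  define \<pi> where "\<pi> = (\<lambda>f :: 'k poly poly. hom_component d f + hom_component (Suc d) f)"
  define B where "B = kvs.span (\<pi> ` G \<union> R1_span V)"
  have I: "ideal.subspace (top_ideal d V)" by (rule ideal_top_ideal[OF V(1)])
  have B: "kvs.subspace B" by (simp add: B_def)
  have proj: "\<pi> f \<in> B" if "f \<in> ideal.span G" for f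
    using that
  proof (induction rule: ideal.span_induct_alt)
    case base
    show ?case using kvs.subspace_0[OF B] by (simp add: \<pi>_def)
  next
    case (step h g f)
    have g: "g \<in> top_ideal d V" using step(1) G(2) ideal.span_base by blast
    then have "g \<in> supported (deg_ge d)" by (simp add: top_ideal_def)
    then obtain c h1 h2 where h: "hom_component d (h * g) = smult [:c:] (hom_component d g)"
      "hom_component (Suc d) (h * g) = smult [:c:] (hom_component (Suc d) g)
         + varx * hom_component d (h1 * g) + vary * hom_component d (h2 * g)"
      by (rule hom_component_mult_low)
    have "hom_component d (h1 * g) \<in> V" "hom_component d (h2 * g) \<in> V"
      using ideal.subspace_scale[OF I g] by (auto simp: top_ideal_def)
    then have "varx * hom_component d (h1 * g) \<in> R1_span V" "vary * hom_component d (h2 * g) \<in> R1_span V"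
      unfolding R1_span_def by (auto intro: kvs.span_base)
    then have "varx * hom_component d (h1 * g) \<in> B" "vary * hom_component d (h2 * g) \<in> B" "\<pi> g \<in> B"
      using step(1) unfolding B_def by (auto intro: kvs.span_base)
    moreover have "\<pi> (h * g + f) = smult [:c:] (\<pi> g) + varx * hom_component d (h1 * g)
        + vary * hom_component d (h2 * g) + \<pi> f"
      unfolding \<pi>_def hom_component_add h smult_add_right by (simp only: ac_simps)
    ultimately show ?case
      using step(2) kvs.subspace_add[OF B] kvs.subspace_scale[OF B] by metis
  qed
  have "f \<in> B" if "f \<in> V \<union> forms (Suc d)" for f
  proof -
    have "\<pi> f = f"
      using that V(2) by (auto simp: \<pi>_def hom_component_form hom_component_other_form)
    moreover have "f \<in> top_ideal d V"
      using that top_ideal_Int_forms[OF V, of d] top_ideal_Int_forms[OF V, of "Suc d"] by auto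
    ultimately show ?thesis using proj G(2) by metis
  qed
  then have sub: "V \<union> forms (Suc d) \<subseteq> B" by blast
  let ?F = "bimonom ` dmon d ` {..d} \<union> bimonom ` dmon (Suc d) ` {..Suc d} :: 'k poly poly set"
  have F: "forms d \<subseteq> kvs.span ?F" "forms (Suc d) \<subseteq> kvs.span ?F"
    using forms_subset_span[where 'k='k] kvs.span_mono[of "bimonom ` dmon d ` {..d}" ?F]
      kvs.span_mono[of "bimonom ` dmon (Suc d) ` {..Suc d}" ?F] by blast+
  have "kvs.dim V + (d + 2) = kvs.dim V + kvs.dim (forms (Suc d) :: 'k poly poly set)"
    by (simp add: dim_forms)
  also have "\<dots> \<le> kvs.dim (V \<union> forms (Suc d))"
  proof (rule kvs.dim_add_le_dim_Un[OF V(1) subspace_forms])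
    show "V \<inter> forms (Suc d) \<subseteq> {0}"
    proof
      fix f assume f: "f \<in> V \<inter> forms (Suc d)"
      then have "hom_component d f = f" "hom_component d f = 0"
        using V(2) hom_component_other_form[of f "Suc d" d] by (auto simp: hom_component_form)
      then show "f \<in> {0}" by simp
    qed
    show "V \<union> forms (Suc d) \<subseteq> kvs.span ?F" using V(2) F by blast
  qed auto
  also have "\<dots> \<le> kvs.dim (\<pi> ` G \<union> R1_span V)"
  proof (rule kvs.dim_mono_finite)
    show "V \<union> forms (Suc d) \<subseteq> kvs.span (\<pi> ` G \<union> R1_span V)" using sub by (simp add: B_def)
    have "\<pi> f \<in> kvs.span ?F" for f
      unfolding \<pi>_def using F hom_component_in_forms by (intro kvs.span_add) blast+
    then show "\<pi> ` G \<union> R1_span V \<subseteq> kvs.span ?F"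
      using R1_span_subset_forms[OF V(2)] F by blast
  qed auto
  also have "\<dots> \<le> card (\<pi> ` G) + R1_dim V"
    using G(1) R1_span_subset_forms[OF V(2)] F(2)
    by (intro kvs.dim_Un_le[of _ _ ?F]) auto
  also have "\<dots> \<le> card G + R1_dim V" using card_image_le[OF G(1)] by simp
  finally show ?thesis .
qed

text \<open>
  A basis of \<open>V\<close>, together with the forms that extend a basis of $R_1 V$ to one of
  $R_{d+1}$, generates the ideal.
\<close>

lemma generators_exist:
  fixes V :: "'k::field poly poly set"
  assumes V: "kvs.subspace V" "V \<subseteq> forms d"
  obtains G where "finite G" "ideal.span G = top_ideal d V"
    "card G + R1_dim V \<le> kvs.dim V + (d + 2)"
proof -
  note R1 = R1_span_subset_forms[OF V(2)]
  have fin: "finite A" if "kvs.independent A" "A \<subseteq> forms n" for A :: "'k poly poly set" and n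
  proof -
    have "A \<subseteq> kvs.span (bimonom ` dmon n ` {..n})" using that(2) forms_subset_span by blast
    then show ?thesis using kvs.independent_span_bound[OF _ that(1)] finite_bimonoms by blast
  qed
  obtain A where A: "A \<subseteq> V" "kvs.independent A" "V \<subseteq> kvs.span A" "card A = kvs.dim V"
    using kvs.basis_exists by blast
  obtain B where B: "B \<subseteq> R1_span V" "kvs.independent B" "R1_span V \<subseteq> kvs.span B" "card B = R1_dim V"
    using kvs.basis_exists by blast
  obtain C where C: "B \<subseteq> C" "C \<subseteq> forms (Suc d)" "kvs.independent C" "forms (Suc d) \<subseteq> kvs.span C"
    using kvs.maximal_independent_subset_extend[of B "forms (Suc d)"] B(1,2) R1 by blast
  have finA: "finite A" and finC: "finite C" using fin A C V(2) by blast+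
  have cardC: "card C = d + 2"
    using kvs.basis_card_eq_dim[OF C(2) C(4) C(3)] by (simp add: dim_forms)
  define G where "G = A \<union> (C - B)"
  have J: "kvs.subspace (ideal.span G)"
    by (rule ideal_subspace_imp_kvs_subspace[OF ideal.subspace_span])
  have "A \<subseteq> ideal.span G" using ideal.span_superset[of G] G_def by blast
  then have VJ: "V \<subseteq> ideal.span G" using A(3) kvs.span_minimal[OF _ J] by blast
  have "R1_span V \<subseteq> ideal.span G"
    unfolding R1_span_def using VJ ideal.span_scale by (intro kvs.span_minimal[OF _ J]) blast
  then have "C \<subseteq> ideal.span G" using B(1) ideal.span_superset[of G] G_def by blast
  then have top: "forms (Suc d) \<subseteq> ideal.span G" using C(4) kvs.span_minimal[OF _ J] by blast
  have forms: "forms n \<subseteq> ideal.span G" if n: "d < n" for n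
  proof -
    have "(bimonom m :: 'k poly poly) \<in> ideal.span G" if "m \<in> dmon n ` {..n}" for m
    proof -
      have "\<exists>b\<le>n. m = (n - b, b)" using that by (auto simp: dmon_def)
      then obtain b where b: "b \<le> n" "m = (n - b, b)" by blast
      \<comment> \<open>The monomial is a multiple of one of degree exactly \<open>d + 1\<close>.\<close>
      define j where "j = min b (Suc d)"
      define i where "i = Suc d - j"
      have "(bimonom (i, j) :: 'k poly poly) \<in> forms (Suc d)"
        by (simp add: forms_eq_supported i_def j_def)
      moreover have "(bimonom m :: 'k poly poly) = bimonom (n - b - i, b - j) * bimonom (i, j)"
        using n b by (simp add: bimonom_mult i_def j_def)
      ultimately show ?thesis using top ideal.span_scale by (metis subsetD)
    qed
    then show ?thesis unfolding forms_eq_span by (intro kvs.span_minimal[OF _ J]) auto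
  qed
  have "G \<subseteq> top_ideal d V"
    using A(1) C(2) top_ideal_Int_forms[OF V, of d] top_ideal_Int_forms[OF V, of "Suc d"]
    by (auto simp: G_def)
  then have "ideal.span G = top_ideal d V"
    using top_ideal_subset[OF J VJ forms] ideal.span_minimal[OF _ ideal_top_ideal[OF V(1)]] by blast
  moreover have "card G + R1_dim V \<le> kvs.dim V + (d + 2)"
  proof -
    have "card G \<le> card A + card (C - B)" unfolding G_def by (rule card_Un_le)
    moreover have "card (C - B) = card C - card B" "card B \<le> card C"
      using finC C(1) by (auto simp: card_Diff_subset finite_subset card_mono)
    ultimately show ?thesis using A(4) B(4) cardC by linarith
  qed
  moreover have "finite G" using finA finC by (simp add: G_def)
  ultimately show thesis using that by blast
qed

lemma num_gens_top_ideal: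
  fixes V :: "'k::field poly poly set"
  assumes V: "kvs.subspace V" "V \<subseteq> forms d"
  shows "num_gens (top_ideal d V) + R1_dim V = kvs.dim V + (d + 2)"
proof -
  obtain G where G: "finite G" "ideal.span G = top_ideal d V"
      "card G + R1_dim V \<le> kvs.dim V + (d + 2)"
    using generators_exist[OF V] by blast
  have "num_gens (top_ideal d V) = card G"
    unfolding num_gens_def
  proof (rule Least_equality)
    show "\<exists>G'. finite G' \<and> card G' = card G \<and> ideal.span G' = top_ideal d V" using G by blast
    fix n assume "\<exists>G'. finite G' \<and> card G' = n \<and> ideal.span G' = top_ideal d V"
    then show "card G \<le> n" using card_generators_ge[OF V] G(3) by fastforce
  qed
  then show ?thesis using card_generators_ge[OF V G(1,2)] G(3) by linarith
qed

section \<open>Partitions and their pivots\<close>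

lemma C_exps_lower:
  assumes "is_partition P" "(a + i, b + j) \<in> C_exps P"
  shows "(a, b) \<in> C_exps P"
proof -
  have b: "b + j < length P" "a + i < P ! (b + j)" using assms(2) by (auto simp: C_exps_def)
  have "P ! (b + j) \<le> P ! b"
    using assms(1) b(1) unfolding is_partition_def
    by (cases "j = 0") (auto simp: sorted_wrt_iff_nth_less)
  then show ?thesis using b by (auto simp: C_exps_def)
qed

lemma upward_closed_compl_C_exps: "is_partition P \<Longrightarrow> upward_closed (- C_exps P)"
  using C_exps_lower by (auto simp: upward_closed_def)

lemma E_ideal_eq_supported: "is_partition P \<Longrightarrow> E_ideal P = supported (- C_exps P)"
  unfolding E_ideal_def by (rule ideal_span_bimonom[OF upward_closed_compl_C_exps])

text \<open>
  The length of a partition and each of its parts can be read off from its diagram.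
\<close>

lemma C_exps_inj:
  assumes "is_partition P" "is_partition Q" "C_exps P = C_exps Q"
  shows "P = Q"
proof -
  have pos: "b < length P \<longleftrightarrow> (0, b) \<in> C_exps P" if "is_partition P" for b P
    using that by (auto simp: C_exps_def is_partition_def in_set_conv_nth)
  have iff: "b < length P \<longleftrightarrow> b < length Q" for b using pos assms by metis
  have len: "length P = length Q" using iff[of "length P"] iff[of "length Q"] by linarith
  show ?thesis
  proof (rule nth_equalityI[OF len])
    fix b assume b: "b < length P"
    have iff: "a < P ! b \<longleftrightarrow> a < Q ! b" for a
    proof -
      have "(a, b) \<in> C_exps P \<longleftrightarrow> (a, b) \<in> C_exps Q" using assms(3) by simp
      then show ?thesis using b len by (simp add: C_exps_def)
    qed
    show "P ! b = Q ! b" using iff[of "P ! b"] iff[of "Q ! b"] by linarith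
  qed
qed

definition basis_exps :: "nat \<Rightarrow> nat set \<Rightarrow> (nat \<times> nat) set" where
  "basis_exps d S = {m. fst m + snd m < d} \<union> dmon d ` ({..d} - S)"

text \<open>
  The $y$-degrees of the monomials of degree \<open>d\<close> in the monomial ideal of the
  partition. They are the positions of the leading monomials in the degree-\<open>d\<close> part
  of an ideal of the cell.
\<close>

definition pivots :: "nat \<Rightarrow> nat list \<Rightarrow> nat set" where
  "pivots d P = {b. b \<le> d \<and> dmon d b \<notin> C_exps P}"

lemma pivots_subset: "pivots d P \<subseteq> {..d}"
  by (auto simp: pivots_def)

lemma supported_Int: "supported A \<inter> supported B = supported (A \<inter> B)"
  unfolding supported_def by blast

lemma diagonal_lengths_eq_card:
  assumes "is_partition P"
  shows "diagonal_lengths TYPE('k::field) P n = card {b. b \<le> n \<and> dmon n b \<in> C_exps P}"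
proof -
  let ?A = "{b. b \<le> n \<and> dmon n b \<in> C_exps P}"
  have "E_ideal P \<inter> forms n = (supported (dmon n ` ({..n} - ?A)) :: 'k poly poly set)"
  proof -
    have "- C_exps P \<inter> dmon n ` {..n} = dmon n ` ({..n} - ?A)" by auto
    then show ?thesis by (simp add: E_ideal_eq_supported[OF assms] forms_eq_dmon supported_Int)
  qed
  then have "diagonal_lengths TYPE('k) P n = n + 1 - card ({..n} - ?A)"
    unfolding diagonal_lengths_def hilbert_def
    by (simp add: dim_forms dim_supported card_image inj_on_subset[OF inj_dmon])
  moreover have "card ({..n} - ?A) = n + 1 - card ?A" "card ?A \<le> card {..n}"
    by (subst card_Diff_subset; auto) (rule card_mono; auto)
  ultimately show ?thesis by simp
qed

lemma dmon_eq_iff [simp]: "dmon n b = dmon n b' \<longleftrightarrow> b = b'"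
  by (auto simp: dmon_def)

lemma dmon_deg: "b \<le> n \<Longrightarrow> fst (dmon n b) + snd (dmon n b) = n"
  by (simp add: dmon_def)

lemma dmon_in_basis_exps:
  assumes "b \<le> n"
  shows "dmon n b \<in> basis_exps d S \<longleftrightarrow> n < d \<or> n = d \<and> b \<notin> S"
proof -
  have "n = d" if "dmon n b = dmon d b'" "b' \<le> d" for b'
    using dmon_deg[OF assms] dmon_deg[OF that(2)] that(1) by simp
  then show ?thesis
    using dmon_deg[OF assms] assms inj_dmon[of d] by (auto simp: basis_exps_def inj_def)
qed

lemma exps_eqI:
  assumes "\<And>n b. b \<le> n \<Longrightarrow> dmon n b \<in> A \<longleftrightarrow> dmon n b \<in> B"
  shows "A = B"
proof (rule set_eqI)
  fix m :: "nat \<times> nat"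
  have "m = dmon (fst m + snd m) (snd m)" by (simp add: dmon_def)
  then show "m \<in> A \<longleftrightarrow> m \<in> B" using assms[of "snd m" "fst m + snd m"] by simp
qed

lemma diagonal_lengths_eq_T_seq_iff:
  assumes "is_partition P" "t \<le> d + 1"
  shows "diagonal_lengths TYPE('k::field) P = T_seq d t \<longleftrightarrow>
    C_exps P = basis_exps d (pivots d P) \<and> card (pivots d P) = d + 1 - t"
proof -
  let ?A = "\<lambda>n. {b. b \<le> n \<and> dmon n b \<in> C_exps P}" and ?B = "basis_exps d (pivots d P)"
  have all: "card (?A n) = n + 1 \<longleftrightarrow> (\<forall>b\<le>n. dmon n b \<in> C_exps P)" for n
  proof
    assume "card (?A n) = n + 1"
    then have "?A n = {..n}" by (intro card_subset_eq) auto
    then show "\<forall>b\<le>n. dmon n b \<in> C_exps P" by blast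
  next
    assume "\<forall>b\<le>n. dmon n b \<in> C_exps P"
    then have "?A n = {..n}" by blast
    then show "card (?A n) = n + 1" by simp
  qed
  have "?A d = {..d} - pivots d P" by (auto simp: pivots_def)
  then have "card (?A d) = d + 1 - card (pivots d P)" and "card (pivots d P) \<le> d + 1"
    using pivots_subset[of d P] card_mono[OF _ pivots_subset[of d P]]
    by (simp_all add: card_Diff_subset finite_subset)
  then have top: "card (?A d) = t \<longleftrightarrow> card (pivots d P) = d + 1 - t" using assms(2) by linarith
  have "card (?A n) = T_seq d t n \<longleftrightarrow> (\<forall>b\<le>n. dmon n b \<in> C_exps P \<longleftrightarrow> dmon n b \<in> ?B) \<and>
      (n = d \<longrightarrow> card (pivots d P) = d + 1 - t)" for n
  proof -
    consider "n < d" | "n = d" | "d < n" by linarith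
    then show ?thesis
    proof cases
      case 1
      then show ?thesis using all[of n] by (simp add: T_seq_def dmon_in_basis_exps)
    next
      case 2
      have "\<forall>b\<le>d. dmon d b \<in> C_exps P \<longleftrightarrow> dmon d b \<in> ?B"
        using dmon_in_basis_exps[of _ d d "pivots d P"] by (simp add: pivots_def)
      then show ?thesis using 2 top by (simp add: T_seq_def)
    next
      case 3
      have "finite (?A n)" by simp
      then have "card (?A n) = 0 \<longleftrightarrow> (\<forall>b\<le>n. dmon n b \<notin> C_exps P)" by auto
      then show ?thesis using 3 by (simp add: T_seq_def dmon_in_basis_exps)
    qed
  qed
  then have "diagonal_lengths TYPE('k) P = T_seq d t \<longleftrightarrow>
      (\<forall>n. (\<forall>b\<le>n. dmon n b \<in> C_exps P \<longleftrightarrow> dmon n b \<in> ?B) \<and> (n = d \<longrightarrow> card (pivots d P) = d + 1 - t))"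
    unfolding fun_eq_iff diagonal_lengths_eq_card[OF assms(1)] by simp
  also have "\<dots> \<longleftrightarrow> C_exps P = ?B \<and> card (pivots d P) = d + 1 - t"
    using exps_eqI[of "C_exps P" ?B] by auto
  finally show ?thesis .
qed

text \<open>
  Row \<open>b\<close> contains the $d - b$ monomials of degree below \<open>d\<close>, and one
  of degree \<open>d\<close> unless \<open>b\<close> is a pivot. The row \<open>d\<close> must
  be left out when it is empty, since the parts of a partition are positive.
\<close>

definition pivot_partition :: "nat \<Rightarrow> nat set \<Rightarrow> nat list" where
  "pivot_partition d S = map (\<lambda>b. d - b + of_bool (b \<notin> S)) [0..<d + of_bool (d \<notin> S)]"

lemma length_pivot_partition: "length (pivot_partition d S) = d + of_bool (d \<notin> S)"
  by (simp add: pivot_partition_def)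

lemma nth_pivot_partition:
  assumes "b < d + of_bool (d \<notin> S)"
  shows "pivot_partition d S ! b = d - b + of_bool (b \<notin> S)"
  using assms by (simp add: pivot_partition_def del: upt_Suc)

lemma is_partition_pivot_partition: "is_partition (pivot_partition d S)"
proof -
  have "0 < d - b + of_bool (b \<notin> S)" if "b < d + of_bool (d \<notin> S)" for b
    using that by (cases "b = d"; cases "d \<in> S") auto
  moreover have "d - c + of_bool (c \<notin> S) \<le> d - b + of_bool (b \<notin> S)" if "b < c" "c < d + of_bool (d \<notin> S)" for b c
  proof -
    have "c \<le> d" using that(2) by (cases "d \<in> S") auto
    moreover have "of_bool (c \<notin> S) \<le> (1 :: nat)" by simp
    ultimately show ?thesis using that(1) by linarith
  qed
  ultimately show ?thesis
    by (auto simp: is_partition_def sorted_wrt_iff_nth_less in_set_conv_nth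
        length_pivot_partition nth_pivot_partition simp del: of_bool_eq_0_iff)
qed

lemma C_exps_pivot_partition: "C_exps (pivot_partition d S) = basis_exps d S"
proof (rule exps_eqI)
  fix n b :: nat assume b: "b \<le> n"
  have "dmon n b \<in> C_exps (pivot_partition d S) \<longleftrightarrow>
      b < d + of_bool (d \<notin> S) \<and> n - b < d - b + of_bool (b \<notin> S)"
    using nth_pivot_partition[of b d S] by (auto simp: dmon_def C_exps_def length_pivot_partition)
  also have "\<dots> \<longleftrightarrow> n < d \<or> n = d \<and> b \<notin> S"
    using b by (cases "b = d"; cases "b \<in> S"; cases "d \<in> S") auto
  finally show "dmon n b \<in> C_exps (pivot_partition d S) \<longleftrightarrow> dmon n b \<in> basis_exps d S"
    by (simp add: dmon_in_basis_exps[OF b])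
qed

lemma pivots_eq: "S \<subseteq> {..d} \<Longrightarrow> C_exps P = basis_exps d S \<Longrightarrow> pivots d P = S"
  by (auto simp: pivots_def dmon_in_basis_exps)

lemma bij_betw_pivots:
  assumes "t \<le> d + 1"
  shows "bij_betw (pivots d) {P. is_partition P \<and> diagonal_lengths TYPE('k::field) P = T_seq d t}
     {S. S \<subseteq> {..d} \<and> card S = d + 1 - t}"
  unfolding bij_betw_def
proof
  let ?A = "{P. is_partition P \<and> diagonal_lengths TYPE('k::field) P = T_seq d t}"
  have A: "is_partition P \<and> C_exps P = basis_exps d (pivots d P) \<and> card (pivots d P) = d + 1 - t"
    if "P \<in> ?A" for P
    using that diagonal_lengths_eq_T_seq_iff[OF _ assms] by blast
  show "inj_on (pivots d) ?A"
    using A C_exps_inj by (metis (no_types, lifting) inj_onI)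
  show "pivots d ` ?A = {S. S \<subseteq> {..d} \<and> card S = d + 1 - t}"
  proof
    show "pivots d ` ?A \<subseteq> {S. S \<subseteq> {..d} \<and> card S = d + 1 - t}" using A pivots_subset by blast
    show "{S. S \<subseteq> {..d} \<and> card S = d + 1 - t} \<subseteq> pivots d ` ?A"
    proof
      fix S assume "S \<in> {S. S \<subseteq> {..d} \<and> card S = d + 1 - t}"
      then have S: "S \<subseteq> {..d}" "card S = d + 1 - t" by auto
      have piv: "pivots d (pivot_partition d S) = S" by (rule pivots_eq[OF S(1) C_exps_pivot_partition])
      have "diagonal_lengths TYPE('k) (pivot_partition d S) = T_seq d t"
        unfolding diagonal_lengths_eq_T_seq_iff[OF is_partition_pivot_partition assms] piv
        using S(2) C_exps_pivot_partition by blast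
      then have "pivot_partition d S \<in> ?A" using is_partition_pivot_partition by blast
      then show "S \<in> pivots d ` ?A" by (rule rev_image_eqI) (simp only: piv)
    qed
  qed
qed

section \<open>Degrees of forms and initial ideals\<close>

lemma form_exp: "f \<in> forms n \<Longrightarrow> bicoeff f m \<noteq> 0 \<Longrightarrow> m = dmon n (snd m)"
  using degree_eq_dmon[of m n] supportedD[of f _ m] unfolding forms_eq_supported by blast

lemma form_degree:
  assumes "f \<in> forms n" "f \<noteq> (0 :: 'k::field poly poly)"
  shows "degree f \<le> n" "bicoeff f (dmon n (degree f)) \<noteq> 0" "initial_exp f = dmon n (degree f)"
    "\<And>b. degree f < b \<Longrightarrow> bicoeff f (dmon n b) = 0"
proof -
  let ?c = "lead_coeff f"
  have c: "coeff ?c (degree ?c) \<noteq> 0" using assms(2) by simp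
  then have "bicoeff f (degree ?c, degree f) \<noteq> 0" by (simp add: bicoeff_def)
  then have n: "degree ?c + degree f = n" using assms(1) by (simp add: forms_def)
  then show "degree f \<le> n" "bicoeff f (dmon n (degree f)) \<noteq> 0" "initial_exp f = dmon n (degree f)"
    using c by (auto simp: bicoeff_def dmon_def initial_exp_def)
  show "bicoeff f (dmon n b) = 0" if "degree f < b" for b
    using that by (simp add: bicoeff_def dmon_def coeff_eq_0)
qed

lemma form_in_supported_degree:
  assumes "f \<in> forms n" "f \<noteq> 0"
  shows "f \<in> supported (dmon n ` {..degree f})"
  unfolding supported_def mem_Collect_eq
proof (intro allI impI)
  fix m assume m: "bicoeff f m \<noteq> 0"
  with assms(1) have m': "m = dmon n (snd m)" by (rule form_exp)
  then have "\<not> degree f < snd m" using form_degree(4)[OF assms, of "snd m"] m by metis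
  then show "m \<in> dmon n ` {..degree f}" using m' by (intro image_eqI[of _ _ "snd m"]) auto
qed

lemma supported_drop_top:
  assumes "f \<in> supported (dmon n ` {..<Suc k})" "bicoeff f (dmon n k) = 0"
  shows "f \<in> supported (dmon n ` {..<k})"
  using assms unfolding supported_def mem_Collect_eq lessThan_Suc image_insert by (metis insertE)

lemma form_degree_eqI:
  assumes "f \<in> forms n" "bicoeff f (dmon n b) \<noteq> 0" "\<And>b'. b < b' \<Longrightarrow> b' \<le> n \<Longrightarrow> bicoeff f (dmon n b') = 0"
  shows "f \<noteq> 0" "degree f = (b::nat)"
proof -
  show f0: "f \<noteq> 0" using assms(2) by auto
  show "degree f = b"
    using form_degree[OF assms(1) f0] assms(2,3) by (metis linorder_neqE_nat)
qed

text \<open>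
  The set of pivots of a subspace in echelon form; its cardinality is the dimension.
\<close>

definition lead_degs :: "'k::field poly poly set \<Rightarrow> nat set" where
  "lead_degs W = degree ` (W - {0})"

lemma lead_degs_subset: "W \<subseteq> forms n \<Longrightarrow> lead_degs W \<subseteq> {..n}"
  using form_degree(1) by (fastforce simp: lead_degs_def)

text \<open>
  Division with remainder by the elements of \<open>W\<close>: starting from the highest
  $y$-degree, each monomial whose $y$-degree occurs as a degree in \<open>W\<close> is
  cancelled. The bound \<open>k\<close> records that the remainder has no monomials above those
  of \<open>f\<close>, which makes the coordinates of a cell triangular.
\<close>

lemma reduce_form:
  assumes "kvs.subspace W" "W \<subseteq> forms n" "f \<in> supported (dmon n ` {..<k})" "k \<le> Suc n"
  shows "\<exists>g\<in>W. f - g \<in> (supported (dmon n ` ({..<k} - lead_degs W)) :: 'k::field poly poly set)"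
  using assms(3,4)
proof (induction k arbitrary: f)
  case 0
  then show ?case using kvs.subspace_0[OF assms(1)] by force
next
  case (Suc k)
  define c where "c = bicoeff f (dmon n k)"
  have cancel: "f - h \<in> supported (dmon n ` {..<k})"
    if h: "h \<in> supported (dmon n ` {..<Suc k})" "bicoeff h (dmon n k) = c" for h
  proof (rule supported_drop_top)
    show "f - h \<in> supported (dmon n ` {..<Suc k})"
      by (rule kvs.subspace_diff[OF subspace_supported Suc.prems(1) h(1)])
  qed (simp add: h(2) c_def)
  have mono: "(supported (dmon n ` ({..<k} - lead_degs W)) :: 'k poly poly set)
      \<subseteq> supported (dmon n ` ({..<Suc k} - lead_degs W))"
    by (intro supported_mono image_mono) auto
  show ?case
  proof (cases "k \<in> lead_degs W")
    case True
    then obtain w where w: "w \<in> W" "w \<noteq> 0" "degree w = k" by (auto simp: lead_degs_def)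
    have wf: "w \<in> forms n" using w assms(2) by blast
    let ?a = "c / bicoeff w (dmon n k)"
    let ?h = "smult [:?a:] w"
    have nz: "bicoeff w (dmon n k) \<noteq> 0" using form_degree(2)[OF wf w(2)] w(3) by simp
    have "w \<in> supported (dmon n ` {..<Suc k})"
      using form_in_supported_degree[OF wf w(2)] w(3) by (simp add: lessThan_Suc_atMost)
    then have "?h \<in> supported (dmon n ` {..<Suc k})" by (rule kvs.subspace_scale[OF subspace_supported])
    then have "f - ?h \<in> supported (dmon n ` {..<k})" using cancel nz by simp
    then obtain g where g: "g \<in> W" "f - ?h - g \<in> supported (dmon n ` ({..<k} - lead_degs W))"
      using Suc.IH Suc.prems(2) by (meson Suc_leD)
    have "?h + g \<in> W" using g w kvs.subspace_add[OF assms(1)] kvs.subspace_scale[OF assms(1)] by blast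
    moreover have "f - (?h + g) \<in> supported (dmon n ` ({..<Suc k} - lead_degs W))"
      unfolding diff_diff_add[symmetric] using g(2) mono by (rule subsetD[rotated])
    ultimately show ?thesis by blast
  next
    case False
    let ?h = "smult [:c:] (bimonom (dmon n k)) :: 'k poly poly"
    have h: "?h \<in> supported (dmon n ` ({..<Suc k} - lead_degs W))"
      using False by (intro kvs.subspace_scale[OF subspace_supported]) auto
    then have "?h \<in> supported (dmon n ` {..<Suc k})"
      using supported_mono[of "dmon n ` ({..<Suc k} - lead_degs W)" "dmon n ` {..<Suc k}"] by blast
    then have "f - ?h \<in> supported (dmon n ` {..<k})" using cancel by simp
    then obtain g where g: "g \<in> W" "f - ?h - g \<in> supported (dmon n ` ({..<k} - lead_degs W))"
      using Suc.IH Suc.prems(2) by (meson Suc_leD)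
    have "f - ?h - g \<in> supported (dmon n ` ({..<Suc k} - lead_degs W))"
      using g(2) mono by blast
    from kvs.subspace_add[OF subspace_supported this h]
    have "f - g \<in> supported (dmon n ` ({..<Suc k} - lead_degs W))" by (simp add: algebra_simps)
    then show ?thesis using g(1) by blast
  qed
qed

abbreviation nonpivot_forms :: "nat \<Rightarrow> nat set \<Rightarrow> 'k::field poly poly set" where
  "nonpivot_forms d S \<equiv> supported (dmon d ` ({..d} - S))"

text \<open>
  The monomials of degree \<open>d\<close> with $y$-degree outside \<open>S\<close> represent a
  basis of the quotient $R_d / V$. In Grassmannian terms, \<open>V\<close> lies in the affine
  chart of \<open>S\<close>.
\<close>

definition complementary :: "nat \<Rightarrow> nat set \<Rightarrow> 'k::field poly poly set \<Rightarrow> bool" where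
  "complementary d S V \<longleftrightarrow> V \<inter> nonpivot_forms d S \<subseteq> {0} \<and>
     (\<forall>f\<in>forms d. \<exists>g\<in>nonpivot_forms d S. f - g \<in> V)"

lemma complementary_lead_degs:
  assumes "kvs.subspace V" "V \<subseteq> (forms d :: 'k::field poly poly set)"
  shows "complementary d (lead_degs V) V"
  unfolding complementary_def
proof (intro conjI ballI subsetI)
  fix f assume f: "f \<in> V \<inter> supported (dmon d ` ({..d} - lead_degs V))"
  show "f \<in> {0}"
  proof (rule ccontr)
    assume "f \<notin> {0}"
    then have f0: "f \<noteq> 0" by simp
    have "bicoeff f (dmon d (degree f)) \<noteq> 0" using form_degree(2) f assms(2) f0 by blast
    then have "dmon d (degree f) \<in> dmon d ` ({..d} - lead_degs V)" using f supportedD by blast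
    then have "degree f \<notin> lead_degs V" using inj_dmon[of d] by (auto simp: inj_def)
    then show False using f f0 by (simp add: lead_degs_def)
  qed
next
  fix f :: "'k poly poly" assume "f \<in> forms d"
  then obtain g where "g \<in> V" "f - g \<in> supported (dmon d ` ({..<Suc d} - lead_degs V))"
    using reduce_form[OF assms, of f "Suc d"] by (auto simp: forms_eq_dmon lessThan_Suc_atMost)
  then show "\<exists>g\<in>supported (dmon d ` ({..d} - lead_degs V)). f - g \<in> V"
    by (intro bexI[of _ "f - g"]) (auto simp: lessThan_Suc_atMost)
qed

text \<open>
  Complements of the same subspace, here of the nonpivot forms, have the same dimension.
\<close>

lemma dim_complementary:
  assumes "kvs.subspace V" "V \<subseteq> (forms d :: 'k::field poly poly set)" "complementary d S V" "S \<subseteq> {..d}"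
  shows "kvs.dim V = card S"
proof -
  let ?N = "dmon d ` ({..d} - S)"
  let ?F = "bimonom ` dmon d ` {..d} :: 'k poly poly set"
  have N: "card ?N = d + 1 - card S" "card S \<le> d + 1"
    using assms(4) card_mono[OF _ assms(4)]
    by (simp_all add: card_image inj_on_subset[OF inj_dmon] card_Diff_subset finite_subset)
  have NF: "supported ?N \<subseteq> (forms d :: 'k poly poly set)"
    unfolding forms_eq_dmon by (rule supported_mono) auto
  have "kvs.dim V + kvs.dim (supported ?N :: 'k poly poly set) \<le> kvs.dim (V \<union> supported ?N)"
  proof (rule kvs.dim_add_le_dim_Un[OF assms(1) subspace_supported])
    show "V \<inter> supported ?N \<subseteq> {0}" using assms(3) by (simp add: complementary_def)
    show "V \<union> supported ?N \<subseteq> kvs.span ?F" using assms(2) NF forms_subset_span[of d, where 'k='k] by blast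
  qed simp
  also have "\<dots> \<le> d + 1" using assms(2) NF by (intro dim_le_if_subset_forms) auto
  finally have le: "kvs.dim V + (d + 1 - card S) \<le> d + 1" using N by (simp add: dim_supported)
  have "d + 1 = kvs.dim (forms d :: 'k poly poly set)" by (simp add: dim_forms)
  also have "\<dots> \<le> kvs.dim (bimonom ` ?N \<union> V)"
  proof (rule kvs.dim_mono_finite)
    show "forms d \<subseteq> kvs.span (bimonom ` ?N \<union> V)"
    proof
      fix f :: "'k poly poly" assume "f \<in> forms d"
      then obtain g where g: "g \<in> supported ?N" "f - g \<in> V" using assms(3) by (auto simp: complementary_def)
      have "g \<in> kvs.span (bimonom ` ?N \<union> V)"
        using g(1) kvs.span_mono[of "bimonom ` ?N" "bimonom ` ?N \<union> V"] by (auto simp: span_bimonom)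
      moreover have "f - g \<in> kvs.span (bimonom ` ?N \<union> V)" using g(2) by (simp add: kvs.span_base)
      ultimately have "g + (f - g) \<in> kvs.span (bimonom ` ?N \<union> V)" by (rule kvs.span_add)
      then show "f \<in> kvs.span (bimonom ` ?N \<union> V)" by simp
    qed
    have "bimonom ` ?N \<subseteq> forms d" unfolding forms_eq_dmon by auto
    then show "bimonom ` ?N \<union> V \<subseteq> kvs.span ?F" using assms(2) forms_subset_span[of d, where 'k='k] by blast
  qed simp
  also have "\<dots> \<le> card (bimonom ` ?N :: 'k poly poly set) + kvs.dim V"
    using assms(2) forms_subset_span[of d, where 'k='k] by (intro kvs.dim_Un_le[of _ _ ?F]) auto
  also have "\<dots> \<le> card ?N + kvs.dim V" by (simp add: card_image_le)
  finally show ?thesis using le N by simp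
qed

lemma dim_eq_card_lead_degs:
  assumes "kvs.subspace V" "V \<subseteq> forms d"
  shows "kvs.dim V = card (lead_degs V)"
  by (rule dim_complementary[OF assms complementary_lead_degs[OF assms] lead_degs_subset[OF assms(2)]])

definition initial_exps :: "'k::field poly poly set \<Rightarrow> (nat \<times> nat) set" where
  "initial_exps I = {initial_exp f | f n. f \<in> I \<inter> forms n \<and> f \<noteq> 0}"

lemma dmon_in_inexps:
  assumes "b \<le> n"
  shows "dmon n b \<in> initial_exps I \<longleftrightarrow> b \<in> lead_degs (I \<inter> forms n)"
proof
  assume "dmon n b \<in> initial_exps I"
  then obtain f n' where f: "f \<in> I \<inter> forms n'" "f \<noteq> 0" "dmon n b = initial_exp f" by (auto simp: initial_exps_def)
  then have eq: "dmon n b = dmon n' (degree f)" "degree f \<le> n'" using form_degree by auto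
  then have "n = n'" "b = degree f" using dmon_deg[OF assms] dmon_deg[OF eq(2)] by (auto simp: dmon_def)
  then show "b \<in> lead_degs (I \<inter> forms n)" using f by (auto simp: lead_degs_def)
next
  assume "b \<in> lead_degs (I \<inter> forms n)"
  then obtain f where f: "f \<in> I \<inter> forms n" "f \<noteq> 0" "b = degree f" by (auto simp: lead_degs_def)
  then have "dmon n b = initial_exp f" using form_degree(3)[of f n] by simp
  then show "dmon n b \<in> initial_exps I" using f unfolding initial_exps_def by blast
qed

lemma upward_closed_inexps:
  assumes "ideal.subspace (I :: 'k::field poly poly set)"
  shows "upward_closed (initial_exps I)"
  unfolding upward_closed_def
proof (intro allI impI)
  fix a b i j assume ab: "(a, b) \<in> initial_exps I"
  have eq: "(a, b) = dmon (a + b) b" "(a + i, b + j) = dmon (i + j + (a + b)) (b + j)" by (auto simp: dmon_def)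
  have "b \<in> lead_degs (I \<inter> forms (a + b))" using ab dmon_in_inexps[of b "a + b" I] eq(1) by simp
  then obtain f where f: "f \<in> I" "f \<in> forms (a + b)" "f \<noteq> 0" "b = degree f" by (auto simp: lead_degs_def)
  let ?g = "bimonom (i, j) * f"
  have g0: "(bimonom (i, j) :: 'k poly poly) \<noteq> 0" by (simp add: bimonom_def monom_eq_0_iff)
  have "degree ?g = degree (bimonom (i, j) :: 'k poly poly) + degree f" using g0 f(3) by (rule degree_mult_eq)
  also have "degree (bimonom (i, j) :: 'k poly poly) = j" by (simp add: bimonom_def degree_monom_eq monom_eq_0_iff)
  finally have "degree ?g = b + j" using f(4) by simp
  moreover have "?g \<in> I" using assms f(1) by (rule ideal.subspace_scale)
  moreover have "?g \<in> forms (i + j + (a + b))" using f(2) by (rule mult_forms)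
  moreover have "?g \<noteq> 0" using g0 f(3) by simp
  ultimately have "b + j \<in> lead_degs (I \<inter> forms (i + j + (a + b)))" unfolding lead_degs_def by force
  then show "(a + i, b + j) \<in> initial_exps I" unfolding eq(2) by (subst dmon_in_inexps) auto
qed

lemma jordan_cell_iff:
  assumes "is_partition P"
  shows "I \<in> jordan_cell P \<longleftrightarrow> graded_ideal I \<and> initial_exps I = - C_exps (P :: nat list)"
proof -
  have "initial_ideal I = supported (initial_exps I)" if "graded_ideal I"
  proof -
    have "{bimonom (initial_exp f) | f n. f \<in> I \<inter> forms n \<and> f \<noteq> 0} = (bimonom ` initial_exps I :: 'a poly poly set)"
      unfolding initial_exps_def by blast
    then show ?thesis
      unfolding initial_ideal_def
      using ideal_span_bimonom[OF upward_closed_inexps, of I] that by (simp add: graded_ideal_def)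
  qed
  then show ?thesis
    unfolding jordan_cell_def E_ideal_eq_supported[OF assms] by (auto simp: supported_eq_iff)
qed

text \<open>
  The initial exponents of an ideal in the cell prescribe the dimension of the ideal in each
  degree: nothing below degree \<open>d\<close>, everything above it.
\<close>

lemma jordan_cell_eq:
  assumes "is_partition P" "C_exps P = basis_exps d S" "S \<subseteq> {..d}"
  shows "(jordan_cell P :: 'k::field poly poly set set) =
    {top_ideal d V | V. kvs.subspace V \<and> V \<subseteq> forms d \<and> lead_degs V = S} " (is "_ = ?R")
proof
  show "?R \<subseteq> (jordan_cell P :: 'k poly poly set set)"
  proof
    fix I :: "'k poly poly set" assume "I \<in> ?R"
    then obtain V where V: "kvs.subspace V" "V \<subseteq> forms d" "lead_degs V = S" "I = top_ideal d V" by blast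
    have full: "lead_degs (forms n :: 'k poly poly set) = {..n}" for n
    proof
      show "{..n} \<subseteq> lead_degs (forms n :: 'k poly poly set)"
      proof
        fix b assume b: "b \<in> {..n}"
        have f: "bimonom (dmon n b) \<in> (forms n :: 'k poly poly set)" using b by (simp add: forms_eq_dmon)
        then have "(bimonom (dmon n b) :: 'k poly poly) \<noteq> 0 \<and> degree (bimonom (dmon n b) :: 'k poly poly) = b"
          using form_degree_eqI[OF f, of b] by auto
        then show "b \<in> lead_degs (forms n :: 'k poly poly set)" using f unfolding lead_degs_def by force
      qed
    qed (simp add: lead_degs_subset)
    have "initial_exps I = - basis_exps d S"
    proof (rule exps_eqI)
      fix n b :: nat assume b: "b \<le> n"
      have "lead_degs ({0} :: 'k poly poly set) = {}" by (simp add: lead_degs_def)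
      then show "dmon n b \<in> initial_exps I \<longleftrightarrow> dmon n b \<in> - basis_exps d S"
        using b V(3) by (simp add: dmon_in_inexps dmon_in_basis_exps V(4) top_ideal_Int_forms[OF V(1,2)] full)
    qed
    then show "I \<in> jordan_cell P"
      unfolding jordan_cell_iff[OF assms(1)] using graded_top_ideal[OF V(1,2)] V(4) assms(2) by simp
  qed
  show "(jordan_cell P :: 'k poly poly set set) \<subseteq> ?R"
  proof
    fix I :: "'k poly poly set" assume "I \<in> jordan_cell P"
    then have I: "graded_ideal I" "initial_exps I = - basis_exps d S"
      unfolding jordan_cell_iff[OF assms(1)] using assms(2) by auto
    have sub: "kvs.subspace I" using I(1) ideal_subspace_imp_kvs_subspace by (auto simp: graded_ideal_def)
    have ld: "b \<in> lead_degs (I \<inter> forms n) \<longleftrightarrow> d < n \<or> n = d \<and> b \<in> S" if "b \<le> n" for n b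
      using that I(2) dmon_in_inexps[OF that, of I] by (auto simp: dmon_in_basis_exps)
    have subn: "kvs.subspace (I \<inter> forms n)" for n by (intro kvs.subspace_inter sub subspace_forms)
    have "I = top_ideal d (I \<inter> forms d)"
    proof (rule graded_ideal_eq_top_ideal_if_dims[OF I(1)])
      fix n
      have sub: "lead_degs (I \<inter> forms n) \<subseteq> {..n}" by (rule lead_degs_subset) blast
      have dim: "kvs.dim (I \<inter> forms n) = card (lead_degs (I \<inter> forms n))"
        by (rule dim_eq_card_lead_degs[OF subn]) blast
      { assume n: "n < d"
        have "lead_degs (I \<inter> forms n) = {}"
        proof (rule equals0I)
          fix b assume b: "b \<in> lead_degs (I \<inter> forms n)"
          then have "b \<le> n" using sub by blast
          then show False using ld[of b n] b n by simp
        qed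
        then show "kvs.dim (I \<inter> forms n) = 0" using dim by simp }
      { assume n: "d < n"
        have "lead_degs (I \<inter> forms n) = {..n}" using ld n sub by blast
        then show "kvs.dim (I \<inter> forms n) = n + 1" using dim by simp }
    qed
    moreover have "lead_degs (I \<inter> forms d) = S"
      using ld[of _ d] lead_degs_subset[of "I \<inter> forms d" d] assms(3) by blast
    ultimately show "I \<in> ?R" using subn[of d] by blast
  qed
qed

section \<open>Coordinates on cells and charts\<close>

text \<open>
  The reduced basis of the subspace with coordinates \<open>v\<close>: one vector for each
  pivot, whose remaining monomials are not pivots.
\<close>

definition chart_form ::
  "nat \<Rightarrow> nat set \<Rightarrow> ((nat \<times> nat) \<times> (nat \<times> nat) \<Rightarrow> 'k::field) \<Rightarrow> nat \<Rightarrow> 'k poly poly" where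
  "chart_form d S v b = bimonom (dmon d b) -
     (\<Sum>c\<in>{..d} - S. smult [:v (dmon d b, dmon d c):] (bimonom (dmon d c)))"

definition chart_space ::
  "nat \<Rightarrow> nat set \<Rightarrow> ((nat \<times> nat) \<times> (nat \<times> nat) \<Rightarrow> 'k::field) \<Rightarrow> 'k poly poly set" where
  "chart_space d S v = kvs.span (chart_form d S v ` S)"

lemma sum_nonpivot_in_supported:
  "(\<Sum>c\<in>{..d} - S. smult [:u c:] (bimonom (dmon d c))) \<in> (nonpivot_forms d S :: 'k::field poly poly set)"
  by (intro kvs.subspace_sum[OF subspace_supported] kvs.subspace_scale[OF subspace_supported]) simp

lemma bicoeff_sum_nonpivot:
  assumes "c \<le> d"
  shows "bicoeff (\<Sum>c\<in>{..d} - S. smult [:u c:] (bimonom (dmon d c))) (dmon d c)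
     = (if c \<in> S then 0 else (u c :: 'k::field))"
proof -
  have "bicoeff (\<Sum>c\<in>{..d} - S. smult [:u c:] (bimonom (dmon d c))) (dmon d c)
      = (\<Sum>e\<in>{..d} - S. if e = c then u c else 0)"
    unfolding bicoeff_sum by (intro sum.cong) auto
  then show ?thesis using assms by simp
qed

lemma eq_sum_nonpivot:
  assumes "g \<in> (nonpivot_forms d S :: 'k::field poly poly set)"
  shows "g = (\<Sum>c\<in>{..d} - S. smult [:bicoeff g (dmon d c):] (bimonom (dmon d c)))"
proof -
  have "g = (\<Sum>m\<in>dmon d ` ({..d} - S). smult [:bicoeff g m:] (bimonom m))"
    using supportedD[OF assms] by (intro bipoly_eq_sum_bimonom) auto
  also have "\<dots> = (\<Sum>c\<in>{..d} - S. smult [:bicoeff g (dmon d c):] (bimonom (dmon d c)))"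
    by (subst sum.reindex) (auto simp: inj_on_def)
  finally show ?thesis .
qed

lemma supported_compl_subset_forms: "nonpivot_forms d S \<subseteq> forms d"
  unfolding forms_eq_dmon by (rule supported_mono) auto

lemma bimonom_dmon_in_forms: "b \<le> d \<Longrightarrow> bimonom (dmon d b) \<in> forms d"
  by (simp add: forms_eq_dmon)

lemma chart_form_in_forms:
  assumes "b \<le> d"
  shows "chart_form d S v b \<in> forms d"
  unfolding chart_form_def
  by (intro kvs.subspace_diff[OF subspace_forms] bimonom_dmon_in_forms[OF assms]
      subsetD[OF supported_compl_subset_forms sum_nonpivot_in_supported])

lemma bicoeff_chart_form:
  assumes "e \<le> d"
  shows "bicoeff (chart_form d S v b) (dmon d e) =
    (if e = b then 1 else 0) - (if e \<in> S then 0 else v (dmon d b, dmon d e))"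
  unfolding chart_form_def bicoeff_diff bicoeff_sum_nonpivot[OF assms] by auto

lemma chart_space_subset_forms:
  "S \<subseteq> {..d} \<Longrightarrow> chart_space d S v \<subseteq> forms d"
  unfolding chart_space_def using chart_form_in_forms[of _ d S v]
  by (intro kvs.span_minimal subspace_forms) blast

lemma subspace_chart_space: "kvs.subspace (chart_space d S v)"
  by (simp add: chart_space_def)

text \<open>
  Each vector of the reduced basis has coefficient 1 at its own pivot and 0 at the others, so
  the coefficients of \<open>f\<close> at the pivots are its coordinates.
\<close>

lemma chart_space_expand:
  assumes "S \<subseteq> {..d}" "f \<in> chart_space d S v"
  shows "f = (\<Sum>b\<in>S. smult [:bicoeff f (dmon d b):] (chart_form d S v b))"
proof -
  have S: "finite S" "\<And>b. b \<in> S \<Longrightarrow> b \<le> d" using assms(1) finite_subset by blast+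
  have coeff: "bicoeff (chart_form d S v b) (dmon d e) = (if b = e then 1 else 0)" if "e \<in> S" for b e
    using that S(2)[OF that] by (simp add: bicoeff_chart_form)
  have "inj_on (chart_form d S v) S"
    using coeff by (metis (no_types, lifting) inj_onI zero_neq_one)
  then obtain c where c: "f = (\<Sum>b\<in>S. smult [:c b:] (chart_form d S v b))"
    using span_image_coefficients[OF S(1)] assms(2) unfolding chart_space_def by blast
  have "bicoeff f (dmon d e) = c e" if e: "e \<in> S" for e
  proof -
    have "bicoeff f (dmon d e) = (\<Sum>b\<in>S. if b = e then c b else 0)"
      unfolding c bicoeff_sum by (intro sum.cong) (simp_all add: coeff[OF e])
    then show ?thesis using S(1) e by simp
  qed
  then show ?thesis using c by simp
qed

lemma complementary_chart_space:
  assumes "S \<subseteq> {..d}"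
  shows "complementary d S (chart_space d S (v :: _ \<Rightarrow> 'k::field))"
  unfolding complementary_def
proof (intro conjI ballI subsetI)
  fix f assume f: "f \<in> chart_space d S v \<inter> nonpivot_forms d S"
  have "bicoeff f (dmon d b) = 0" if "b \<in> S" for b
  proof -
    have "dmon d b \<notin> dmon d ` ({..d} - S)" using that by auto
    then show ?thesis using f supportedD by blast
  qed
  then have "(\<Sum>b\<in>S. smult [:bicoeff f (dmon d b):] (chart_form d S v b)) = 0" by (intro sum.neutral) simp
  then show "f \<in> {0}" using chart_space_expand[OF assms, of f v] f by simp
next
  fix f :: "'k poly poly" assume f: "f \<in> forms d"
  have fin: "finite S" using assms finite_subset by blast
  define h where "h = (\<Sum>b\<in>S. smult [:bicoeff f (dmon d b):] (chart_form d S v b))"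
  have h: "h \<in> chart_space d S v"
    unfolding h_def chart_space_def by (intro kvs.span_sum kvs.span_scale kvs.span_base) simp
  have "f - h \<in> nonpivot_forms d S"
    unfolding supported_def mem_Collect_eq
  proof (intro allI impI)
    fix m assume m: "bicoeff (f - h) m \<noteq> 0"
    have "f - h \<in> forms d"
      using f h chart_space_subset_forms[OF assms] kvs.subspace_diff[OF subspace_forms] by blast
    then obtain e where e: "m = dmon d e" "e \<le> d"
      using m supportedD[of "f - h" "dmon d ` {..d}" m] unfolding forms_eq_dmon by blast
    have "e \<notin> S"
    proof
      assume eS: "e \<in> S"
      have "bicoeff h m = (\<Sum>b\<in>S. if b = e then bicoeff f m else 0)"
        unfolding h_def bicoeff_sum
        by (intro sum.cong) (use e eS in \<open>auto simp: bicoeff_chart_form\<close>)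
      then have "bicoeff (f - h) m = 0" using eS fin by simp
      then show False using m by blast
    qed
    then show "m \<in> dmon d ` ({..d} - S)" using e by blast
  qed
  then show "\<exists>g\<in>nonpivot_forms d S. f - g \<in> chart_space d S v"
    using h by (intro bexI[of _ "f - h"]) auto
qed

lemma chart_space_eqI:
  assumes "S \<subseteq> {..d}" "kvs.subspace V" "V \<subseteq> (forms d :: 'k::field poly poly set)" "complementary d S V"
    and "\<And>b. b \<in> S \<Longrightarrow> chart_form d S v b \<in> V"
  shows "V = chart_space d S v"
proof
  show sub: "chart_space d S v \<subseteq> V"
    unfolding chart_space_def using assms(5) by (intro kvs.span_minimal assms(2)) blast
  show "V \<subseteq> chart_space d S v"
  proof
    fix f assume f: "f \<in> V"
    obtain g where g: "g \<in> nonpivot_forms d S" "f - g \<in> chart_space d S v"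
      using complementary_chart_space[OF assms(1), of v] f assms(3) unfolding complementary_def by blast
    have "f - (f - g) \<in> V" using f g(2) sub using kvs.subspace_diff[OF assms(2)] by blast
    then have "g \<in> V \<inter> nonpivot_forms d S" using g(1) by simp
    then have "g = 0" using assms(4) unfolding complementary_def by blast
    then show "f \<in> chart_space d S v" using g(2) by simp
  qed
qed

lemma truncation_exists:
  "\<exists>l. \<forall>m. bicoeff l m = (if m \<in> A then bicoeff (f :: 'k::field poly poly) m else 0)"
proof -
  let ?B = "{m. bicoeff f m \<noteq> 0} \<inter> A"
  have "bicoeff (\<Sum>m\<in>?B. smult [:bicoeff f m:] (bimonom m)) m = (if m \<in> A then bicoeff f m else 0)" for m
  proof -
    have "bicoeff (\<Sum>m\<in>?B. smult [:bicoeff f m:] (bimonom m)) m = (\<Sum>i\<in>?B. if i = m then bicoeff f m else 0)"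
      unfolding bicoeff_sum by (intro sum.cong) auto
    also have "\<dots> = (if m \<in> ?B then bicoeff f m else 0)"
      using finite_bicoeff_support[of f] by (subst sum.delta) auto
    finally show ?thesis by auto
  qed
  then show ?thesis by blast
qed

lemma basis_exps_Int_deg_ge: "basis_exps d S \<inter> deg_ge d = dmon d ` ({..d} - S)"
  by (auto simp: basis_exps_def deg_ge_def dmon_deg)

text \<open>
  Both conditions on \<open>g\<close> together leave only monomials of degree \<open>d\<close>
  outside the pivots.
\<close>

lemma complementary_unique:
  assumes "complementary d S V" "g \<in> supported (basis_exps d S)" "g \<in> top_ideal d V"
  shows "g = 0"
proof -
  have "g \<in> supported (basis_exps d S) \<inter> supported (deg_ge d)"
    using assms(2,3) by (simp add: top_ideal_def)
  then have g: "g \<in> nonpivot_forms d S" by (simp add: supported_Int basis_exps_Int_deg_ge)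
  then have "hom_component d g = g" using supported_compl_subset_forms hom_component_form by blast
  then show ?thesis using assms(1,3) g by (auto simp: top_ideal_def complementary_def)
qed

text \<open>
  A normal form keeps the monomials below degree \<open>d\<close>, forgets those above, and in
  degree \<open>d\<close> is the projection along \<open>V\<close>.
\<close>

lemma monomial_basis_mod_top_ideal:
  assumes "kvs.subspace V" "complementary d S V"
  shows "monomial_basis_mod (basis_exps d S) (top_ideal d (V :: 'k::field poly poly set))"
  unfolding monomial_basis_mod_def span_bimonom
proof (intro allI ex_ex1I)
  have I: "kvs.subspace (top_ideal d V)"
    by (rule ideal_subspace_imp_kvs_subspace[OF ideal_top_ideal[OF assms(1)]])
  fix f :: "'k poly poly"
  obtain l where l: "\<And>m. bicoeff l m = (if m \<in> - deg_ge d then bicoeff f m else 0)"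
    using truncation_exists[of "- deg_ge d" f] by blast
  obtain g where g: "g \<in> nonpivot_forms d S" "hom_component d f - g \<in> V"
    using assms(2) hom_component_in_forms unfolding complementary_def by blast
  have gf: "g \<in> forms d" using g(1) supported_compl_subset_forms by blast
  have l_sup: "l \<in> supported (basis_exps d S)"
    unfolding supported_def mem_Collect_eq
  proof (intro allI impI)
    fix m assume "bicoeff l m \<noteq> 0"
    then have "m \<in> - deg_ge d" using l by metis
    then show "m \<in> basis_exps d S" by (simp add: basis_exps_def deg_ge_def)
  qed
  have "g \<in> supported (basis_exps d S)"
    using g(1) supported_mono[of "dmon d ` ({..d} - S)" "basis_exps d S"] unfolding basis_exps_def by blast
  with l_sup have "l + g \<in> supported (basis_exps d S)" by (rule kvs.subspace_add[OF subspace_supported])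
  moreover have "f - (l + g) \<in> top_ideal d V"
  proof -
    have "hom_component d l = 0"
      by (rule bipoly_eqI) (simp add: bicoeff_hom_component l deg_ge_def)
    then have "hom_component d (f - (l + g)) = hom_component d f - g"
      by (simp add: hom_component_diff hom_component_add hom_component_form[OF gf])
    moreover have "f - (l + g) \<in> supported (deg_ge d)"
      unfolding supported_def mem_Collect_eq
    proof (intro allI impI, rule ccontr)
      fix m assume m: "bicoeff (f - (l + g)) m \<noteq> 0" "m \<notin> deg_ge d"
      then have "bicoeff g m = 0"
        using gf supportedD[of g _ m] unfolding forms_eq_supported by (auto simp: deg_ge_def)
      then show False using m l[of m] by simp
    qed
    ultimately show ?thesis using g(2) by (simp add: top_ideal_def)
  qed
  ultimately show "\<exists>g. g \<in> supported (basis_exps d S) \<and> f - g \<in> top_ideal d V" by blast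
  fix g1 g2
  assume g1: "g1 \<in> supported (basis_exps d S) \<and> f - g1 \<in> top_ideal d V"
    and g2: "g2 \<in> supported (basis_exps d S) \<and> f - g2 \<in> top_ideal d V"
  have "g1 - g2 \<in> supported (basis_exps d S)"
    using g1 g2 by (simp add: kvs.subspace_diff[OF subspace_supported])
  moreover have "(f - g2) - (f - g1) \<in> top_ideal d V"
    using g1 g2 kvs.subspace_diff[OF I] by blast
  then have "g1 - g2 \<in> top_ideal d V" by (simp add: algebra_simps)
  ultimately have "g1 - g2 = 0" by (rule complementary_unique[OF assms(2)])
  then show "g1 = g2" by simp
qed

lemma coords_eqI:
  assumes "kvs.subspace V" "complementary d S V"
    and g: "g \<in> supported (basis_exps d S)" "bimonom \<mu> - g \<in> top_ideal d (V :: 'k::field poly poly set)"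
  shows "coords (basis_exps d S) (top_ideal d V) (\<mu>, \<nu>) = bicoeff g \<nu>"
proof -
  have "\<exists>!g. g \<in> kvs.span (bimonom ` basis_exps d S) \<and> bimonom \<mu> - g \<in> top_ideal d V"
    using monomial_basis_mod_top_ideal[OF assms(1,2)] by (simp add: monomial_basis_mod_def)
  then have "normal_form (basis_exps d S) (top_ideal d V) (bimonom \<mu>) = g"
    unfolding normal_form_def using g by (intro the1_equality) (auto simp: span_bimonom)
  then show ?thesis by (simp add: coords_def)
qed

text \<open>
  The coordinates of a normal form carry information only at pairs of a pivot and a nonpivot in
  degree \<open>d\<close>; all other values are forced. Forced values are constant on the whole
  chart, so the set is an affine subspace.
\<close>

definition chart_coords :: "nat \<Rightarrow> nat set \<Rightarrow> ((nat \<times> nat) \<times> (nat \<times> nat) \<Rightarrow> 'k::field) set" where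
  "chart_coords d S = {v. \<forall>\<mu> \<nu>.
     (\<mu> \<in> basis_exps d S \<longrightarrow> v (\<mu>, \<nu>) = (if \<mu> = \<nu> then 1 else 0)) \<and>
     (d < fst \<mu> + snd \<mu> \<longrightarrow> v (\<mu>, \<nu>) = 0) \<and>
     (\<mu> \<in> dmon d ` S \<and> \<nu> \<notin> dmon d ` ({..d} - S) \<longrightarrow> v (\<mu>, \<nu>) = 0)}"

lemma chart_coordsD:
  assumes "v \<in> chart_coords d S"
  shows "\<mu> \<in> basis_exps d S \<Longrightarrow> v (\<mu>, \<nu>) = (if \<mu> = \<nu> then 1 else 0)"
    and "d < fst \<mu> + snd \<mu> \<Longrightarrow> v (\<mu>, \<nu>) = 0"
    and "\<mu> \<in> dmon d ` S \<Longrightarrow> \<nu> \<notin> dmon d ` ({..d} - S) \<Longrightarrow> v (\<mu>, \<nu>) = 0"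
  using assms unfolding chart_coords_def by blast+

lemma exponent_cases:
  assumes "S \<subseteq> {..d}"
  obtains "\<mu> \<in> basis_exps d S" | "d < fst \<mu> + snd \<mu>" | b where "b \<in> S" "\<mu> = dmon d b"
proof -
  consider "fst \<mu> + snd \<mu> < d" | "fst \<mu> + snd \<mu> = d" | "d < fst \<mu> + snd \<mu>" by linarith
  then show thesis
  proof cases
    case 2
    then have "\<mu> = dmon d (snd \<mu>)" "snd \<mu> \<le> d" using degree_eq_dmon[of \<mu> d] by auto
    then show ?thesis using that unfolding basis_exps_def by (cases "snd \<mu> \<in> S") blast+
  qed (use that in \<open>auto simp: basis_exps_def\<close>)
qed

lemma bimonom_high_in_top_ideal:
  assumes "kvs.subspace V" "V \<subseteq> (forms d :: 'k::field poly poly set)" "d < fst \<mu> + snd \<mu>"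
  shows "bimonom \<mu> \<in> top_ideal d V"
proof -
  have "(bimonom \<mu> :: 'k poly poly) \<in> forms (fst \<mu> + snd \<mu>)" by (simp add: forms_eq_supported)
  then show ?thesis using top_ideal_Int_forms[OF assms(1,2), of "fst \<mu> + snd \<mu>"] assms(3) by auto
qed

lemma form_in_top_ideal:
  assumes "kvs.subspace V" "V \<subseteq> (forms d :: 'k::field poly poly set)" "f \<in> V"
  shows "f \<in> top_ideal d V"
  using top_ideal_Int_forms[OF assms(1,2), of d] assms(3) by auto

lemma coords_basic:
  assumes V: "kvs.subspace V" "V \<subseteq> (forms d :: 'k::field poly poly set)" "complementary d S V"
  shows "\<mu> \<in> basis_exps d S \<Longrightarrow>
      coords (basis_exps d S) (top_ideal d V) (\<mu>, \<nu>) = (if \<mu> = \<nu> then 1 else 0)"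
    and "d < fst \<mu> + snd \<mu> \<Longrightarrow> coords (basis_exps d S) (top_ideal d V) (\<mu>, \<nu>) = 0"
    and "g \<in> nonpivot_forms d S \<Longrightarrow> bimonom \<mu> - g \<in> V \<Longrightarrow>
      coords (basis_exps d S) (top_ideal d V) (\<mu>, \<nu>) = bicoeff g \<nu>"
proof -
  have zero: "0 \<in> top_ideal d V" by (rule ideal.subspace_0[OF ideal_top_ideal[OF V(1)]])
  show "\<mu> \<in> basis_exps d S \<Longrightarrow>
      coords (basis_exps d S) (top_ideal d V) (\<mu>, \<nu>) = (if \<mu> = \<nu> then 1 else 0)"
    using coords_eqI[OF V(1,3), of "bimonom \<mu>" \<mu> \<nu>] zero by simp
  show "d < fst \<mu> + snd \<mu> \<Longrightarrow> coords (basis_exps d S) (top_ideal d V) (\<mu>, \<nu>) = 0"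
    using coords_eqI[OF V(1,3), of 0 \<mu> \<nu>] bimonom_high_in_top_ideal[OF V(1,2), of \<mu>]
      kvs.subspace_0[OF subspace_supported[of "basis_exps d S", where 'a='k]] by simp
  assume g: "g \<in> nonpivot_forms d S" "bimonom \<mu> - g \<in> V"
  have "g \<in> supported (basis_exps d S)"
    using g(1) supported_mono[of "dmon d ` ({..d} - S)" "basis_exps d S"] unfolding basis_exps_def by blast
  then show "coords (basis_exps d S) (top_ideal d V) (\<mu>, \<nu>) = bicoeff g \<nu>"
    using coords_eqI[OF V(1,3)] form_in_top_ideal[OF V(1,2) g(2)] by blast
qed

lemma coords_in_chart_coords:
  assumes S: "S \<subseteq> {..d}" and V: "kvs.subspace V" "V \<subseteq> (forms d :: 'k::field poly poly set)" "complementary d S V"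
  defines "v \<equiv> coords (basis_exps d S) (top_ideal d V)"
  shows "v \<in> chart_coords d S" "V = chart_space d S v"
proof -
  have ex: "\<exists>g\<in>nonpivot_forms d S. bimonom (dmon d b) - g \<in> V" if "b \<in> S" for b
    using V(3) bimonom_dmon_in_forms[of b d, where 'a='k] S that unfolding complementary_def by blast
  have "v (dmon d b, \<nu>) = 0" if b: "b \<in> S" and \<nu>: "\<nu> \<notin> dmon d ` ({..d} - S)" for b \<nu>
  proof -
    obtain g where g: "g \<in> nonpivot_forms d S" "bimonom (dmon d b) - g \<in> V" using ex[OF b] by blast
    then show ?thesis using coords_basic(3)[OF V g] supportedD[OF g(1) \<nu>] by (simp add: v_def)
  qed
  then show "v \<in> chart_coords d S"
    using coords_basic(1,2)[OF V] unfolding chart_coords_def v_def by blast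
  show "V = chart_space d S v"
  proof (rule chart_space_eqI[OF S V])
    fix b assume b: "b \<in> S"
    obtain g where g: "g \<in> nonpivot_forms d S" "bimonom (dmon d b) - g \<in> V" using ex[OF b] by blast
    have "chart_form d S v b = bimonom (dmon d b) - g"
      unfolding chart_form_def v_def coords_basic(3)[OF V g] using eq_sum_nonpivot[OF g(1)] by simp
    then show "chart_form d S v b \<in> V" using g(2) by simp
  qed
qed

text \<open>
  The normal form of a pivot monomial is read off from the reduced basis vector of that pivot.
\<close>

lemma coords_chart_space:
  assumes S: "S \<subseteq> {..d}" and v: "v \<in> (chart_coords d S :: (_ \<Rightarrow> 'k::field) set)"
  shows "coords (basis_exps d S) (top_ideal d (chart_space d S v)) = v"
proof (rule ext, clarify)
  fix a b a' b' :: nat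
  define \<mu> \<nu> where "\<mu> = (a, b)" and "\<nu> = (a', b')"
  note V = subspace_chart_space[of d S v] chart_space_subset_forms[OF S, of v] complementary_chart_space[OF S, of v]
  have "coords (basis_exps d S) (top_ideal d (chart_space d S v)) (\<mu>, \<nu>) = v (\<mu>, \<nu>)"
  proof (rule exponent_cases[OF S, of \<mu>])
    assume "\<mu> \<in> basis_exps d S"
    then show ?thesis by (simp only: coords_basic(1)[OF V] chart_coordsD(1)[OF v])
  next
    assume "d < fst \<mu> + snd \<mu>"
    then show ?thesis by (simp only: coords_basic(2)[OF V] chart_coordsD(2)[OF v])
  next
    fix b assume b: "b \<in> S" "\<mu> = dmon d b"
    let ?g = "\<Sum>c\<in>{..d} - S. smult [:v (dmon d b, dmon d c):] (bimonom (dmon d c)) :: 'k poly poly"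
    have "chart_form d S v b \<in> chart_space d S v"
      unfolding chart_space_def using b(1) by (intro kvs.span_base) blast
    then have "bimonom \<mu> - ?g \<in> chart_space d S v" by (simp only: chart_form_def b(2))
    from coords_basic(3)[OF V sum_nonpivot_in_supported this, of \<nu>]
    have 1: "coords (basis_exps d S) (top_ideal d (chart_space d S v)) (\<mu>, \<nu>) = bicoeff ?g \<nu>" .
    show ?thesis
    proof (cases "\<nu> \<in> dmon d ` ({..d} - S)")
      case True
      then obtain c where "c \<le> d" "c \<notin> S" "\<nu> = dmon d c" by blast
      then show ?thesis unfolding 1 by (simp only: bicoeff_sum_nonpivot b(2) if_False)
    next
      case False
      then show ?thesis
        unfolding 1 using supportedD[OF sum_nonpivot_in_supported False] chart_coordsD(3)[OF v _ False, of \<mu>] b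
        by simp
    qed
  qed
  then show "coords (basis_exps d S) (top_ideal d (chart_space d S v)) ((a, b), (a', b')) = v ((a, b), (a', b'))"
    by (simp add: \<mu>_def \<nu>_def)
qed

definition cell_coords :: "nat \<Rightarrow> nat set \<Rightarrow> ((nat \<times> nat) \<times> (nat \<times> nat) \<Rightarrow> 'k::field) set" where
  "cell_coords d S = {v \<in> chart_coords d S. \<forall>b\<in>S. \<forall>c\<le>d. b < c \<longrightarrow> v (dmon d b, dmon d c) = 0}"

text \<open>
  The reduction of a pivot monomial involves no monomials of higher $y$-degree.
\<close>

lemma coords_in_cell_coords:
  assumes V: "kvs.subspace V" "V \<subseteq> (forms d :: 'k::field poly poly set)"
  shows "coords (basis_exps d (lead_degs V)) (top_ideal d V) \<in> cell_coords d (lead_degs V)"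
proof -
  let ?S = "lead_degs V"
  have S: "?S \<subseteq> {..d}" by (rule lead_degs_subset[OF V(2)])
  have comp: "complementary d ?S V" by (rule complementary_lead_degs[OF V])
  have "coords (basis_exps d ?S) (top_ideal d V) (dmon d b, dmon d c) = 0" if bc: "b \<in> ?S" "c \<le> d" "b < c" for b c
  proof -
    have "(bimonom (dmon d b) :: 'k poly poly) \<in> supported (dmon d ` {..<Suc b})" by simp
    then obtain h where h: "h \<in> V" "bimonom (dmon d b) - h \<in> supported (dmon d ` ({..<Suc b} - ?S))"
      using reduce_form[OF V, of "bimonom (dmon d b)" "Suc b"] bc by auto
    let ?g = "bimonom (dmon d b) - h"
    have "?g \<in> supported (dmon d ` ({..d} - ?S))"
      using h(2) supported_mono[of "dmon d ` ({..<Suc b} - ?S)" "dmon d ` ({..d} - ?S)"] bc by fastforce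
    then have "coords (basis_exps d ?S) (top_ideal d V) (dmon d b, dmon d c) = bicoeff ?g (dmon d c)"
      using h(1) by (intro coords_basic(3)[OF V comp]) auto
    also have "dmon d c \<notin> dmon d ` ({..<Suc b} - ?S)" using bc by auto
    then have "bicoeff ?g (dmon d c) = 0" by (rule supportedD[OF h(2)])
    finally show ?thesis .
  qed
  then show ?thesis using coords_in_chart_coords(1)[OF S V comp] by (simp add: cell_coords_def)
qed

text \<open>
  In a combination of triangular basis vectors the highest monomial that survives belongs to a
  pivot: a nonpivot coefficient only receives contributions from higher pivots.
\<close>

lemma lead_degs_chart_space:
  assumes S: "S \<subseteq> {..d}" and v: "v \<in> (cell_coords d S :: (_ \<Rightarrow> 'k::field) set)"
  shows "lead_degs (chart_space d S v) = S"
proof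
  have fin: "finite S" using S finite_subset by blast
  have tri: "v (dmon d b, dmon d c) = 0" if "b \<in> S" "c \<le> d" "b < c" for b c
    using v that by (simp add: cell_coords_def)
  show "S \<subseteq> lead_degs (chart_space d S v)"
  proof
    fix b assume b: "b \<in> S"
    then have bd: "b \<le> d" using S by blast
    have "chart_form d S v b \<noteq> 0 \<and> degree (chart_form d S v b) = b"
      using form_degree_eqI[OF chart_form_in_forms[OF bd], of S v b] b bd tri[OF b]
      by (auto simp: bicoeff_chart_form)
    moreover have "chart_form d S v b \<in> chart_space d S v"
      unfolding chart_space_def using b by (intro kvs.span_base) blast
    ultimately show "b \<in> lead_degs (chart_space d S v)" unfolding lead_degs_def by force
  qed
  show "lead_degs (chart_space d S v) \<subseteq> S"
  proof
    fix e assume "e \<in> lead_degs (chart_space d S v)"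
    then obtain f where f: "f \<in> chart_space d S v" "f \<noteq> 0" "e = degree f" by (auto simp: lead_degs_def)
    have ff: "f \<in> forms d" using f(1) chart_space_subset_forms[OF S] by blast
    note deg = form_degree[OF ff f(2)]
    show "e \<in> S"
    proof (rule ccontr)
      assume e: "e \<notin> S"
      have "bicoeff f (dmon d b) * bicoeff (chart_form d S v b) (dmon d e) = 0" if b: "b \<in> S" for b
      proof (cases "b < e")
        case True
        then show ?thesis using tri[OF b _ True] deg(1) f(3) e by (simp add: bicoeff_chart_form)
      next
        case False
        then have "e < b" using b e by (metis linorder_neqE_nat)
        then show ?thesis using deg(4) f(3) by simp
      qed
      then have "bicoeff (\<Sum>b\<in>S. smult [:bicoeff f (dmon d b):] (chart_form d S v b)) (dmon d e) = 0"
        unfolding bicoeff_sum bicoeff_smult by (intro sum.neutral) blast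
      then show False using deg(2) f(3) chart_space_expand[OF S f(1)] by simp
    qed
  qed
qed

lemma jordan_cell_eq_image:
  assumes "is_partition P" "C_exps P = basis_exps d S" "S \<subseteq> {..d}"
  shows "(jordan_cell P :: 'k::field poly poly set set) = (\<lambda>v. top_ideal d (chart_space d S v)) ` cell_coords d S"
    (is "_ = ?R")
proof
  show "jordan_cell P \<subseteq> ?R"
  proof
    fix I :: "'k poly poly set" assume "I \<in> jordan_cell P"
    then obtain V where V: "kvs.subspace V" "V \<subseteq> forms d" "lead_degs V = S" "I = top_ideal d V"
      unfolding jordan_cell_eq[OF assms] by blast
    have "coords (basis_exps d S) (top_ideal d V) \<in> cell_coords d S"
      using coords_in_cell_coords[OF V(1,2)] V(3) by simp
    moreover have "V = chart_space d S (coords (basis_exps d S) (top_ideal d V))"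
      using coords_in_chart_coords(2)[OF assms(3) V(1,2)] complementary_lead_degs[OF V(1,2)] V(3) by simp
    ultimately show "I \<in> ?R" using V(4) by (metis imageI)
  qed
  show "?R \<subseteq> jordan_cell P"
    unfolding jordan_cell_eq[OF assms]
    using lead_degs_chart_space[OF assms(3)] subspace_chart_space chart_space_subset_forms[OF assms(3)] by blast
qed

lemma graded_ideals_T_seq:
  assumes "t \<le> d"
  shows "(graded_ideals (T_seq d t) :: 'k::field poly poly set set) =
    {top_ideal d V | V. kvs.subspace V \<and> V \<subseteq> forms d \<and> kvs.dim V = d + 1 - t}" (is "_ = ?R")
proof
  show "?R \<subseteq> (graded_ideals (T_seq d t) :: 'k poly poly set set)"
  proof
    fix I :: "'k poly poly set" assume "I \<in> ?R"
    then obtain V where V: "kvs.subspace V" "V \<subseteq> forms d" "kvs.dim V = d + 1 - t" "I = top_ideal d V" by blast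
    then show "I \<in> graded_ideals (T_seq d t)"
      using graded_top_ideal[OF V(1,2)] hilbert_top_ideal[OF V(1,2)] assms by (simp add: graded_ideals_def)
  qed
  show "(graded_ideals (T_seq d t) :: 'k poly poly set set) \<subseteq> ?R"
  proof
    fix I :: "'k poly poly set" assume "I \<in> graded_ideals (T_seq d t)"
    then have I: "graded_ideal I" "\<And>n. hilbert I n = T_seq d t n" by (auto simp: graded_ideals_def)
    have sub: "kvs.subspace I" using I(1) ideal_subspace_imp_kvs_subspace by (auto simp: graded_ideal_def)
    have subn: "kvs.subspace (I \<inter> forms n)" for n by (intro kvs.subspace_inter sub subspace_forms)
    have dim: "n + 1 - kvs.dim (I \<inter> forms n) = T_seq d t n" "kvs.dim (I \<inter> forms n) \<le> n + 1" for n
      using I(2)[of n] dim_le_if_subset_forms[of "I \<inter> forms n" n] by (simp_all add: hilbert_def dim_forms)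
    have "I = top_ideal d (I \<inter> forms d)"
    proof (rule graded_ideal_eq_top_ideal_if_dims[OF I(1)])
      show "kvs.dim (I \<inter> forms n) = 0" if "n < d" for n using dim[of n] that by (simp add: T_seq_def)
      show "kvs.dim (I \<inter> forms n) = n + 1" if "d < n" for n using dim[of n] that by (simp add: T_seq_def)
    qed
    moreover have "kvs.dim (I \<inter> forms d) = d + 1 - t" using dim[of d] assms by (simp add: T_seq_def)
    ultimately show "I \<in> ?R" using subn[of d] by blast
  qed
qed

text \<open>
  Uniqueness of normal forms excludes from the basis all monomials of degree above
  \<open>d\<close>, because these lie in the ideal; existence forces into the basis all
  monomials of degree below \<open>d\<close>, because the ideal has no elements there.
\<close>

lemma chart_structure:
  assumes "t \<le> d" "I \<in> (chart (T_seq d t) C :: 'k::field poly poly set set)"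
  obtains S V where "S \<subseteq> {..d}" "C = basis_exps d S" "card S = d + 1 - t"
    "kvs.subspace V" "V \<subseteq> forms d" "complementary d S V" "I = top_ideal d V"
proof -
  obtain V where V: "kvs.subspace V" "V \<subseteq> forms d" "kvs.dim V = d + 1 - t" "I = top_ideal d V"
    using assms graded_ideals_T_seq[OF assms(1), where 'k='k] unfolding chart_def by blast
  have mb: "\<exists>!g. g \<in> supported C \<and> f - g \<in> top_ideal d V" for f
    using assms(2) V(4) by (simp add: chart_def monomial_basis_mod_def span_bimonom)
  have I: "ideal.subspace (top_ideal d V)" by (rule ideal_top_ideal[OF V(1)])
  have zero: "f = 0" if "f \<in> supported C" "f \<in> top_ideal d V" for f
    using mb[of f] that ideal.subspace_0[OF I] kvs.subspace_0[OF subspace_supported[of C, where 'a='k]]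
    by (metis cancel_comm_monoid_add_class.diff_cancel diff_zero)
  define S where "S = {b. b \<le> d \<and> dmon d b \<notin> C}"
  have S: "S \<subseteq> {..d}" by (auto simp: S_def)
  have C: "C = basis_exps d S"
  proof (rule exps_eqI)
    fix n b :: nat assume b: "b \<le> n"
    consider "n < d" | "n = d" | "d < n" by linarith
    then show "dmon n b \<in> C \<longleftrightarrow> dmon n b \<in> basis_exps d S"
    proof cases
      case 1
      obtain g where g: "g \<in> supported C" "bimonom (dmon n b) - g \<in> top_ideal d V" using mb by blast
      have "bicoeff (bimonom (dmon n b) - g) (dmon n b) = 0"
        using g(2) dmon_deg[OF b] 1 by (intro supportedD[of _ "deg_ge d"]) (auto simp: top_ideal_def deg_ge_def)
      then have "bicoeff g (dmon n b) \<noteq> 0" by simp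
      then have "dmon n b \<in> C" using supportedD[OF g(1)] by blast
      then show ?thesis using 1 by (simp add: dmon_in_basis_exps[OF b])
    next
      case 2
      then show ?thesis using b unfolding dmon_in_basis_exps[OF b] by (simp add: S_def)
    next
      case 3
      have "dmon n b \<notin> C"
      proof
        assume "dmon n b \<in> C"
        then have "(bimonom (dmon n b) :: 'k poly poly) = 0"
          using bimonom_high_in_top_ideal[OF V(1,2), of "dmon n b"] dmon_deg[OF b] 3 by (intro zero) auto
        then have "bicoeff (bimonom (dmon n b) :: 'k poly poly) (dmon n b) = 0" by simp
        then show False by simp
      qed
      then show ?thesis using 3 by (simp add: dmon_in_basis_exps[OF b])
    qed
  qed
  have comp: "complementary d S V"
    unfolding complementary_def
  proof (intro conjI ballI subsetI)
    fix f assume f: "f \<in> V \<inter> nonpivot_forms d S"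
    then have "f \<in> supported C"
      using supported_mono[of "dmon d ` ({..d} - S)" C] C unfolding basis_exps_def by blast
    then show "f \<in> {0}" using zero form_in_top_ideal[OF V(1,2)] f by blast
  next
    fix f :: "'k poly poly" assume f: "f \<in> forms d"
    obtain g where g: "g \<in> supported C" "f - g \<in> top_ideal d V" using mb by blast
    have "f - hom_component d g \<in> V"
      using g(2) f by (simp add: top_ideal_def hom_component_diff hom_component_form)
    moreover have "hom_component d g \<in> nonpivot_forms d S"
      unfolding supported_def mem_Collect_eq
    proof (intro allI impI)
      fix m assume m: "bicoeff (hom_component d g) m \<noteq> 0"
      then have "m \<in> basis_exps d S" "fst m + snd m = d"
        using supportedD[OF g(1), of m] C by (auto simp: bicoeff_hom_component split: if_splits)
      then show "m \<in> dmon d ` ({..d} - S)" by (simp add: basis_exps_def)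
    qed
    ultimately show "\<exists>g\<in>nonpivot_forms d S. f - g \<in> V" by blast
  qed
  have "card S = d + 1 - t" using dim_complementary[OF V(1,2) comp S] V(3) by simp
  then show thesis using that S C V comp by blast
qed

lemma chart_eq_image:
  assumes "t \<le> d" "S \<subseteq> {..d}" "card S = d + 1 - t"
  shows "(chart (T_seq d t) (basis_exps d S) :: 'k::field poly poly set set) =
    (\<lambda>v. top_ideal d (chart_space d S v)) ` chart_coords d S" (is "_ = ?R")
proof
  show "chart (T_seq d t) (basis_exps d S) \<subseteq> ?R"
  proof
    fix I :: "'k poly poly set" assume I: "I \<in> chart (T_seq d t) (basis_exps d S)"
    obtain S' V where V: "S' \<subseteq> {..d}" "basis_exps d S = basis_exps d S'"
      "kvs.subspace V" "V \<subseteq> forms d" "complementary d S' V" "I = top_ideal d V"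
      by (rule chart_structure[OF assms(1) I])
    have "b \<in> S \<longleftrightarrow> b \<in> S'" if "b \<le> d" for b
      using V(2) dmon_in_basis_exps[OF that, of d S] dmon_in_basis_exps[OF that, of d S'] by simp
    then have "S' = S" using V(1) assms(2) by blast
    then show "I \<in> ?R" using coords_in_chart_coords[OF assms(2) V(3,4)] V(5,6) by (metis imageI)
  qed
  show "?R \<subseteq> chart (T_seq d t) (basis_exps d S)"
  proof
    fix I :: "'k poly poly set" assume "I \<in> ?R"
    then obtain v where v: "I = top_ideal d (chart_space d S v)" by blast
    note V = subspace_chart_space[of d S v] chart_space_subset_forms[OF assms(2), of v]
    note comp = complementary_chart_space[OF assms(2), of v]
    have "kvs.dim (chart_space d S v) = d + 1 - t" using dim_complementary[OF V comp assms(2)] assms(3) by simp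
    then have "I \<in> graded_ideals (T_seq d t)" unfolding graded_ideals_T_seq[OF assms(1)] using V v by blast
    then show "I \<in> chart (T_seq d t) (basis_exps d S)"
      using monomial_basis_mod_top_ideal[OF V(1) comp] v by (simp add: chart_def)
  qed
qed

section \<open>Irreducibility and open conditions in the Zariski topology\<close>

definition line_point :: "('v \<Rightarrow> 'k::field) \<Rightarrow> ('v \<Rightarrow> 'k) \<Rightarrow> 'k \<Rightarrow> 'v \<Rightarrow> 'k" where
  "line_point v w l = (\<lambda>i. (1 - l) * v i + l * w i)"

lemma line_point_0 [simp]: "line_point v w 0 = v"
  and line_point_1 [simp]: "line_point v w 1 = w"
  by (simp_all add: line_point_def)

text \<open>
  Restricting a polynomial function to a line gives a polynomial in one variable, which has
  finitely many roots unless it is zero.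
\<close>

lemma poly_function_on_line:
  assumes "p \<in> poly_functions"
  shows "\<exists>q. \<forall>l. p (line_point v w l) = poly q l"
  using assms
proof induction
  case (const c)
  show ?case by (intro exI[of _ "[:c:]"]) simp
next
  case (coord i)
  show ?case by (intro exI[of _ "[:v i, w i - v i:]"]) (simp add: line_point_def algebra_simps)
next
  case (add p q)
  then show ?case by (metis poly_add)
next
  case (mult p q)
  then show ?case by (metis poly_mult)
qed

lemma line_avoids_zero_loci:
  assumes "infinite (UNIV :: 'k::field set)" "p \<in> poly_functions" "q \<in> poly_functions"
    and "p v \<noteq> 0" "q w \<noteq> (0 :: 'k)"
  shows "\<exists>l. p (line_point v w l) \<noteq> 0 \<and> q (line_point v w l) \<noteq> 0"
proof -
  obtain f where f: "\<And>l. p (line_point v w l) = poly f l" using poly_function_on_line assms(2) by blast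
  obtain g where g: "\<And>l. q (line_point v w l) = poly g l" using poly_function_on_line assms(3) by blast
  have "f \<noteq> 0" "g \<noteq> 0" using f[of 0] g[of 1] assms(4,5) by auto
  then have "finite {l. poly (f * g) l = 0}" by (intro poly_roots_finite) simp
  then obtain l where "poly (f * g) l \<noteq> 0" using ex_new_if_finite[OF assms(1)] by blast
  then show ?thesis using f g by auto
qed

lemma zariski_basic_neighbourhood:
  assumes "openin zariski U" "v \<in> U"
  shows "\<exists>p\<in>poly_functions. p v \<noteq> 0 \<and> {w. p w \<noteq> 0} \<subseteq> (U :: ('v \<Rightarrow> 'k::field) set)"
proof -
  have "generate_topology_on {{v. p v \<noteq> 0} | p. p \<in> poly_functions} U"
    using assms(1) unfolding zariski_def by (rule openin_topology_generated_by)
  then show ?thesis using assms(2)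
  proof (induction arbitrary: v)
    case (Int a b)
    have v: "v \<in> a" "v \<in> b" using Int.prems by auto
    obtain p where p: "p \<in> poly_functions" "p v \<noteq> 0" "{w. p w \<noteq> 0} \<subseteq> a"
      using Int.IH(1)[OF v(1)] by (elim bexE conjE)
    obtain q where q: "q \<in> poly_functions" "q v \<noteq> 0" "{w. q w \<noteq> 0} \<subseteq> b"
      using Int.IH(2)[OF v(2)] by (elim bexE conjE)
    show ?case
      using p q poly_functions.mult[OF p(1) q(1)] by (intro bexI[of _ "\<lambda>w. p w * q w"]) auto
  next
    case (UN K)
    obtain k where k: "k \<in> K" "v \<in> k" using UN.prems by (elim UnionE)
    obtain p where "p \<in> poly_functions" "p v \<noteq> 0" "{w. p w \<noteq> 0} \<subseteq> k"
      using UN.IH[OF k] by (elim bexE conjE)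
    then show ?case using Union_upper[OF k(1)] by (meson subset_trans)
  next
    case (Basis s)
    then obtain p where "p \<in> poly_functions" "s = {w. p w \<noteq> 0}" by (auto simp only: mem_Collect_eq)
    then show ?case using Basis.prems by (intro bexI[of _ p]) simp_all
  qed simp
qed

lemma openin_zariski_basic:
  assumes "p \<in> poly_functions"
  shows "openin zariski {v. p v \<noteq> 0}"
  unfolding zariski_def
  by (intro topology_generated_by_Basis CollectI exI[of _ p] conjI refl assms)

text \<open>
  The line through points of two basic open sets stays inside the coordinate set, and all but
  finitely many of its points lie in both open sets.
\<close>

lemma pullback_zariski_irreducible:
  fixes c :: "'a \<Rightarrow> 'v \<Rightarrow> 'k::field"
  assumes "infinite (UNIV :: 'k set)"
    and lines: "\<And>v w l. v \<in> c ` X \<Longrightarrow> w \<in> c ` X \<Longrightarrow> line_point v w l \<in> c ` X"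
    and U: "openin (pullback_topology X c zariski) U" "U \<noteq> {}"
    and W: "openin (pullback_topology X c zariski) W" "W \<noteq> {}"
  shows "U \<inter> W \<noteq> {}"
proof -
  obtain U' where U': "openin zariski U'" "U = c -` U' \<inter> X"
    using U(1) unfolding openin_pullback_topology by (elim exE conjE)
  obtain W' where W': "openin zariski W'" "W = c -` W' \<inter> X"
    using W(1) unfolding openin_pullback_topology by (elim exE conjE)
  obtain x y where "x \<in> U" "y \<in> W" using U(2) W(2) by blast
  then have x: "x \<in> X" "c x \<in> U'" and y: "y \<in> X" "c y \<in> W'" unfolding U'(2) W'(2) by simp_all
  obtain p where p: "p \<in> poly_functions" "p (c x) \<noteq> 0" "{w. p w \<noteq> 0} \<subseteq> U'"
    using zariski_basic_neighbourhood[OF U'(1) x(2)] by (elim bexE conjE)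
  obtain q where q: "q \<in> poly_functions" "q (c y) \<noteq> 0" "{w. q w \<noteq> 0} \<subseteq> W'"
    using zariski_basic_neighbourhood[OF W'(1) y(2)] by (elim bexE conjE)
  obtain l where l: "p (line_point (c x) (c y) l) \<noteq> 0" "q (line_point (c x) (c y) l) \<noteq> 0"
    using line_avoids_zero_loci[where p = p and q = q and v = "c x" and w = "c y", OF assms(1) p(1) q(1) p(2) q(2)] by (elim exE conjE)
  have "line_point (c x) (c y) l \<in> c ` X" by (rule lines) (simp_all add: x y)
  then obtain z where z: "line_point (c x) (c y) l = c z" "z \<in> X" by (elim imageE)
  have "c z \<in> U'" "c z \<in> W'"
    using subsetD[OF p(3), of "c z"] subsetD[OF q(3), of "c z"] l unfolding z(1) by simp_all
  then have "z \<in> U \<inter> W" unfolding U'(2) W'(2) using z(2) by simp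
  then show ?thesis by blast
qed

lemma poly_functions_diff:
  assumes "p \<in> poly_functions" "q \<in> poly_functions"
  shows "(\<lambda>v. p v - q v) \<in> poly_functions"
proof -
  have "(\<lambda>v. p v + (- 1) * q v) \<in> poly_functions"
    by (intro poly_functions.add poly_functions.mult poly_functions.const assms)
  then show ?thesis by simp
qed

lemma poly_functions_sum:
  "finite A \<Longrightarrow> (\<And>i. i \<in> A \<Longrightarrow> f i \<in> poly_functions) \<Longrightarrow> (\<lambda>v. \<Sum>i\<in>A. f i v) \<in> poly_functions"
  by (induction A rule: finite_induct) (auto intro: poly_functions.add poly_functions.const)

text \<open>
  Families are used instead of sets, because vectors that depend on parameters may coincide for
  some values.
\<close>

definition indep_family :: "'j set \<Rightarrow> ('j \<Rightarrow> 'k::field poly poly) \<Rightarrow> bool" where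
  "indep_family J u \<longleftrightarrow> (\<forall>c. (\<Sum>j\<in>J. smult [:c j:] (u j)) = 0 \<longrightarrow> (\<forall>j\<in>J. c j = 0))"

lemma indep_familyD:
  "indep_family J u \<Longrightarrow> (\<Sum>j\<in>J. smult [:c j:] (u j)) = 0 \<Longrightarrow> j \<in> J \<Longrightarrow> c j = 0"
  unfolding indep_family_def by blast

lemma indep_family_imp_independent:
  assumes "finite J" "indep_family J (u :: 'j \<Rightarrow> 'k::field poly poly)"
  shows "inj_on u J" "kvs.independent (u ` J)"
proof -
  show inj: "inj_on u J"
  proof (rule inj_onI, rule ccontr)
    fix i j assume ij: "i \<in> J" "j \<in> J" "u i = u j" "i \<noteq> j"
    let ?c = "\<lambda>k. (if k = i then 1 else 0) - (if k = j then 1 else (0 :: 'k))"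
    have split: "smult [:?c k:] (u k) = (if k = i then u i else 0) - (if k = j then u j else 0)" for k
      by (simp add: smult_diff_left one_pCons[symmetric])
    have "(\<Sum>k\<in>J. smult [:?c k:] (u k)) = 0"
      unfolding split sum_subtractf using assms(1) ij by simp
    from indep_familyD[OF assms(2) this ij(1)] show False using ij(4) by simp
  qed
  show "kvs.independent (u ` J)"
  proof (rule kvs.independent_if_scalars_zero)
    fix f x assume z: "(\<Sum>x\<in>u ` J. smult [:f x:] x) = 0" and x: "x \<in> u ` J"
    have "(\<Sum>j\<in>J. smult [:f (u j):] (u j)) = 0" using z by (simp add: sum.reindex[OF inj])
    then show "f x = 0" using indep_familyD[OF assms(2), of "\<lambda>j. f (u j)"] x by blast
  qed (use assms(1) in simp)
qed

lemma card_indep_family_le_dim: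
  assumes "finite J" "indep_family J u" "u ` J \<subseteq> W" "W \<subseteq> kvs.span B" "finite B"
  shows "card J \<le> kvs.dim (W :: 'k::field poly poly set)"
  using kvs.independent_card_le_dim_finite[OF indep_family_imp_independent(2)[OF assms(1,2)] assms(3-5)]
    card_image[OF indep_family_imp_independent(1)[OF assms(1,2)]] by simp

lemma indep_subfamily_exists:
  fixes u :: "'j \<Rightarrow> 'k::field poly poly"
  assumes "finite J"
  obtains J' where "J' \<subseteq> J" "indep_family J' u" "card J' = kvs.dim (u ` J)"
proof -
  obtain B where B: "B \<subseteq> u ` J" "kvs.independent B" "u ` J \<subseteq> kvs.span B" "card B = kvs.dim (u ` J)"
    by (rule kvs.basis_exists)
  obtain J' where J': "J' \<subseteq> J" "inj_on u J'" "B = u ` J'" using B(1) by (auto simp: subset_image_inj)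
  have fin: "finite J'" using J'(1) assms finite_subset by blast
  have "indep_family J' u"
    unfolding indep_family_def
  proof (intro allI impI ballI)
    fix c j assume z: "(\<Sum>j\<in>J'. smult [:c j:] (u j)) = 0" and j: "j \<in> J'"
    let ?f = "\<lambda>x. c (the_inv_into J' u x)"
    have "(\<Sum>x\<in>B. smult [:?f x:] x) = (\<Sum>j\<in>J'. smult [:c j:] (u j))"
      unfolding J'(3) sum.reindex[OF J'(2)] by (intro sum.cong) (auto simp: the_inv_into_f_f[OF J'(2)])
    then have "?f (u j) = 0"
      using kvs.independentD[OF B(2), of B ?f "u j"] fin J'(3) j z by auto
    then show "c j = 0" using the_inv_into_f_f[OF J'(2) j] by simp
  qed
  moreover have "card J' = kvs.dim (u ` J)" using B(4) J'(3) card_image[OF J'(2)] by simp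
  ultimately show thesis using that J'(1) by blast
qed

text \<open>
  Gaussian elimination without division: if the coefficient \<open>a i\<close> of
  \<open>u i\<close> at some monomial is nonzero at \<open>v0\<close>, then the vectors
  \<open>a i * u j - a j * u i\<close> for the other indices are again independent at
  \<open>v0\<close>, and wherever they are independent and \<open>a i\<close> is nonzero, so is
  the original family.
\<close>

lemma indep_family_open:
  fixes u :: "'j \<Rightarrow> ('v \<Rightarrow> 'k::field) \<Rightarrow> 'k poly poly"
  assumes "finite J" "\<And>j m. j \<in> J \<Longrightarrow> (\<lambda>v. bicoeff (u j v) m) \<in> poly_functions"
    and "indep_family J (\<lambda>j. u j v0)"
  shows "\<exists>p\<in>poly_functions. p v0 \<noteq> 0 \<and> (\<forall>v. p v \<noteq> 0 \<longrightarrow> indep_family J (\<lambda>j. u j v))"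
  using assms
proof (induction J arbitrary: u rule: finite_induct)
  case empty
  show ?case by (intro bexI[of _ "\<lambda>_. 1"] poly_functions.const) (auto simp: indep_family_def)
next
  case (insert i J)
  have "u i v0 \<noteq> 0"
  proof
    assume "u i v0 = 0"
    then have "(\<Sum>j\<in>insert i J. smult [:if j = i then 1 else 0:] (u j v0)) = 0"
      by (intro sum.neutral) auto
    from indep_familyD[OF insert.prems(2) this, of i] show False by simp
  qed
  then obtain m where m: "bicoeff (u i v0) m \<noteq> 0" using bipoly_eqI[of "u i v0" 0] by auto
  define a where "a = (\<lambda>j v. bicoeff (u j v) m)"
  define w where "w = (\<lambda>j v. smult [:a i v:] (u j v) - smult [:a j v:] (u i v))"
  have comb: "(\<Sum>j\<in>J. smult [:c j:] (w j v))
      = smult [:a i v:] (\<Sum>j\<in>J. smult [:c j:] (u j v)) - smult [:\<Sum>j\<in>J. c j * a j v:] (u i v)" for c v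
  proof (rule bipoly_eqI)
    fix m'
    show "bicoeff (\<Sum>j\<in>J. smult [:c j:] (w j v)) m' = bicoeff (smult [:a i v:]
       (\<Sum>j\<in>J. smult [:c j:] (u j v)) - smult [:\<Sum>j\<in>J. c j * a j v:] (u i v)) m'"
      unfolding w_def bicoeff_diff bicoeff_smult bicoeff_sum sum_distrib_left sum_distrib_right
        sum_subtractf[symmetric]
      by (intro sum.cong refl) (simp add: algebra_simps)
  qed
  have "\<exists>p\<in>poly_functions. p v0 \<noteq> 0 \<and> (\<forall>v. p v \<noteq> 0 \<longrightarrow> indep_family J (\<lambda>j. w j v))"
  proof (rule insert.IH)
    fix j m' assume "j \<in> J"
    then show "(\<lambda>v. bicoeff (w j v) m') \<in> poly_functions"
      unfolding w_def bicoeff_diff bicoeff_smult a_def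
      by (intro poly_functions_diff poly_functions.mult insert.prems(1)) auto
  next
    show "indep_family J (\<lambda>j. w j v0)"
      unfolding indep_family_def
    proof (intro allI impI ballI)
      fix c j assume z: "(\<Sum>j\<in>J. smult [:c j:] (w j v0)) = 0" and j: "j \<in> J"
      \<comment> \<open>A relation among the eliminated vectors, written as one among the original vectors.\<close>
      let ?c = "\<lambda>j. if j = i then - (\<Sum>j\<in>J. c j * a j v0) else a i v0 * c j"
      have "(\<Sum>j\<in>insert i J. smult [:?c j:] (u j v0))
          = smult [:- (\<Sum>j\<in>J. c j * a j v0):] (u i v0) + (\<Sum>j\<in>J. smult [:a i v0 * c j:] (u j v0))"
      proof -
        have "(\<Sum>j\<in>J. smult [:?c j:] (u j v0)) = (\<Sum>j\<in>J. smult [:a i v0 * c j:] (u j v0))"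
          using insert.hyps(2) by (intro sum.cong) auto
        then show ?thesis using insert.hyps by (simp del: minus_pCons)
      qed
      also have "\<dots> = (\<Sum>j\<in>J. smult [:c j:] (w j v0))"
        unfolding comb
        by (rule bipoly_eqI) (simp add: sum_distrib_left algebra_simps del: minus_pCons smult_minus_left)
      finally have "(\<Sum>j\<in>insert i J. smult [:?c j:] (u j v0)) = 0" using z by simp
      from indep_familyD[OF insert.prems(2) this, of j] have "?c j = 0" using j by blast
      then show "c j = 0" using j insert.hyps(2) m by (auto simp: a_def split: if_splits)
    qed
  qed
  then obtain p where p: "p \<in> poly_functions" "p v0 \<noteq> 0"
    "\<And>v. p v \<noteq> 0 \<Longrightarrow> indep_family J (\<lambda>j. w j v)" by blast
  show ?case
  proof (intro bexI[of _ "\<lambda>v. a i v * p v"] conjI allI impI)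
    show "(\<lambda>v. a i v * p v) \<in> poly_functions"
      unfolding a_def by (intro poly_functions.mult insert.prems(1) p(1)) simp
    show "a i v0 * p v0 \<noteq> 0" using m p(2) by (simp add: a_def)
    fix v assume "a i v * p v \<noteq> 0"
    then have ai: "a i v \<noteq> 0" and ind: "indep_family J (\<lambda>j. w j v)" using p(3) by auto
    show "indep_family (insert i J) (\<lambda>j. u j v)"
      unfolding indep_family_def
    proof (intro allI impI)
      fix c assume "(\<Sum>j\<in>insert i J. smult [:c j:] (u j v)) = 0"
      then have z: "smult [:c i:] (u i v) + (\<Sum>j\<in>J. smult [:c j:] (u j v)) = 0"
        using insert.hyps by simp
      have "bicoeff (smult [:c i:] (u i v) + (\<Sum>j\<in>J. smult [:c j:] (u j v))) m = 0"
        unfolding z by simp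
      then have s: "(\<Sum>j\<in>J. c j * a j v) = - (c i * a i v)"
        unfolding a_def by (simp add: eq_neg_iff_add_eq_0 add.commute)
      have "(\<Sum>j\<in>J. smult [:c j:] (u j v)) = - smult [:c i:] (u i v)"
        using z by (simp add: eq_neg_iff_add_eq_0 add.commute)
      then have "(\<Sum>j\<in>J. smult [:c j:] (w j v)) = 0"
        unfolding comb s by (intro bipoly_eqI) (simp del: minus_pCons smult_minus_left)
      then have cJ: "c j = 0" if "j \<in> J" for j using indep_familyD[OF ind] that by blast
      then have "c i * a i v = 0" using s by (simp add: sum.neutral)
      then show "\<forall>j\<in>insert i J. c j = 0" using cJ ai by auto
    qed
  qed
qed

definition products :: "('b \<Rightarrow> 'k::field poly poly) \<Rightarrow> 'b \<times> bool \<Rightarrow> 'k poly poly" where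
  "products z = (\<lambda>(b, i). (if i then varx else vary) * z b)"

lemma R1_span_span: "R1_span (kvs.span F) = R1_span F"
proof
  have "y * f \<in> R1_span F" if y: "y = varx \<or> y = vary" and f: "f \<in> kvs.span F" for y f
  proof -
    have "kvs.subspace {f. y * f \<in> R1_span F}"
      using subspace_R1_span[of F]
      by (intro kvs.subspaceI)
        (simp_all add: kvs.subspace_0 kvs.subspace_add kvs.subspace_scale distrib_left mult_smult_right)
    moreover have "F \<subseteq> {f. y * f \<in> R1_span F}"
      using y unfolding R1_span_def by (auto intro: kvs.span_base)
    ultimately show ?thesis using f kvs.span_minimal by blast
  qed
  then show "R1_span (kvs.span F) \<subseteq> R1_span F"
    unfolding R1_span_def[of "kvs.span F"] by (intro kvs.span_minimal subspace_R1_span) blast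
  show "R1_span F \<subseteq> R1_span (kvs.span F)"
    unfolding R1_span_def by (intro kvs.span_mono Un_mono image_mono kvs.span_superset)
qed

lemma R1_span_image: "R1_span (z ` S) = kvs.span (products z ` (S \<times> UNIV))"
proof -
  have "products z ` (S \<times> UNIV) = (*) varx ` z ` S \<union> (*) vary ` z ` S"
  proof
    have "products z (b, i) \<in> (*) varx ` z ` S \<union> (*) vary ` z ` S" if "b \<in> S" for b i
    proof -
      have "varx * z b \<in> (*) varx ` z ` S" "vary * z b \<in> (*) vary ` z ` S"
        using that by (intro imageI; assumption)+
      then show ?thesis unfolding products_def by (cases i) (simp_all only: prod.case if_True if_False Un_iff simp_thms)
    qed
    then show "products z ` (S \<times> UNIV) \<subseteq> (*) varx ` z ` S \<union> (*) vary ` z ` S" by blast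
    have "varx * z b \<in> products z ` (S \<times> UNIV)" "vary * z b \<in> products z ` (S \<times> UNIV)" if "b \<in> S" for b
    proof -
      have "products z (b, True) \<in> products z ` (S \<times> UNIV)" "products z (b, False) \<in> products z ` (S \<times> UNIV)"
        using that by blast+
      then show "varx * z b \<in> products z ` (S \<times> UNIV)" "vary * z b \<in> products z ` (S \<times> UNIV)"
        unfolding products_def prod.case if_True if_False by this
    qed
    then show "(*) varx ` z ` S \<union> (*) vary ` z ` S \<subseteq> products z ` (S \<times> UNIV)" by blast
  qed
  then show ?thesis by (simp only: R1_span_def)
qed

text \<open>
  Select products of \<open>x\<close> and \<open>y\<close> with the spanning vectors that form a
  basis of $R_1 V$ at \<open>v0\<close>: they remain independent on a basic open neighbourhood.
\<close>

lemma R1_rank_lower_semicontinuous: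
  fixes z :: "'b \<Rightarrow> ('v \<Rightarrow> 'k::field) \<Rightarrow> 'k poly poly"
  assumes "finite S" "\<And>b m. b \<in> S \<Longrightarrow> (\<lambda>v. bicoeff (z b v) m) \<in> poly_functions"
    and "\<And>b v. b \<in> S \<Longrightarrow> z b v \<in> forms d"
  shows "\<exists>p\<in>poly_functions. p v0 \<noteq> 0 \<and> (\<forall>v. p v \<noteq> 0 \<longrightarrow>
    R1_dim (kvs.span ((\<lambda>b. z b v0) ` S)) \<le> R1_dim (kvs.span ((\<lambda>b. z b v) ` S)))"
proof -
  let ?u = "\<lambda>v. products (\<lambda>b. z b v)"
  obtain J where J: "J \<subseteq> S \<times> UNIV" "indep_family J (?u v0)" "card J = kvs.dim (?u v0 ` (S \<times> UNIV))"
    using indep_subfamily_exists[of "S \<times> UNIV" "?u v0"] assms(1) by auto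
  have fin: "finite J" using J(1) assms(1) by (meson finite_SigmaI finite_UNIV finite_subset)
  have poly: "(\<lambda>v. bicoeff (?u v j) m) \<in> poly_functions" if "j \<in> J" for j m
  proof -
    have "j \<in> S \<times> UNIV" using that J(1) by blast
    then obtain b i where j: "j = (b, i)" "b \<in> S" by (elim SigmaE)
    obtain m1 m2 where m: "m = (m1, m2)" by (cases m)
    show ?thesis
      unfolding j m products_def
      using assms(2)[OF j(2)] poly_functions.const[of 0]
      by (cases i; cases m1; cases m2) (simp_all add: bicoeff_bimonom_mult)
  qed
  obtain p where p: "p \<in> poly_functions" "p v0 \<noteq> 0" "\<And>v. p v \<noteq> 0 \<Longrightarrow> indep_family J (?u v)"
    using indep_family_open[of J "\<lambda>j v. ?u v j" v0] fin poly J(2) by blast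
  have "R1_dim (kvs.span ((\<lambda>b. z b v0) ` S)) \<le> R1_dim (kvs.span ((\<lambda>b. z b v) ` S))"
    if "p v \<noteq> 0" for v
  proof -
    have "R1_dim (kvs.span ((\<lambda>b. z b v0) ` S)) = card J"
      using J(3) by (simp add: R1_span_span R1_span_image)
    also have "\<dots> \<le> R1_dim (kvs.span ((\<lambda>b. z b v) ` S))"
    proof (rule card_indep_family_le_dim[OF fin p(3)[OF that]])
      show "?u v ` J \<subseteq> R1_span (kvs.span ((\<lambda>b. z b v) ` S))"
        unfolding R1_span_span R1_span_image using J(1) kvs.span_superset[of "?u v ` (S \<times> UNIV)"] by blast
      have "kvs.span ((\<lambda>b. z b v) ` S) \<subseteq> forms d"
        using assms(3) by (intro kvs.span_minimal subspace_forms) blast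
      then show "R1_span (kvs.span ((\<lambda>b. z b v) ` S)) \<subseteq> kvs.span (bimonom ` dmon (Suc d) ` {..Suc d})"
        using R1_span_subset_forms forms_subset_span by blast
    qed simp
    finally show ?thesis .
  qed
  then show ?thesis using p(1,2) by blast
qed

text \<open>
  Two dense open sets meet, so at most one value is taken on all of a dense open set.
\<close>

lemma generic_num_gensI:
  assumes "openin X U" "U \<noteq> {}" "\<And>W. openin X W \<Longrightarrow> W \<noteq> {} \<Longrightarrow> U \<inter> W \<noteq> {}"
    and "\<And>I. I \<in> U \<Longrightarrow> num_gens I = k"
  shows "generic_num_gens X = k"
  unfolding generic_num_gens_def
proof (rule the_equality)
  show "\<exists>U. openin X U \<and> U \<noteq> {} \<and> X closure_of U = topspace X \<and> (\<forall>I\<in>U. num_gens I = k)"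
    using assms unfolding dense_intersects_open by blast
  fix k' assume "\<exists>U. openin X U \<and> U \<noteq> {} \<and> X closure_of U = topspace X \<and> (\<forall>I\<in>U. num_gens I = k')"
  then obtain W where W: "openin X W" "W \<noteq> {}" "\<forall>I\<in>W. num_gens I = k'" by blast
  then obtain I where "I \<in> U" "I \<in> W" using assms(3) by blast
  then show "k' = k" using assms(4) W(3) by auto
qed

lemma num_gens_chart_space:
  assumes "S \<subseteq> {..d}"
  shows "num_gens (top_ideal d (chart_space d S v)) + R1_dim (chart_space d S v) = card S + (d + 2)"
  using num_gens_top_ideal[OF subspace_chart_space chart_space_subset_forms[OF assms], of v]
    dim_complementary[OF subspace_chart_space chart_space_subset_forms[OF assms]
      complementary_chart_space[OF assms] assms, of v] by simp

lemma coords_image_eq: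
  assumes "S \<subseteq> {..d}" "Q \<subseteq> chart_coords d S"
  shows "coords (basis_exps d S) ` (\<lambda>v. top_ideal d (chart_space d S v)) ` Q = (Q :: (_ \<Rightarrow> 'k::field) set)"
proof -
  have "coords (basis_exps d S) (top_ideal d (chart_space d S v)) = v" if "v \<in> Q" for v
    using coords_chart_space[OF assms(1)] assms(2) that by blast
  then show ?thesis by (simp add: image_image)
qed

text \<open>
  The coordinate set \<open>Q\<close> is arbitrary so that the statement serves cells and charts
  alike.
\<close>

lemma openin_few_generators:
  fixes Q :: "((nat \<times> nat) \<times> (nat \<times> nat) \<Rightarrow> 'k::field) set"
  assumes S: "S \<subseteq> {..d}" and Q: "Q \<subseteq> chart_coords d S"
  defines "X \<equiv> (\<lambda>v. top_ideal d (chart_space d S v)) ` Q"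
  shows "openin (pullback_topology X (coords (basis_exps d S)) zariski) {I \<in> X. num_gens I \<le> k}"
proof (subst openin_subopen, intro ballI)
  fix I assume "I \<in> {I \<in> X. num_gens I \<le> k}"
  then obtain v0 where v0: "v0 \<in> Q" "I = top_ideal d (chart_space d S v0)" "num_gens I \<le> k"
    by (auto simp: X_def)
  have c: "coords (basis_exps d S) (top_ideal d (chart_space d S v)) = v" if "v \<in> Q" for v
    using coords_chart_space[OF S] Q that by blast
  have fin: "finite S" using S finite_subset by blast
  have poly: "(\<lambda>v. bicoeff (chart_form d S v b) m) \<in> poly_functions" for b m
    unfolding chart_form_def bicoeff_diff bicoeff_sum bicoeff_smult
    by (intro poly_functions_diff poly_functions_sum poly_functions.mult poly_functions.const poly_functions.coord)
      simp
  have forms: "chart_form d S v b \<in> forms d" if "b \<in> S" for b v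
    using chart_form_in_forms S that by blast
  have "\<exists>p\<in>poly_functions. p v0 \<noteq> 0 \<and> (\<forall>v. p v \<noteq> 0 \<longrightarrow>
      R1_dim (chart_space d S v0) \<le> R1_dim (chart_space d S v))"
    unfolding chart_space_def
    by (rule R1_rank_lower_semicontinuous[where z = "\<lambda>b v. chart_form d S v b", OF fin poly forms])
  then obtain p where p: "p \<in> poly_functions" "p v0 \<noteq> 0"
    "\<And>v. p v \<noteq> 0 \<Longrightarrow> R1_dim (chart_space d S v0) \<le> R1_dim (chart_space d S v)"
    by (elim bexE conjE) blast
  let ?W = "coords (basis_exps d S) -` {v. p v \<noteq> 0} \<inter> X"
  have "openin (pullback_topology X (coords (basis_exps d S)) zariski) ?W"
    unfolding openin_pullback_topology using openin_zariski_basic[OF p(1)] by blast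
  moreover have "I \<in> ?W" using v0(1,2) c p(2) by (auto simp: X_def)
  moreover have "?W \<subseteq> {I \<in> X. num_gens I \<le> k}"
  proof
    fix I' assume "I' \<in> ?W"
    then obtain v where v: "v \<in> Q" "I' = top_ideal d (chart_space d S v)" "p v \<noteq> 0"
      using c by (auto simp: X_def)
    then have "num_gens I' \<le> num_gens I"
      using p(3)[OF v(3)] num_gens_chart_space[OF S, of v] num_gens_chart_space[OF S, of v0] v0(2) by simp
    then show "I' \<in> {I \<in> X. num_gens I \<le> k}" using v v0(3) by (auto simp: X_def)
  qed
  ultimately show "\<exists>T. openin (pullback_topology X (coords (basis_exps d S)) zariski) T \<and> I \<in> T \<and>
      T \<subseteq> {I \<in> X. num_gens I \<le> k}" by blast
qed

lemma chart_coords_line: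
  assumes "v \<in> chart_coords d S" "w \<in> chart_coords d S"
  shows "line_point v w l \<in> chart_coords d S"
  unfolding chart_coords_def mem_Collect_eq line_point_def
proof (intro allI conjI impI)
  fix \<mu> \<nu>
  show "(1 - l) * v (\<mu>, \<nu>) + l * w (\<mu>, \<nu>) = (if \<mu> = \<nu> then 1 else 0)" if "\<mu> \<in> basis_exps d S"
    unfolding chart_coordsD(1)[OF assms(1) that] chart_coordsD(1)[OF assms(2) that] by simp
  show "(1 - l) * v (\<mu>, \<nu>) + l * w (\<mu>, \<nu>) = 0" if "d < fst \<mu> + snd \<mu>"
    unfolding chart_coordsD(2)[OF assms(1) that] chart_coordsD(2)[OF assms(2) that] by simp
  show "(1 - l) * v (\<mu>, \<nu>) + l * w (\<mu>, \<nu>) = 0"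
    if "\<mu> \<in> dmon d ` S \<and> \<nu> \<notin> dmon d ` ({..d} - S)"
    using chart_coordsD(3)[OF assms(1)] chart_coordsD(3)[OF assms(2)] that by simp
qed

lemma cell_coords_line:
  assumes "v \<in> cell_coords d S" "w \<in> cell_coords d S"
  shows "line_point v w l \<in> cell_coords d S"
  using assms chart_coords_line[of v d S w l] by (simp add: cell_coords_def line_point_def)

section \<open>The generic number of generators on a Jordan cell\<close>

text \<open>
  A walk that starts at 1 and is reflected at 0, with down-steps at the elements of
  \<open>S\<close>. Its position after \<open>n\<close> steps is the codimension of $R_1 V$ in
  the forms of degree $d + 1$ and $y$-degree at most \<open>n\<close>, for generic
  \<open>V\<close> spanned by forms of the $y$-degrees in $S \cap \{0, \ldots, n - 1\}$.
\<close>

primrec gap :: "nat set \<Rightarrow> nat \<Rightarrow> nat" where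
  "gap S 0 = 1"
| "gap S (Suc n) = (if n \<in> S then gap S n - 1 else gap S n + 1)"

lemma subset_span_if_subset_forms: "V \<subseteq> forms d \<Longrightarrow> V \<subseteq> kvs.span (bimonom ` dmon d ` {..d})"
  using forms_subset_span by blast

lemma R1_span_insert:
  "R1_span (insert f F) = kvs.span (insert (varx * f) (insert (vary * f) (R1_span F)))"
proof -
  have "R1_span (insert f F) = kvs.span ({varx * f, vary * f} \<union> ((*) varx ` F \<union> (*) vary ` F))"
    unfolding R1_span_def by (rule arg_cong[of _ _ kvs.span]) blast
  also have "\<dots> = kvs.span ({varx * f, vary * f} \<union> kvs.span ((*) varx ` F \<union> (*) vary ` F))"
    unfolding kvs.span_Un[of "{varx * f, vary * f}"] kvs.span_span by (rule refl)
  finally show ?thesis unfolding R1_span_def by simp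
qed

lemma R1_span_mono: "F \<subseteq> G \<Longrightarrow> R1_span F \<subseteq> R1_span G"
  unfolding R1_span_def by (intro kvs.span_mono Un_mono image_mono)

lemma shift_supported:
  assumes "f \<in> supported (dmon d ` A)" "A \<subseteq> {..d}"
  shows "varx * f \<in> supported (dmon (Suc d) ` A)" "vary * f \<in> supported (dmon (Suc d) ` Suc ` A)"
proof -
  have "(a, b) \<in> dmon (Suc d) ` A" if nz: "bicoeff (varx * f) (a, b) \<noteq> 0" for a b
  proof -
    have *: "1 \<le> a" "bicoeff f (a - 1, b) \<noteq> 0"
      using nz by (auto simp: bicoeff_bimonom_mult split: if_splits)
    then have "(a - 1, b) \<in> dmon d ` A" using supportedD[OF assms(1)] by blast
    then show ?thesis using *(1) assms(2) by (auto simp: dmon_def image_iff)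
  qed
  then show "varx * f \<in> supported (dmon (Suc d) ` A)" by (rule supportedI)
  have "(a, b) \<in> dmon (Suc d) ` Suc ` A" if nz: "bicoeff (vary * f) (a, b) \<noteq> 0" for a b
  proof -
    have *: "1 \<le> b" "bicoeff f (a, b - 1) \<noteq> 0"
      using nz by (auto simp: bicoeff_bimonom_mult split: if_splits)
    then have "(a, b - 1) \<in> dmon d ` A" using supportedD[OF assms(1)] by blast
    then have "b - 1 \<in> A" "a = d - (b - 1)" by (auto simp: dmon_def)
    then show ?thesis using *(1)
      by (intro image_eqI[of _ _ b] image_eqI[of _ _ "b - 1"]) (auto simp: dmon_def)
  qed
  then show "vary * f \<in> supported (dmon (Suc d) ` Suc ` A)" by (rule supportedI)
qed

lemma R1_span_truncated:
  assumes "F \<subseteq> supported (dmon d ` {..<n})" "n \<le> Suc d"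
  shows "R1_span F \<subseteq> (supported (dmon (Suc d) ` {..n}) :: 'k::field poly poly set)"
  unfolding R1_span_def
proof (intro kvs.span_minimal subspace_supported)
  have "varx * f \<in> supported (dmon (Suc d) ` {..n}) \<and> vary * f \<in> supported (dmon (Suc d) ` {..n})"
    if "f \<in> F" for f :: "'k poly poly"
  proof -
    have f: "f \<in> supported (dmon d ` {..<n})" using that assms(1) by blast
    have sub: "{..<n} \<subseteq> {..d}" using assms(2) by auto
    have "dmon (Suc d) ` {..<n} \<subseteq> dmon (Suc d) ` {..n}" "dmon (Suc d) ` Suc ` {..<n} \<subseteq> dmon (Suc d) ` {..n}"
      by (intro image_mono; auto)+
    note mono = this[THEN supported_mono, THEN subsetD]
    show ?thesis using mono(1)[OF shift_supported(1)[OF f sub]] mono(2)[OF shift_supported(2)[OF f sub]] by blast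
  qed
  then show "(*) varx ` F \<union> (*) vary ` F \<subseteq> supported (dmon (Suc d) ` {..n})" by blast
qed

lemma dim_supported_dmon: "finite A \<Longrightarrow> kvs.dim (supported (dmon d ` A) :: 'k::field poly poly set) = card A"
  by (simp add: dim_supported card_image inj_on_def)

lemma supported_subset_span: "supported (dmon d ` {..n}) \<subseteq> kvs.span (bimonom ` dmon d ` {..n})"
  by (simp add: span_bimonom)

text \<open>
  Filter \<open>V\<close> by $y$-degree. Passing from $y$-degree below \<open>n\<close> to at
  most \<open>n\<close> enlarges the subspace only if \<open>n\<close> is a leading degree, and
  then by one form \<open>g\<close>, which adds at most $xg$ and $yg$ to the products; on the
  other hand all products have $y$-degree at most $n + 1$.
\<close>

lemma R1_dim_le_gap:
  fixes V :: "'k::field poly poly set"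
  assumes V: "kvs.subspace V" "V \<subseteq> forms d" and n: "n \<le> Suc d"
  shows "R1_dim (V \<inter> supported (dmon d ` {..<n})) + gap (lead_degs V) n \<le> n + 1"
  using n
proof (induction n)
  case 0
  have "f = 0" if "f \<in> supported (dmon d ` {..<0})" for f :: "'k poly poly"
  proof (rule bipoly_eqI)
    fix m show "bicoeff f m = bicoeff 0 m" using supportedD[OF that, of m] by simp
  qed
  then have "V \<inter> supported (dmon d ` {..<0}) \<subseteq> {0}" by blast
  then have "R1_span (V \<inter> supported (dmon d ` {..<0})) \<subseteq> R1_span {0}" by (rule R1_span_mono)
  also have "R1_span {0} = kvs.span ({} :: 'k poly poly set)" unfolding R1_span_def by simp
  finally have "R1_dim (V \<inter> supported (dmon d ` {..<0})) \<le> card ({} :: 'k poly poly set)"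
    by (intro kvs.dim_le_card) auto
  then show ?case by simp
next
  case (Suc n)
  let ?V = "\<lambda>n. V \<inter> supported (dmon d ` {..<n})"
  have nd: "n \<le> d" using Suc.prems by simp
  have IH: "R1_dim (?V n) + gap (lead_degs V) n \<le> n + 1" using Suc by simp
  have drop: "f \<in> ?V n" if f: "f \<in> ?V (Suc n)" "bicoeff f (dmon d n) = 0" for f
    using f supported_drop_top by blast
  have lead: "f \<noteq> 0 \<and> degree f = n" if f: "f \<in> ?V (Suc n)" "bicoeff f (dmon d n) \<noteq> 0" for f
  proof -
    have "bicoeff f (dmon d b) = 0" if "n < b" for b
      using f(1) that by (intro supportedD[of f "dmon d ` {..<Suc n}"]) auto
    then show ?thesis using form_degree_eqI[of f d n] f V(2) by blast
  qed
  show ?case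
  proof (cases "n \<in> lead_degs V")
    case False
    have "?V (Suc n) \<subseteq> ?V n"
    proof
      fix f assume f: "f \<in> ?V (Suc n)"
      show "f \<in> ?V n"
      proof (rule drop[OF f], rule ccontr)
        assume "bicoeff f (dmon d n) \<noteq> 0"
        then show False using lead[OF f] f False unfolding lead_degs_def by blast
      qed
    qed
    then have "R1_span (?V (Suc n)) \<subseteq> R1_span (?V n)" by (rule R1_span_mono)
    then have "R1_dim (?V (Suc n)) \<le> R1_dim (?V n)"
      using kvs.span_superset subset_span_if_subset_forms[OF R1_span_subset_forms[of "?V n" d]] V(2)
      by (intro kvs.dim_mono_finite[of _ _ "bimonom ` dmon (Suc d) ` {..Suc d}"]) blast+
    then show ?thesis using IH False by simp
  next
    case True
    then obtain g where g: "g \<in> V" "g \<noteq> 0" "degree g = n" by (auto simp: lead_degs_def)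
    have gf: "g \<in> forms d" using g(1) V(2) by blast
    have gd: "bicoeff g (dmon d n) \<noteq> 0" using form_degree(2)[OF gf g(2)] g(3) by simp
    have gsup: "g \<in> supported (dmon d ` {..<Suc n})"
      using form_in_supported_degree[OF gf g(2)] g(3) by (simp add: lessThan_Suc_atMost)
    have "?V (Suc n) \<subseteq> kvs.span (insert g (?V n))"
    proof
      fix f assume f: "f \<in> ?V (Suc n)"
      let ?a = "bicoeff f (dmon d n) / bicoeff g (dmon d n)"
      have "f - smult [:?a:] g \<in> ?V (Suc n)"
        using f g(1) gsup V(1) by (simp add: kvs.subspace_diff kvs.subspace_scale subspace_supported)
      then have "f - smult [:?a:] g \<in> ?V n" using gd by (intro drop) simp_all
      then show "f \<in> kvs.span (insert g (?V n))"
        unfolding kvs.span_insert using kvs.span_base by blast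
    qed
    then have "R1_span (?V (Suc n)) \<subseteq> R1_span (insert g (?V n))"
      using R1_span_mono R1_span_span by metis
    then have sub: "R1_span (?V (Suc n)) \<subseteq> kvs.span (insert (varx * g) (insert (vary * g) (R1_span (?V n))))"
      by (simp only: R1_span_insert)
    let ?B = "bimonom ` dmon (Suc d) ` {..Suc d} :: 'k poly poly set"
    have R: "R1_span (?V n) \<subseteq> kvs.span ?B"
      using subset_span_if_subset_forms[OF R1_span_subset_forms[of "?V n" d]] V(2) by blast
    have "R1_span {g} \<subseteq> kvs.span ?B"
      using subset_span_if_subset_forms[OF R1_span_subset_forms[of "{g}" d]] g(1) V(2) by blast
    moreover have "varx * g \<in> R1_span {g}" "vary * g \<in> R1_span {g}"
      unfolding R1_span_def by (auto intro: kvs.span_base)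
    ultimately have xy: "varx * g \<in> kvs.span ?B" "vary * g \<in> kvs.span ?B" by blast+
    have "R1_dim (?V (Suc n)) \<le> kvs.dim (insert (varx * g) (insert (vary * g) (R1_span (?V n))))"
      using sub R xy by (intro kvs.dim_mono_finite[of _ _ ?B]) auto
    also have "\<dots> \<le> Suc (kvs.dim (insert (vary * g) (R1_span (?V n))))"
      using R xy by (intro kvs.dim_insert_le_finite[of _ ?B]) auto
    also have "\<dots> \<le> Suc (Suc (R1_dim (?V n)))"
      using R kvs.dim_insert_le_finite[of _ ?B] by simp
    finally have 1: "R1_dim (?V (Suc n)) \<le> R1_dim (?V n) + 2" by simp
    have "R1_dim (?V (Suc n)) \<le> kvs.dim (supported (dmon (Suc d) ` {..Suc n}) :: 'k poly poly set)"
      using R1_span_truncated[of "?V (Suc n)" d "Suc n"] Suc.prems supported_subset_span[of "Suc d" "Suc n", where 'a='k]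
        kvs.span_superset[of "supported (dmon (Suc d) ` {..Suc n}) :: 'k poly poly set"]
      by (intro kvs.dim_mono_finite[of _ _ "bimonom ` dmon (Suc d) ` {..Suc n}"]) blast+
    then have 2: "R1_dim (?V (Suc n)) \<le> n + 2" by (simp add: dim_supported_dmon)
    show ?thesis using IH True 1 2 by simp
  qed
qed

lemma R1_dim_le_gap_cell:
  fixes V :: "'k::field poly poly set"
  assumes "kvs.subspace V" "V \<subseteq> forms d"
  shows "R1_dim V + gap (lead_degs V) (Suc d) \<le> d + 2"
proof -
  have "V \<inter> supported (dmon d ` {..<Suc d}) = V"
    using assms(2) unfolding forms_eq_dmon lessThan_Suc_atMost by blast
  then show ?thesis using R1_dim_le_gap[OF assms, of "Suc d"] by simp
qed

lemma varx_dmon: "b \<le> d \<Longrightarrow> varx * bimonom (dmon d b) = bimonom (dmon (Suc d) b)"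
  by (simp add: dmon_def bimonom_mult Suc_diff_le)

text \<open>
  In the step with $n \in S$, either the products obtained so far already fill the forms of
  $y$-degree at most \<open>n\<close>, and every \<open>f\<close> of $y$-degree \<open>n\<close>
  contributes just $yf$; or they do not, and \<open>f\<close> can be chosen with $xf$ outside
  their span. In both cases $yf$ is new because of its $y$-degree.
\<close>

lemma greedy_family:
  assumes "S \<subseteq> {..d}" "n \<le> Suc d"
  shows "\<exists>z. (\<forall>b\<in>S \<inter> {..<n}. z b \<in> supported (dmon d ` {..b}) \<and> bicoeff (z b) (dmon d b) \<noteq> 0) \<and>
    R1_dim (z ` (S \<inter> {..<n}) :: 'k::field poly poly set) + gap S n = n + 1"
  using assms(2)
proof (induction n)
  case 0
  have "R1_dim ({} :: 'k poly poly set) \<le> card ({} :: 'k poly poly set)"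
    by (intro kvs.dim_le_card) (auto simp: R1_span_def)
  then show ?case by simp
next
  case (Suc n)
  have nd: "n \<le> d" using Suc.prems by simp
  obtain z :: "nat \<Rightarrow> 'k poly poly" where z: "\<And>b. b \<in> S \<inter> {..<n} \<Longrightarrow>
      z b \<in> supported (dmon d ` {..b}) \<and> bicoeff (z b) (dmon d b) \<noteq> 0"
    "R1_dim (z ` (S \<inter> {..<n})) + gap S n = n + 1"
    using Suc by auto
  show ?case
  proof (cases "n \<in> S")
    case False
    then have "S \<inter> {..<Suc n} = S \<inter> {..<n}" by (auto simp: less_Suc_eq)
    then show ?thesis using z False by (intro exI[of _ z]) auto
  next
    case True
    define F where "F = z ` (S \<inter> {..<n})"
    let ?W = "R1_span F"
    let ?L = "supported (dmon (Suc d) ` {..n}) :: 'k poly poly set"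
    let ?B = "bimonom ` dmon (Suc d) ` {..n} :: 'k poly poly set"
    have "F \<subseteq> supported (dmon d ` {..<n})"
    proof
      fix f assume "f \<in> F"
      then obtain b where b: "b \<in> S \<inter> {..<n}" "f = z b" by (auto simp: F_def)
      have "dmon d ` {..b} \<subseteq> dmon d ` {..<n}" using b(1) by (intro image_mono) auto
      then show "f \<in> supported (dmon d ` {..<n})" using z(1)[OF b(1)] b(2) supported_mono by blast
    qed
    then have WL: "?W \<subseteq> ?L" using Suc.prems by (intro R1_span_truncated) auto
    have WB: "?W \<subseteq> kvs.span ?B" using WL supported_subset_span by blast
    have spanW: "kvs.span ?W = ?W" by (simp add: subspace_R1_span)
    have dimL: "kvs.dim ?L = n + 1" by (simp add: dim_supported_dmon)
    let ?m = "\<lambda>b. bimonom (dmon d b) :: 'k poly poly"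
    have top: "vary * f \<notin> kvs.span ?L" if f: "bicoeff f (dmon d n) \<noteq> 0" for f :: "'k poly poly"
    proof
      assume "vary * f \<in> kvs.span ?L"
      then have "vary * f \<in> ?L" using kvs.span_eq_iff subspace_supported by blast
      moreover have "dmon (Suc d) (Suc n) \<notin> dmon (Suc d) ` {..n}" by auto
      ultimately have "bicoeff (vary * f) (dmon (Suc d) (Suc n)) = 0" by (rule supportedD)
      then show False using f nd by (simp add: dmon_def bicoeff_bimonom_mult)
    qed
    obtain f where f: "f \<in> supported (dmon d ` {..n})" "bicoeff f (dmon d n) \<noteq> 0"
      "R1_dim (insert f F) + gap S (Suc n) = n + 2"
    proof (cases "?W = ?L")
      case eq: True
      let ?f = "?m n"
      have xf: "varx * ?f \<in> ?W" unfolding eq varx_dmon[OF nd] by simp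
      have "R1_span (insert ?f F) = kvs.span (insert (vary * ?f) ?W)"
        unfolding R1_span_insert using xf kvs.span_mono[of ?W "insert (vary * ?f) ?W"] kvs.span_base
        by (intro kvs.span_redundant) blast
      moreover have "vary * ?f \<notin> kvs.span ?W" unfolding eq by (rule top) simp
      ultimately have "R1_dim (insert ?f F) = Suc (kvs.dim ?W)"
        using kvs.dim_insert_notin_finite[OF WB] by simp
      moreover have "kvs.dim ?W = n + 1" using eq dimL by simp
      ultimately show thesis
        using that[of ?f] z(2) True by (simp add: F_def)
    next
      case ne: False
      have less: "kvs.dim ?W < n + 1"
      proof (rule ccontr)
        assume "\<not> kvs.dim ?W < n + 1"
        then have "?W = ?L"
          using dimL by (intro kvs.subspace_eq_of_dim_le[OF subspace_R1_span WL supported_subset_span]) auto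
        then show False using ne by blast
      qed
      have "\<exists>f. f \<in> supported (dmon d ` {..n}) \<and> bicoeff f (dmon d n) \<noteq> 0 \<and> varx * f \<notin> ?W"
      proof (cases "varx * ?m n \<in> ?W")
        case False
        then show ?thesis by (intro exI[of _ "?m n"]) simp
      next
        case True
        have "\<exists>b\<le>n. bimonom (dmon (Suc d) b) \<notin> ?W"
        proof (rule ccontr)
          assume "\<not> ?thesis"
          then have "kvs.span ?B \<subseteq> ?W" by (intro kvs.span_minimal subspace_R1_span) auto
          then show False using ne WL by (simp add: span_bimonom)
        qed
        then obtain b where b: "b \<le> n" "bimonom (dmon (Suc d) b) \<notin> ?W" by blast
        then have bn: "b \<noteq> n" using True varx_dmon[OF nd, where 'a='k] by auto
        \<comment> \<open>The product of \<open>x\<close> with the monomial of $y$-degree \<open>n\<close> is not new,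
          so a lower monomial with a new product is added.\<close>
        let ?f = "?m n + ?m b"
        have xb: "varx * ?m b \<notin> ?W" using b nd varx_dmon[of b d, where 'a='k] by simp
        have "varx * ?f \<notin> ?W"
        proof
          assume "varx * ?f \<in> ?W"
          then have "varx * ?f - varx * ?m n \<in> ?W" using True by (rule kvs.subspace_diff[OF subspace_R1_span])
          then show False using xb by (simp add: distrib_left)
        qed
        moreover have "?f \<in> supported (dmon d ` {..n})"
          using b(1) by (intro kvs.subspace_add[OF subspace_supported]) auto
        moreover have "bicoeff ?f (dmon d n) \<noteq> 0" using bn by simp
        ultimately show ?thesis by blast
      qed
      then obtain f where f: "f \<in> supported (dmon d ` {..n})" "bicoeff f (dmon d n) \<noteq> 0" "varx * f \<notin> ?W"
        by blast
      have "{..n} \<subseteq> {..d}" using nd by auto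
      then have xL: "varx * f \<in> ?L" using shift_supported(1)[OF f(1)] by blast
      have 1: "kvs.dim (insert (varx * f) ?W) = Suc (kvs.dim ?W)"
        by (rule kvs.dim_insert_notin_finite[OF WB]) (simp_all only: spanW f(3) finite_imageI finite_atMost not_False_eq_True)
      have "insert (varx * f) ?W \<subseteq> ?L" using xL WL by blast
      then have sub: "insert (varx * f) ?W \<subseteq> kvs.span ?B" "kvs.span (insert (varx * f) ?W) \<subseteq> kvs.span ?L"
        using supported_subset_span kvs.span_mono by blast+
      have "kvs.dim (insert (vary * f) (insert (varx * f) ?W)) = Suc (Suc (kvs.dim ?W))"
        using kvs.dim_insert_notin_finite[OF sub(1)] 1 top[OF f(2)] sub(2) by auto
      then have "R1_dim (insert f F) = kvs.dim ?W + 2"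
        by (simp add: R1_span_insert insert_commute)
      moreover have "kvs.dim ?W + gap S n = n + 1" using z(2) by (simp add: F_def)
      ultimately show thesis using that[OF f(1,2)] less True by simp
    qed
    let ?z = "z(n := f)"
    have "S \<inter> {..<Suc n} = insert n (S \<inter> {..<n})" using True by (auto simp: less_Suc_eq)
    moreover have "?z ` insert n (S \<inter> {..<n}) = insert f F" by (auto simp: F_def)
    ultimately show ?thesis
      using f z(1) by (intro exI[of _ ?z]) auto
  qed
qed

lemma cell_attains_gap:
  assumes S: "S \<subseteq> {..d}"
  obtains V :: "'k::field poly poly set" where "kvs.subspace V" "V \<subseteq> forms d" "lead_degs V = S"
    "R1_dim V + gap S (Suc d) = d + 2"
proof -
  have SS: "S \<inter> {..<Suc d} = S" using S by auto
  obtain z :: "nat \<Rightarrow> 'k poly poly" where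
    z: "\<And>b. b \<in> S \<Longrightarrow> z b \<in> supported (dmon d ` {..b}) \<and> bicoeff (z b) (dmon d b) \<noteq> 0"
      "R1_dim (z ` S) + gap S (Suc d) = Suc d + 1"
    using greedy_family[OF S, of "Suc d", where 'k='k] unfolding SS by blast
  define V where "V = kvs.span (z ` S)"
  have sub: "kvs.subspace V" by (simp add: V_def)
  have zf: "z b \<in> forms d" if "b \<in> S" for b
  proof -
    have "dmon d ` {..b} \<subseteq> dmon d ` {..d}" using S that by (intro image_mono) auto
    then show ?thesis using z(1)[OF that] supported_mono unfolding forms_eq_dmon by blast
  qed
  have Vf: "V \<subseteq> forms d" unfolding V_def using zf by (intro kvs.span_minimal subspace_forms) blast
  have "S \<subseteq> lead_degs V"
  proof
    fix b assume b: "b \<in> S"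
    have "bicoeff (z b) (dmon d b') = 0" if "b < b'" for b'
      using z(1)[OF b] that by (intro supportedD[of "z b" "dmon d ` {..b}"]) auto
    then have "z b \<noteq> 0 \<and> degree (z b) = b" using form_degree_eqI[OF zf[OF b], of b] z(1)[OF b] by blast
    moreover have "z b \<in> V" unfolding V_def using b by (intro kvs.span_base) blast
    ultimately show "b \<in> lead_degs V" unfolding lead_degs_def by force
  qed
  moreover have "card (lead_degs V) \<le> card S"
  proof -
    have fin: "finite S" using S finite_subset by blast
    have "card (lead_degs V) = kvs.dim V" using dim_eq_card_lead_degs[OF sub Vf] by simp
    also have "\<dots> \<le> card (z ` S)" unfolding V_def using fin by (intro kvs.dim_le_card) auto
    also have "\<dots> \<le> card S" using fin by (rule card_image_le)
    finally show ?thesis .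
  qed
  moreover have "finite (lead_degs V)" using lead_degs_subset[OF Vf] finite_subset by blast
  ultimately have "lead_degs V = S" using card_seteq by metis
  moreover have "R1_dim V + gap S (Suc d) = d + 2" using z(2) by (simp add: V_def R1_span_span)
  ultimately show thesis using that sub Vf by blast
qed

lemma kappa_eq_card_plus_gap:
  assumes inf: "infinite (UNIV :: 'k::field set)"
    and P: "is_partition P" "C_exps P = basis_exps d S" and S: "S \<subseteq> {..d}"
  shows "kappa TYPE('k) P = card S + gap S (Suc d)"
  unfolding kappa_def
proof (rule generic_num_gensI)
  let ?X = "jordan_cell P :: 'k poly poly set set"
  let ?k = "card S + gap S (Suc d)"
  let ?U = "{I \<in> ?X. num_gens I \<le> ?k}"
  have X: "?X = (\<lambda>v. top_ideal d (chart_space d S v)) ` cell_coords d S" by (rule jordan_cell_eq_image[OF P S])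
  have sub: "(cell_coords d S :: (_ \<Rightarrow> 'k) set) \<subseteq> chart_coords d S" by (auto simp: cell_coords_def)
  show U: "openin (cell_topology P) ?U"
    unfolding cell_topology_def X P(2) using openin_few_generators[OF S sub] by simp
  obtain V :: "'k poly poly set" where V: "kvs.subspace V" "V \<subseteq> forms d" "lead_degs V = S"
    "R1_dim V + gap S (Suc d) = d + 2" by (rule cell_attains_gap[OF S])
  have "num_gens (top_ideal d V) + R1_dim V = card S + (d + 2)"
    using num_gens_top_ideal[OF V(1,2)] dim_eq_card_lead_degs[OF V(1,2)] V(3) by simp
  then have "num_gens (top_ideal d V) \<le> ?k" using V(4) by linarith
  moreover have "top_ideal d V \<in> ?X" unfolding jordan_cell_eq[OF P S] using V by blast
  ultimately show U0: "?U \<noteq> {}" by blast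
  show "?U \<inter> W \<noteq> {}" if W: "openin (cell_topology P) W" "W \<noteq> {}" for W
  proof (rule pullback_zariski_irreducible[OF inf _ _ U0 _ W(2)])
    show "openin (pullback_topology ?X (coords (C_exps P)) zariski) ?U"
      "openin (pullback_topology ?X (coords (C_exps P)) zariski) W"
      using U W(1) by (simp_all only: cell_topology_def)
    show "line_point v w l \<in> coords (C_exps P) ` ?X"
      if "v \<in> coords (C_exps P) ` ?X" "w \<in> coords (C_exps P) ` ?X" for v w l
      using that unfolding X P(2) coords_image_eq[OF S sub] by (rule cell_coords_line)
  qed
  show "num_gens I = ?k" if I: "I \<in> ?U" for I
  proof -
    have "I \<in> ?X" using I by blast
    then obtain V where V: "kvs.subspace V" "V \<subseteq> forms d" "lead_degs V = S" "I = top_ideal d V"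
      unfolding jordan_cell_eq[OF P S] by blast
    have "num_gens I + R1_dim V = card S + (d + 2)" using num_gens_top_ideal[OF V(1,2)] dim_eq_card_lead_degs[OF V(1,2)] V(3,4) by simp
    moreover have "R1_dim V + gap S (Suc d) \<le> d + 2"
      using R1_dim_le_gap_cell[OF V(1,2)] V(3) by simp
    ultimately show ?thesis using I by simp
  qed
qed

section \<open>The generic number of generators for a Hilbert function\<close>

lemma gap_initial: "n \<le> m \<Longrightarrow> gap {m..d} n = n + 1"
  by (induction n) auto

lemma gap_top_segment: "m + j \<le> Suc d \<Longrightarrow> gap {m..d} (m + j) = m + 1 - j"
  by (induction j) (auto simp: gap_initial)

text \<open>
  Lying in the chart of \<open>S\<close> means that a basis is independent from the nonpivot
  monomials. In this form it is an open condition on families of forms.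
\<close>

lemma complementary_if_indep_family:
  fixes w :: "nat \<Rightarrow> 'k::field poly poly"
  assumes S: "S \<subseteq> {..d}" and w: "\<And>b. b \<le> d \<Longrightarrow> w b \<in> forms d"
    and mon: "\<And>b. b \<in> {..d} - S \<Longrightarrow> w b = bimonom (dmon d b)" and ind: "indep_family {..d} w"
  shows "complementary d S (kvs.span (w ` S))"
proof -
  let ?N = "{..d} - S"
  note indp = indep_family_imp_independent[OF finite_atMost ind]
  have fin: "finite S" using S finite_subset by blast
  have N: "kvs.span (w ` ?N) = nonpivot_forms d S"
    unfolding span_bimonom[symmetric] image_image using mon by (intro arg_cong[of _ _ kvs.span] image_cong) auto
  have "kvs.span (w ` {..d}) = forms d"
  proof (rule kvs.subspace_eq_of_dim_le[OF kvs.subspace_span _ forms_subset_span])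
    show "kvs.span (w ` {..d}) \<subseteq> forms d" using w by (intro kvs.span_minimal subspace_forms) auto
    show "kvs.dim (forms d :: 'k poly poly set) \<le> kvs.dim (kvs.span (w ` {..d}))"
      using kvs.dim_span_eq_card_independent[OF indp(2)] card_image[OF indp(1)] by (simp add: dim_forms)
  qed simp
  moreover have "w ` {..d} = w ` ?N \<union> w ` S" using S by blast
  ultimately have sum: "forms d = {g + h | g h. g \<in> nonpivot_forms d S \<and> h \<in> kvs.span (w ` S)}"
    by (simp only: kvs.span_Un N)
  show ?thesis
    unfolding complementary_def
  proof (intro conjI subsetI ballI)
    fix f :: "'k poly poly" assume "f \<in> forms d"
    then obtain g h where "f = g + h" "g \<in> nonpivot_forms d S" "h \<in> kvs.span (w ` S)" unfolding sum by blast
    then show "\<exists>g\<in>nonpivot_forms d S. f - g \<in> kvs.span (w ` S)" by (intro bexI[of _ g]) simp_all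
  next
    fix f assume f: "f \<in> kvs.span (w ` S) \<inter> nonpivot_forms d S"
    obtain c where c: "f = (\<Sum>b\<in>S. smult [:c b:] (w b))"
      using span_image_coefficients[OF fin inj_on_subset[OF indp(1) S]] f by blast
    obtain e where e: "f = (\<Sum>b\<in>?N. smult [:e b:] (w b))"
      using span_image_coefficients[of ?N w f, OF _ inj_on_subset[OF indp(1)]] f N by auto
    let ?c = "\<lambda>b. if b \<in> S then c b else - e b"
    have "(\<Sum>b\<in>{..d}. smult [:?c b:] (w b)) = (\<Sum>b\<in>?N. smult [:?c b:] (w b)) + (\<Sum>b\<in>S. smult [:?c b:] (w b))"
      by (rule sum.subset_diff[OF S finite_atMost])
    also have "(\<Sum>b\<in>S. smult [:?c b:] (w b)) = f" unfolding c by (intro sum.cong) auto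
    also have "(\<Sum>b\<in>?N. smult [:?c b:] (w b)) = (\<Sum>b\<in>?N. - smult [:e b:] (w b))"
      by (intro sum.cong) auto
    finally have "(\<Sum>b\<in>{..d}. smult [:?c b:] (w b)) = 0" using e by (simp only: sum_negf add.left_inverse)
    then have "?c b = 0" if "b \<le> d" for b using indep_familyD[OF ind, of ?c b] that by simp
    then have "c b = 0" if "b \<in> S" for b using that S by (metis atMost_iff subsetD)
    then show "f \<in> {0}" unfolding c by (simp add: sum.neutral)
  qed
qed

text \<open>
  Move a basis of \<open>V0\<close> along a line to the pivot monomials of the chart. At the
  start the rank of the products is that of \<open>V0\<close>, at the end the subspace lies in
  the chart; both conditions are given by nonvanishing polynomials on the line, so they hold
  together at some point.
\<close>

lemma chart_meets_max_rank:
  fixes V0 :: "'k::field poly poly set"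
  assumes inf: "infinite (UNIV :: 'k set)" and S: "S \<subseteq> {..d}"
    and V0: "kvs.subspace V0" "V0 \<subseteq> forms d" "kvs.dim V0 = card S"
  obtains V :: "'k poly poly set" where "kvs.subspace V" "V \<subseteq> forms d" "complementary d S V"
    "R1_dim V0 \<le> R1_dim V"
proof -
  have fin: "finite S" using S finite_subset by blast
  obtain B where B: "B \<subseteq> V0" "kvs.independent B" "V0 \<subseteq> kvs.span B" "card B = kvs.dim V0"
    by (rule kvs.basis_exists)
  have finB: "finite B"
    using kvs.independent_span_bound[OF finite_bimonoms B(2)] B(1) subset_span_if_subset_forms[OF V0(2)] by blast
  obtain h where h: "bij_betw h S B"
    using finite_same_card_bij[OF fin finB] B(4) V0(3) by auto
  have spanB: "kvs.span B = V0" by (rule kvs.span_subspace[OF B(1) B(3) V0(1)])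
  have hV: "h b \<in> forms d" if "b \<in> S" for b
    using bij_betwE[OF h] that B(1) V0(2) by blast
  \<comment> \<open>The parameter space is a line: functions on the unit type are single field elements.\<close>
  define z :: "nat \<Rightarrow> (unit \<Rightarrow> 'k) \<Rightarrow> 'k poly poly" where
    "z = (\<lambda>b v. smult [:1 - v ():] (h b) + smult [:v ():] (bimonom (dmon d b)))"
  have zpoly: "(\<lambda>v. bicoeff (z b v) m) \<in> poly_functions" for b m
    unfolding z_def bicoeff_add bicoeff_smult
    by (intro poly_functions.add poly_functions.mult poly_functions_diff poly_functions.const poly_functions.coord)
  have zf: "z b v \<in> forms d" if "b \<in> S" for b v
    unfolding z_def using that S
    by (intro kvs.subspace_add[OF subspace_forms] kvs.subspace_scale[OF subspace_forms] hV bimonom_dmon_in_forms) auto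
  define v0 v1 :: "unit \<Rightarrow> 'k" where "v0 = (\<lambda>_. 0)" and "v1 = (\<lambda>_. 1)"
  have z0: "(\<lambda>b. z b v0) ` S = B"
  proof -
    have "z b v0 = h b" for b by (rule bipoly_eqI) (simp add: z_def v0_def)
    then show ?thesis using h by (simp add: bij_betw_def)
  qed
  have z1: "z b v1 = bimonom (dmon d b)" for b by (rule bipoly_eqI) (simp add: z_def v1_def)
  have "\<exists>p\<in>poly_functions. p v0 \<noteq> 0 \<and> (\<forall>v. p v \<noteq> 0 \<longrightarrow>
      R1_dim (kvs.span ((\<lambda>b. z b v0) ` S)) \<le> R1_dim (kvs.span ((\<lambda>b. z b v) ` S)))"
    by (rule R1_rank_lower_semicontinuous[OF fin zpoly zf])
  then obtain p where p: "p \<in> poly_functions" "p v0 \<noteq> 0"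
    "\<And>v. p v \<noteq> 0 \<Longrightarrow> R1_dim V0 \<le> R1_dim (kvs.span ((\<lambda>b. z b v) ` S))"
    unfolding z0 spanB by (elim bexE conjE) blast
  let ?w = "\<lambda>b v. if b \<in> S then z b v else bimonom (dmon d b)"
  have "\<exists>q\<in>poly_functions. q v1 \<noteq> 0 \<and> (\<forall>v. q v \<noteq> 0 \<longrightarrow> indep_family {..d} (\<lambda>b. ?w b v))"
  proof (rule indep_family_open[OF finite_atMost])
    show "(\<lambda>v. bicoeff (?w b v) m) \<in> poly_functions" for b m
      using zpoly[of b m] poly_functions.const by (cases "b \<in> S") auto
    have w1: "?w b v1 = bimonom (dmon d b)" for b using z1 by simp
    show "indep_family {..d} (\<lambda>b. ?w b v1)"
      unfolding indep_family_def w1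
    proof (intro allI impI ballI)
      fix c b assume zero: "(\<Sum>j\<in>{..d}. smult [:c j:] (bimonom (dmon d j) :: 'k poly poly)) = 0" and b: "b \<in> {..d}"
      have "bicoeff (\<Sum>j\<in>{..d}. smult [:c j:] (bimonom (dmon d j))) (dmon d b) = (\<Sum>j\<in>{..d}. if j = b then c b else 0)"
        unfolding bicoeff_sum by (intro sum.cong) auto
      then show "c b = 0" using zero b by simp
    qed
  qed
  then obtain q where q: "q \<in> poly_functions" "q v1 \<noteq> 0"
    "\<And>v. q v \<noteq> 0 \<Longrightarrow> indep_family {..d} (\<lambda>b. ?w b v)"
    by (elim bexE conjE) blast
  obtain l where l: "p (line_point v0 v1 l) \<noteq> 0" "q (line_point v0 v1 l) \<noteq> 0"
    using line_avoids_zero_loci[where p = p and q = q and v = v0 and w = v1, OF inf p(1) q(1) p(2) q(2)]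
    by (elim exE conjE)
  define V where "V = kvs.span ((\<lambda>b. z b (line_point v0 v1 l)) ` S)"
  have "complementary d S (kvs.span ((\<lambda>b. ?w b (line_point v0 v1 l)) ` S))"
    by (rule complementary_if_indep_family[OF S _ _ q(3)[OF l(2)]]) (auto simp: zf bimonom_dmon_in_forms)
  then have "complementary d S V" by (simp add: V_def cong: image_cong)
  moreover have "V \<subseteq> forms d"
    unfolding V_def using zf by (intro kvs.span_minimal subspace_forms) blast
  moreover have "kvs.subspace V" by (simp add: V_def)
  moreover have "R1_dim V0 \<le> R1_dim V" unfolding V_def by (rule p(3)[OF l(1)])
  ultimately show thesis using that by blast
qed

lemma dim_R1_span_le:
  fixes V :: "'k::field poly poly set"
  assumes "kvs.subspace V" "V \<subseteq> forms d"
  shows "R1_dim V \<le> 2 * kvs.dim V" "R1_dim V \<le> d + 2"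
proof -
  obtain B where B: "B \<subseteq> V" "kvs.independent B" "V \<subseteq> kvs.span B" "card B = kvs.dim V"
    by (rule kvs.basis_exists)
  have finB: "finite B"
    using kvs.independent_span_bound[OF finite_bimonoms B(2)] B(1) subset_span_if_subset_forms[OF assms(2)] by blast
  have "kvs.span B = V" by (rule kvs.span_subspace[OF B(1) B(3) assms(1)])
  then have "R1_span V = R1_span B" using R1_span_span by metis
  also have "\<dots> = kvs.span ((*) varx ` B \<union> (*) vary ` B)" by (simp only: R1_span_def)
  finally have "R1_dim V \<le> card ((*) varx ` B \<union> (*) vary ` B)"
    using finB by (intro kvs.dim_le_card) auto
  also have "\<dots> \<le> card ((*) varx ` B) + card ((*) vary ` B)" by (rule card_Un_le)
  also have "\<dots> \<le> card B + card B" using finB by (intro add_mono card_image_le)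
  finally show "R1_dim V \<le> 2 * kvs.dim V" using B(4) by simp
  show "R1_dim V \<le> d + 2"
    using dim_le_if_subset_forms[OF R1_span_subset_forms[OF assms(2)]] by simp
qed

text \<open>
  The pivots $\{t, \ldots, d\}$ make the walk first go up \<open>t\<close> times and then down
  $d + 1 - t$ times, so the cell with these pivots contains a \<open>V\<close> for which the
  dimension of $R_1 V$ reaches the trivial bounds. Every chart contains such a \<open>V\<close>
  too, and in a chart nonempty open sets meet.
\<close>

lemma kappa_hilbert_T_seq:
  assumes inf: "infinite (UNIV :: 'k::field set)" and t: "1 \<le> t" "t \<le> d"
  shows "kappa_hilbert TYPE('k) (T_seq d t) = (d + 1 - t) + (d + 2 - 2 * (d + 1 - t))"
  unfolding kappa_hilbert_def
proof (rule generic_num_gensI)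
  let ?s = "d + 1 - t"
  let ?k = "?s + (d + 2 - 2 * ?s)"
  let ?G = "graded_ideals (T_seq d t) :: 'k poly poly set set"
  let ?U = "{I \<in> ?G. num_gens I \<le> ?k}"
  let ?C = "\<lambda>S. chart (T_seq d t) (basis_exps d S) :: 'k poly poly set set"
  let ?img = "\<lambda>S. (\<lambda>v. top_ideal d (chart_space d S v)) ` chart_coords d S :: 'k poly poly set set"
  have U_chart: "?U \<inter> chart (T_seq d t) C = {I \<in> chart (T_seq d t) C. num_gens I \<le> ?k}" for C
    by (auto simp: chart_def)
  show U: "openin (graded_ideals_topology (T_seq d t)) ?U"
    unfolding openin_graded_ideals_topology
  proof (intro conjI allI)
    fix C
    show "openin (chart_topology (T_seq d t) C) (?U \<inter> chart (T_seq d t) C)"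
    proof (cases "chart (T_seq d t) C = ({} :: 'k poly poly set set)")
      case True
      then show ?thesis by simp
    next
      case False
      then obtain I where "I \<in> (chart (T_seq d t) C :: 'k poly poly set set)" by blast
      then obtain S where S: "S \<subseteq> {..d}" "C = basis_exps d S" "card S = ?s"
        using chart_structure[OF t(2)] by metis
      have "openin (pullback_topology (?C S) (coords (basis_exps d S)) zariski) {I \<in> ?C S. num_gens I \<le> ?k}"
        unfolding chart_eq_image[OF t(2) S(1,3)]
        by (rule openin_few_generators[OF S(1) order_refl])
      then show ?thesis by (simp only: U_chart chart_topology_def S(2))
    qed
  qed auto
  obtain V0 :: "'k poly poly set" where V0: "kvs.subspace V0" "V0 \<subseteq> forms d" "lead_degs V0 = {t..d}"
    "R1_dim V0 + gap {t..d} (Suc d) = d + 2"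
    using cell_attains_gap[of "{t..d}" d, where 'k='k] by auto
  have dimV0: "kvs.dim V0 = ?s"
    using dim_eq_card_lead_degs[OF V0(1,2)] V0(3) by simp
  have "gap {t..d} (Suc d) = t + 1 - ?s" using gap_top_segment[of t ?s d] t(2) by simp
  then have rank0: "R1_dim V0 + (d + 2 - 2 * ?s) = d + 2" using V0(4) t by simp
  have few: "top_ideal d V \<in> ?U"
    if V: "kvs.subspace V" "V \<subseteq> forms d" "kvs.dim V = ?s" "R1_dim V0 \<le> R1_dim V" for V
  proof -
    have "top_ideal d V \<in> ?G" unfolding graded_ideals_T_seq[OF t(2)] using V by blast
    moreover have "num_gens (top_ideal d V) \<le> ?k"
      using num_gens_top_ideal[OF V(1,2)] V(3,4) rank0 by linarith
    ultimately show ?thesis by blast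
  qed
  show "?U \<noteq> {}" using few[OF V0(1,2) dimV0] by blast
  show "num_gens I = ?k" if I: "I \<in> ?U" for I
  proof -
    have "I \<in> ?G" using I by blast
    then obtain V where V: "kvs.subspace V" "V \<subseteq> forms d" "kvs.dim V = ?s" "I = top_ideal d V"
      unfolding graded_ideals_T_seq[OF t(2)] by blast
    have "num_gens I + R1_dim V = ?s + (d + 2)" using num_gens_top_ideal[OF V(1,2)] V(3,4) by simp
    moreover have "num_gens I \<le> ?k" using I by blast
    ultimately show ?thesis using dim_R1_span_le[OF V(1,2)] V(3) by linarith
  qed
  show "?U \<inter> W \<noteq> {}" if W: "openin (graded_ideals_topology (T_seq d t)) W" "W \<noteq> {}" for W
  proof -
    obtain I where I: "I \<in> W" using W(2) by blast
    have WG: "W \<subseteq> ?G" and Wc: "\<And>C. openin (chart_topology (T_seq d t) C) (W \<inter> chart (T_seq d t) C)"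
      using W(1) unfolding openin_graded_ideals_topology by blast+
    have "I \<in> ?G" using I WG by blast
    then obtain V where V: "kvs.subspace V" "V \<subseteq> forms d" "kvs.dim V = ?s" "I = top_ideal d V"
      unfolding graded_ideals_T_seq[OF t(2)] by blast
    define S where "S = lead_degs V"
    have S: "S \<subseteq> {..d}" unfolding S_def by (rule lead_degs_subset[OF V(2)])
    have comp: "complementary d S V" unfolding S_def by (rule complementary_lead_degs[OF V(1,2)])
    have cS: "card S = ?s" using dim_complementary[OF V(1,2) comp S] V(3) by simp
    have "I \<in> ?C S"
      using \<open>I \<in> ?G\<close> monomial_basis_mod_top_ideal[OF V(1) comp] V(4) by (simp add: chart_def)
    then have Wne: "W \<inter> ?C S \<noteq> {}" using I by blast
    have "kvs.dim V0 = card S" using dimV0 cS by simp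
    then obtain V1 :: "'k poly poly set" where V1: "kvs.subspace V1" "V1 \<subseteq> forms d" "complementary d S V1"
      "R1_dim V0 \<le> R1_dim V1"
      by (rule chart_meets_max_rank[OF inf S V0(1,2)])
    have "kvs.dim V1 = ?s" using dim_complementary[OF V1(1-3) S] cS by simp
    then have "top_ideal d V1 \<in> ?U" using few V1 by blast
    moreover from this have "top_ideal d V1 \<in> ?C S"
      using monomial_basis_mod_top_ideal[OF V1(1,3)] by (simp add: chart_def)
    ultimately have Une: "?U \<inter> ?C S \<noteq> {}" by blast
    have "(?U \<inter> ?C S) \<inter> (W \<inter> ?C S) \<noteq> {}"
    proof (rule pullback_zariski_irreducible[OF inf _ _ Une _ Wne])
      show "openin (pullback_topology (?C S) (coords (basis_exps d S)) zariski) (?U \<inter> ?C S)"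
        using U unfolding openin_graded_ideals_topology chart_topology_def by blast
      show "openin (pullback_topology (?C S) (coords (basis_exps d S)) zariski) (W \<inter> ?C S)"
        using Wc[of "basis_exps d S"] unfolding chart_topology_def .
      show "line_point v w l \<in> coords (basis_exps d S) ` ?C S"
        if "v \<in> coords (basis_exps d S) ` ?C S" "w \<in> coords (basis_exps d S) ` ?C S" for v w l
        using that unfolding chart_eq_image[OF t(2) S cS] coords_image_eq[OF S order_refl] by (rule chart_coords_line)
    qed
    then show ?thesis by blast
  qed
qed

section \<open>Counting pivot sets\<close>

lemma subsets_of_size_Suc:
  fixes n s :: nat
  shows "{S. S \<subseteq> {..<Suc n} \<and> card S = Suc s \<and> Q S} =
    {S. S \<subseteq> {..<n} \<and> card S = Suc s \<and> Q S} \<union> insert n ` {S. S \<subseteq> {..<n} \<and> card S = s \<and> Q (insert n S)}"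
    (is "?A = ?B \<union> insert n ` ?C")
proof
  show "?A \<subseteq> ?B \<union> insert n ` ?C"
  proof
    fix S assume S: "S \<in> ?A"
    show "S \<in> ?B \<union> insert n ` ?C"
    proof (cases "n \<in> S")
      case False
      then show ?thesis using S by (auto simp: lessThan_Suc)
    next
      case True
      have S': "S \<subseteq> insert n {..<n}" "card S = Suc s" "Q S" using S by (auto simp: lessThan_Suc)
      have "finite S" using S'(1) finite_subset by blast
      then have "card (S - {n}) = s" using card.remove[of S n] True S'(2) by simp
      moreover have eq: "insert n (S - {n}) = S" using True by blast
      moreover have "S - {n} \<subseteq> {..<n}" using S'(1) by blast
      ultimately have "S - {n} \<in> ?C" using S'(3) by simp
      then show ?thesis using eq by (intro UnI2 rev_image_eqI[of "S - {n}"]) simp_all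
    qed
  qed
  have "card (insert n S) = Suc (card S)" if "S \<subseteq> {..<n}" for S
  proof -
    have "finite S" "n \<notin> S" using that finite_subset[of S "{..<n}"] by auto
    then show ?thesis by simp
  qed
  then show "?B \<union> insert n ` ?C \<subseteq> ?A" by (auto simp: lessThan_Suc)
qed

lemma gap_insert_ge: "n \<le> m \<Longrightarrow> gap (insert m S) n = gap S n"
  by (induction n) auto

text \<open>
  The last step decides: without \<open>n\<close> in the set the walk must reach $m - 1$ before,
  with \<open>n\<close> it must reach $m + 1$, and the two counts add up by Pascal's rule. The
  condition on \<open>m\<close> and \<open>s\<close> is inherited by both. For $m = 0$ all sets of
  the given size are counted.
\<close>

lemma card_gap_ge:
  assumes "m = 0 \<or> n + 2 \<le> m + 2 * s"
  shows "card {S. S \<subseteq> {..<n} \<and> card S = s \<and> m \<le> gap S n} = n choose (s + m)"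
  using assms
proof (induction n arbitrary: s m)
  case 0
  have "{S. S \<subseteq> {..<0::nat} \<and> card S = s \<and> m \<le> gap S 0} = (if s = 0 \<and> m \<le> 1 then {{}} else {})"
    by auto
  then show ?case using 0 by (simp only:) (cases s; cases m; simp)
next
  case (Suc n)
  let ?F = "\<lambda>n s m. {S. S \<subseteq> {..<n} \<and> card S = s \<and> m \<le> gap S n}"
  have fin: "finite (?F n s m)" for n s m
    by (rule finite_subset[of _ "Pow {..<n}"]) auto
  show ?case
  proof (cases "m = 0")
    case True
    then have "?F (Suc n) s m = {S. S \<subseteq> {..<Suc n} \<and> card S = s}" by auto
    then show ?thesis using True n_subsets[of "{..<Suc n}" s] by simp
  next
    case False
    have skip: "gap S (Suc n) = gap S n + 1" if "S \<subseteq> {..<n}" for S using that by auto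
    have eq1: "{S. S \<subseteq> {..<n} \<and> card S = s \<and> m \<le> gap S (Suc n)} = ?F n s (m - 1)" for s
      using skip False by (auto simp del: gap.simps)
    have IH1: "card (?F n s (m - 1)) = n choose (s + (m - 1))"
      using Suc.prems False by (intro Suc.IH) auto
    show ?thesis
    proof (cases s)
      case 0
      have "n + 3 \<le> m" using Suc.prems False 0 by simp
      have sub: "S = {}" if "S \<subseteq> {..<Suc n}" "card S = 0" for S :: "nat set"
        using that finite_subset[OF that(1)] by simp
      have "?F (Suc n) s m = {S. S \<subseteq> {..<n} \<and> card S = s \<and> m \<le> gap S (Suc n)}"
        using 0 sub by (auto simp del: gap.simps)
      then have "card (?F (Suc n) s m) = n choose (s + (m - 1))" unfolding eq1 using IH1 by simp
      then show ?thesis using \<open>n + 3 \<le> m\<close> 0 by (simp add: binomial_eq_0)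
    next
      case (Suc s')
      have take: "gap (insert n S) (Suc n) = gap S n - 1" for S by (simp add: gap_insert_ge)
      have eq2: "{S. S \<subseteq> {..<n} \<and> card S = s' \<and> m \<le> gap (insert n S) (Suc n)} = ?F n s' (m + 1)"
        unfolding take using False by auto
      have IH2: "card (?F n s' (m + 1)) = n choose (s' + (m + 1))"
        using Suc.prems False Suc by (intro Suc.IH) auto
      have Feq: "?F (Suc n) s m = ?F n s (m - 1) \<union> insert n ` ?F n s' (m + 1)"
        unfolding Suc subsets_of_size_Suc[of n s' "\<lambda>S. m \<le> gap S (Suc n)"] eq2 using eq1[of "Suc s'"] by simp
      have "card (?F (Suc n) s m) = card (?F n s (m - 1)) + card (insert n ` ?F n s' (m + 1))"
        unfolding Feq using fin by (intro card_Un_disjoint) auto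
      also have "card (insert n ` ?F n s' (m + 1)) = card (?F n s' (m + 1))"
      proof (rule card_image, rule inj_onI)
        fix A B assume "A \<in> ?F n s' (m + 1)" "B \<in> ?F n s' (m + 1)" and eq: "insert n A = insert n B"
        then have "n \<notin> A" "n \<notin> B" by auto
        then show "A = B" using eq by (metis insert_ident)
      qed
      also have "card (?F n s (m - 1)) + card (?F n s' (m + 1)) = (n choose (s + (m - 1))) + (n choose (s' + (m + 1)))"
        unfolding IH1 IH2 ..
      also have "\<dots> = Suc n choose (s + m)"
      proof -
        have "s + (m - 1) = s' + m" "s' + (m + 1) = Suc (s' + m)" "s + m = Suc (s' + m)" using Suc False by auto
        then show ?thesis by (simp only: binomial_Suc_Suc)
      qed
      finally show ?thesis .
    qed
  qed
qed

text \<open>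
  Equality would hold without the reflection at 0, which only raises the walk.
\<close>

lemma gap_lower_bound:
  "S \<subseteq> {..<n} \<Longrightarrow> n + 1 \<le> gap S n + 2 * card S"
proof (induction n arbitrary: S)
  case (Suc n)
  have fin: "finite S" using Suc.prems finite_subset by blast
  show ?case
  proof (cases "n \<in> S")
    case False
    then have "S \<subseteq> {..<n}" using Suc.prems by (auto simp: less_Suc_eq)
    then show ?thesis using Suc.IH False by fastforce
  next
    case True
    have "S - {n} \<subseteq> {..<n}" using Suc.prems by (auto simp: less_Suc_eq)
    then have "n + 1 \<le> gap (S - {n}) n + 2 * card (S - {n})" by (rule Suc.IH)
    moreover have "gap S n = gap (S - {n}) n"
      using gap_insert_ge[of n n "S - {n}"] True by (simp add: insert_absorb)
    moreover have "card S = Suc (card (S - {n}))" using card.remove[OF fin True] .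
    moreover have "gap S (Suc n) = gap S n - 1" using True by simp
    ultimately show ?thesis by linarith
  qed
qed simp

section \<open>Partitions with a given generic number of generators\<close>

theorem corollary4p3:
  fixes d t s \<delta> k :: nat
  assumes field: "CHAR('k::field) = 0 \<or> infinite (UNIV :: 'k set) \<and> CHAR('k) > d"
    and t: "1 \<le> t" "t \<le> d"
    and s: "int s = int d + 1 - int t"
    and delta: "int \<delta> = max (int t + 1 - int s) 0"
    and k: "k > 0"
  shows "int (mu TYPE('k) (T_seq d t) k) =
           (if k = s + \<delta> then int ((s + t) choose s) - int ((s + t) choose (s + \<delta> + 1))
            else if s + \<delta> < k \<and> k \<le> s + t then int ((s + t) choose k) - int ((s + t) choose (k + 1))
            else 0) \<and>
         (\<forall>P. is_partition P \<and> diagonal_lengths TYPE('k) P = T_seq d t \<longrightarrow>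
           (non_special TYPE('k) P \<longleftrightarrow> kappa TYPE('k) P = s + \<delta>))"
proof -
  have inf: "infinite (UNIV :: 'k set)"
  proof
    assume "finite (UNIV :: 'k set)"
    then have "CHAR('k) > 0" by (rule finite_imp_CHAR_pos)
    then show False using field \<open>finite (UNIV :: 'k set)\<close> by auto
  qed
  have s': "s = d + 1 - t" "s + t = Suc d" and delta': "\<delta> = t + 1 - s" "\<delta> = d + 2 - 2 * s"
    using s delta t by linarith+
  have td: "t \<le> d + 1" using t by simp
  let ?A = "{P. is_partition P \<and> diagonal_lengths TYPE('k) P = T_seq d t}"
  let ?Ss = "{S. S \<subseteq> {..d} \<and> card S = s}"
  have bij: "bij_betw (pivots d) ?A ?Ss" using bij_betw_pivots[OF td, where 'k='k] s' by simp
  have kap: "kappa TYPE('k) P = s + gap (pivots d P) (Suc d)" if P: "P \<in> ?A" for P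
  proof -
    have "C_exps P = basis_exps d (pivots d P) \<and> card (pivots d P) = d + 1 - t"
      using P diagonal_lengths_eq_T_seq_iff[OF _ td, where 'k='k] by blast
    then show ?thesis using kappa_eq_card_plus_gap[OF inf _ _ pivots_subset, of P d] P s' by simp
  qed
  have "non_special TYPE('k) P \<longleftrightarrow> kappa TYPE('k) P = s + \<delta>" if "P \<in> ?A" for P
    using that kappa_hilbert_T_seq[OF inf t] s' delta' by (simp add: non_special_def)
  moreover have "int (mu TYPE('k) (T_seq d t) k) =
           (if k = s + \<delta> then int ((s + t) choose s) - int ((s + t) choose (s + \<delta> + 1))
            else if s + \<delta> < k \<and> k \<le> s + t then int ((s + t) choose k) - int ((s + t) choose (k + 1))
            else 0)"
  proof -
    let ?N = "\<lambda>m. card {S. S \<subseteq> {..<Suc d} \<and> card S = s \<and> m \<le> gap S (Suc d)}"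
    have fin: "finite {S. S \<subseteq> {..<Suc d} \<and> Q S}" for Q :: "nat set \<Rightarrow> bool"
      by (rule finite_subset[of _ "Pow {..<Suc d}"]) auto
    have N: "?N m = (s + t) choose (s + m)" if "m = 0 \<or> \<delta> < m" for m
    proof -
      have "m = 0 \<or> Suc d + 2 \<le> m + 2 * s" using that delta' by linarith
      then show ?thesis unfolding s'(2) by (rule card_gap_ge)
    qed
    have N0: "?N m = (s + t) choose s" if "m \<le> \<delta>" for m
    proof -
      have "m \<le> gap S (Suc d)" if "S \<subseteq> {..<Suc d}" "card S = s" for S
        using gap_lower_bound[OF that(1)] that(2) delta' \<open>m \<le> \<delta>\<close> by linarith
      then have "{S. S \<subseteq> {..<Suc d} \<and> card S = s \<and> m \<le> gap S (Suc d)} = {S. S \<subseteq> {..<Suc d} \<and> card S = s \<and> 0 \<le> gap S (Suc d)}"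
        by blast
      then show ?thesis using N[of 0] by simp
    qed
    have mu: "mu TYPE('k) (T_seq d t) k = card {S \<in> ?Ss. s + gap S (Suc d) = k}"
    proof -
      have "{S \<in> ?Ss. s + gap S (Suc d) = k} = pivots d ` {P \<in> ?A. s + gap (pivots d P) (Suc d) = k}"
        unfolding bij_betw_imp_surj_on[OF bij, symmetric] by blast
      moreover have "{P \<in> ?A. s + gap (pivots d P) (Suc d) = k} = {P \<in> ?A. kappa TYPE('k) P = k}"
        by (intro Collect_cong conj_cong refl) (simp only: kap)
      moreover have "card (pivots d ` {P \<in> ?A. kappa TYPE('k) P = k}) = card {P \<in> ?A. kappa TYPE('k) P = k}"
        by (rule card_image[OF inj_on_subset[OF bij_betw_imp_inj_on[OF bij]]]) blast
      ultimately show ?thesis by (simp only: mu_def mem_Collect_eq conj_assoc)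
    qed
    show ?thesis
    proof (cases "s \<le> k")
      case True
      have split: "{S. S \<subseteq> {..<Suc d} \<and> card S = s \<and> k - s \<le> gap S (Suc d)} =
          {S \<in> ?Ss. s + gap S (Suc d) = k} \<union> {S. S \<subseteq> {..<Suc d} \<and> card S = s \<and> k - s + 1 \<le> gap S (Suc d)}"
        using True by (auto simp: lessThan_Suc_atMost simp del: gap.simps)
      have "?N (k - s) = card {S \<in> ?Ss. s + gap S (Suc d) = k} + ?N (k - s + 1)"
        unfolding split
      proof (rule card_Un_disjoint)
        show "finite {S \<in> ?Ss. s + gap S (Suc d) = k}"
          by (rule finite_subset[of _ "Pow {..d}"]) auto
        show "{S \<in> ?Ss. s + gap S (Suc d) = k} \<inter>
            {S. S \<subseteq> {..<Suc d} \<and> card S = s \<and> k - s + 1 \<le> gap S (Suc d)} = {}" by auto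
      qed (rule fin)
      then have eq: "int (mu TYPE('k) (T_seq d t) k) = int (?N (k - s)) - int (?N (k - s + 1))"
        unfolding mu by simp
      consider "k < s + \<delta>" | "k = s + \<delta>" | "s + \<delta> < k" "k \<le> s + t" | "s + t < k" "s + \<delta> < k" by linarith
      then show ?thesis
      proof cases
        case 1
        then have "k - s \<le> \<delta>" "k - s + 1 \<le> \<delta>" using True by linarith+
        then show ?thesis unfolding eq N0[OF \<open>k - s \<le> \<delta>\<close>] N0[OF \<open>k - s + 1 \<le> \<delta>\<close>] using 1 by simp
      next
        case 2
        then have le: "k - s \<le> \<delta>" and gt: "k - s + 1 = 0 \<or> \<delta> < k - s + 1" using True by linarith+
        show ?thesis unfolding eq N0[OF le] N[OF gt] using 2 by (simp add: algebra_simps)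
      next
        case 3
        then have gt: "k - s = 0 \<or> \<delta> < k - s" "k - s + 1 = 0 \<or> \<delta> < k - s + 1" by linarith+
        show ?thesis unfolding eq N[OF gt(1)] N[OF gt(2)] using 3 True by simp
      next
        case 4
        then have gt: "k - s = 0 \<or> \<delta> < k - s" "k - s + 1 = 0 \<or> \<delta> < k - s + 1" by linarith+
        show ?thesis unfolding eq N[OF gt(1)] N[OF gt(2)] using 4 True by (simp add: binomial_eq_0)
      qed
    next
      case False
      then have "{S \<in> ?Ss. s + gap S (Suc d) = k} = {}" by auto
      then show ?thesis using False unfolding mu by simp
    qed
  qed
  ultimately show ?thesis by blast
qed

end
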